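(* Let $F=x_0^ax_1^bx_2^c\in\mathbb{C}[x_0,x_1,x_2]$ with $0<a\leq b\leq c$ and let $r=(a+1)(b+1)=\underline{\mathbf{rk}}(F)$. If $c=a+b-1$, then $\underline{\mathrm{VSP}}(F,r)$ is of fiber type. Furthermore: (i) if $a=b=1$, then $\underline{\mathrm{VSP}}(F,4)\cong\mathrm{VPS}(F,4)\cong\mathbb{P}(\mathrm{Ann}(F)_2)=\mathbb{P}^2$; (ii) if $a=1<b$, then $\mathrm{VPS}(F,2(b+1))=\{\mathrm{Proj}(S/(y_0^2,sy_1^{b+1}+ty_2^{b+1})):[s:t]\in\mathbb{P}^1\}\cong\mathbb{P}^1$; (iii) if $a\geq 2$, then $\mathrm{VPS}(F,r)=\{\mathrm{Proj}(S/(y_0^{a+1},y_1^{b+1}))\}$.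
   Context: $X=\mathbb{P}^2$; $S=\mathbb{C}[y_0,y_1,y_2]$ and $T=\mathbb{C}[x_0,x_1,x_2]$ are standard graded, $S$ acting on $T$ by differentiation ($y_i\circ x_j=\delta_{ij}$); $\mathrm{Ann}(F)=\{\psi\in S:\psi\circ F=0\}$. $\underline{\mathbf{rk}}(F)$ is the border rank of $F$ with respect to the Veronese embedding $\nu_{\deg F}(\mathbb{P}^2)$ (least $r$ with $[F]$ in the $r$-th secant variety); for monomials as in the claim it is known that $\underline{\mathbf{rk}}(F)=(a+1)(b+1)$. $h_{r,\mathbb{P}^2}(k)=\min\{r,\dim_{\mathbb C}S_k\}$; $\mathrm{Slip}_{r,\mathbb{P}^2}$ is the irreducible component of the multigraded Hilbert scheme $\mathrm{Hilb}_S^{h_{r,\mathbb{P}^2}}$ (of homogeneous ideals whose quotient has Hilbert function $h_{r,\mathbb{P}^2}$) that is the closure of the locus of saturated ideals of $r$ distinct points with Hilbert function $h_{r,\mathbb{P}^2}$. $\underline{\mathrm{VSP}}(F,r)=\{J\in\mathrm{Slip}_{r,\mathbb{P}^2}:J\subset\mathrm{Ann}(F)\}$, with reduced structure. $\mathrm{VPS}(F,r)=\{Z\in\mathrm{Hilb}^r(\mathbb{P}^2):I_Z\subset\mathrm{Ann}(F)\}$, $I_Z$ being the saturated ideal of $Z$. $\phi_{r,\mathbb{P}^2}\colon\mathrm{Slip}_{r,\mathbb{P}^2}\to\mathrm{Hilb}^r(\mathbb{P}^2)$ sends $J$ to $\mathrm{Proj}(S/J)$. $\underline{\mathrm{VSP}}(F,r)$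 is of fiber type if $\underline{\mathrm{VSP}}(F,r)=\phi_{r,\mathbb{P}^2}^{-1}(\mathrm{VPS}(F,r))$. *)

theory Defs
  imports "HOL-Analysis.Analysis" "HOL-Library.Poly_Mapping" "HOL-Library.Numeral_Type"
begin

section \<open>Ternary polynomials over the complex numbers\<close>

text \<open>
  The rings \<open>S\<close> and \<open>T\<close> share one carrier type. The index type \<open>3\<close> has the elements
  \<open>0\<close>, \<open>1\<close>, \<open>2\<close>; exponent vectors have type \<open>3 \<Rightarrow>\<^sub>0 nat\<close>.
\<close>

type_synonym expo = "3 \<Rightarrow>\<^sub>0 nat"
type_synonym tpoly = "expo \<Rightarrow>\<^sub>0 complex"

abbreviation coef :: "('a \<Rightarrow>\<^sub>0 'b::zero) \<Rightarrow> 'a \<Rightarrow> 'b"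
  where "coef \<equiv> Poly_Mapping.lookup"

abbreviation supp :: "('a \<Rightarrow>\<^sub>0 'b::zero) \<Rightarrow> 'a set"
  where "supp \<equiv> Poly_Mapping.keys"

definition Var :: "3 \<Rightarrow> tpoly"
  where "Var i = Poly_Mapping.single (Poly_Mapping.single i 1) 1"

definition monomial_poly :: "expo \<Rightarrow> tpoly"
  where "monomial_poly m = Poly_Mapping.single m 1"

definition pscale :: "complex \<Rightarrow> tpoly \<Rightarrow> tpoly"
  where "pscale c p = Poly_Mapping.single 0 c * p"

interpretation tpoly: vector_space pscale
proof
  show "pscale a (x + y) = pscale a x + pscale a y" for a x y
    by (simp add: pscale_def distrib_left)
  show "pscale (a + b) x = pscale a x + pscale b x" for a b x
    by (simp add: pscale_def single_add distrib_right)
  show "pscale a (pscale b x) = pscale (a * b) x" for a b x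
    by (simp add: pscale_def mult.assoc[symmetric] mult_single)
  show "pscale 1 x = x" for x
    by (simp add: pscale_def)
qed

text \<open>The ring as a module over itself: its submodules are the ideals.\<close>

interpretation tideal: module "(*) :: tpoly \<Rightarrow> tpoly \<Rightarrow> tpoly"
  by unfold_locales (simp_all add: algebra_simps)

definition mdeg :: "expo \<Rightarrow> nat"
  where "mdeg m = (\<Sum>i\<in>UNIV. coef m i)"

definition graded_piece :: "nat \<Rightarrow> tpoly set"
  where "graded_piece k = {p. \<forall>m\<in>supp p. mdeg m = k}"

definition hom_component :: "nat \<Rightarrow> tpoly \<Rightarrow> tpoly"
  where "hom_component k p =
    (\<Sum>m \<in> {m \<in> supp p. mdeg m = k}. Poly_Mapping.single m (coef p m))"

definition poly_eval :: "tpoly \<Rightarrow> complex ^ 3 \<Rightarrow> complex"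
  where "poly_eval p v = (\<Sum>m\<in>supp p. coef p m * (\<Prod>i\<in>UNIV. (v $ i) ^ coef m i))"


section \<open>Apolarity\<close>

definition pdiff :: "3 \<Rightarrow> tpoly \<Rightarrow> tpoly"
  where "pdiff i F = (\<Sum>m\<in>supp F.
    Poly_Mapping.single (m - Poly_Mapping.single i 1) (of_nat (coef m i) * coef F m))"

definition apolar_act :: "tpoly \<Rightarrow> tpoly \<Rightarrow> tpoly"
  where "apolar_act \<psi> F = (\<Sum>m\<in>supp \<psi>. pscale (coef \<psi> m)
    ((pdiff 0 ^^ coef m 0) ((pdiff 1 ^^ coef m 1) ((pdiff 2 ^^ coef m 2) F))))"

definition Ann :: "tpoly \<Rightarrow> tpoly set"
  where "Ann F = {\<psi>. apolar_act \<psi> F = 0}"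


section \<open>Homogeneous ideals and closed subschemes of the plane\<close>

definition homogeneous_ideal :: "tpoly set \<Rightarrow> bool"
  where "homogeneous_ideal I \<longleftrightarrow> tideal.subspace I \<and> (\<forall>p\<in>I. \<forall>k. hom_component k p \<in> I)"

text \<open>The Hilbert function of the quotient of the polynomial ring by \<open>I\<close>.\<close>

definition hilbert_function :: "tpoly set \<Rightarrow> nat \<Rightarrow> nat"
  where "hilbert_function I k = tpoly.dim (graded_piece k) - tpoly.dim (I \<inter> graded_piece k)"

definition saturation :: "tpoly set \<Rightarrow> tpoly set"
  where "saturation I = {p. \<exists>n. \<forall>q\<in>graded_piece n. q * p \<in> I}"

text \<open>
  A closed subscheme \<open>Z\<close> of the projective plane is represented by its saturated homogeneous
  ideal \<open>I\<^sub>Z\<close>. For a homogeneous ideal \<open>I\<close>, the saturated ideal of \<open>Proj (S/I)\<close> is the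
  saturation of \<open>I\<close>.
\<close>

definition Proj_quot :: "tpoly set \<Rightarrow> tpoly set"
  where "Proj_quot I = saturation I"


section \<open>Spaces with functions\<close>

text \<open>
  A reduced complex variety is represented by its closed points, its Zariski topology and its
  sheaf of regular complex-valued functions. The structure is generated from a collection of
  local coordinates, that is, pairs of a domain and a function on it: the rational expressions
  in the coordinates form the smallest family that contains the coordinates and is closed under
  the ring operations and under inversion away from the zeros. Their domains (a family closed
  under finite intersections) form a basis of the topology; a function is regular when it is
  locally such an expression. Generating from the same coordinates on a subset of the points
  gives the reduced induced structure on a locally closed subset.
\<close>

record 'a fspace =
  fs_top :: "'a topology"
  fs_regular :: "'a set \<Rightarrow> ('a \<Rightarrow> complex) \<Rightarrow> bool"

inductive rational_expr ::
  "'a set \<Rightarrow> ('a set \<times> ('a \<Rightarrow> complex)) set \<Rightarrow> 'a set \<Rightarrow> ('a \<Rightarrow> complex) \<Rightarrow> bool"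
  for X :: "'a set" and G :: "('a set \<times> ('a \<Rightarrow> complex)) set"
  where
    coord: "(U, g) \<in> G \<Longrightarrow> rational_expr X G (U \<inter> X) g"
  | const: "rational_expr X G X (\<lambda>_. c)"
  | add: "rational_expr X G U f \<Longrightarrow> rational_expr X G V g \<Longrightarrow>
      rational_expr X G (U \<inter> V) (\<lambda>x. f x + g x)"
  | mult: "rational_expr X G U f \<Longrightarrow> rational_expr X G V g \<Longrightarrow>
      rational_expr X G (U \<inter> V) (\<lambda>x. f x * g x)"
  | inverse: "rational_expr X G U f \<Longrightarrow>
      rational_expr X G {x \<in> U. f x \<noteq> 0} (\<lambda>x. inverse (f x))"

definition generated_fspace :: "'a set \<Rightarrow> ('a set \<times> ('a \<Rightarrow> complex)) set \<Rightarrow> 'a fspace"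
  where "generated_fspace X G = \<lparr>
    fs_top = topology_generated_by {U. \<exists>g. rational_expr X G U g},
    fs_regular = (\<lambda>V f. \<forall>x\<in>V. \<exists>U g. rational_expr X G U g \<and> x \<in> U \<and> U \<subseteq> V \<and>
      (\<forall>y\<in>U. f y = g y)) \<rparr>"

definition fs_isomorphism :: "'a fspace \<Rightarrow> 'b fspace \<Rightarrow> ('a \<Rightarrow> 'b) \<Rightarrow> bool"
  where "fs_isomorphism X Y f \<longleftrightarrow>
    homeomorphic_map (fs_top X) (fs_top Y) f \<and>
    (\<forall>V g. openin (fs_top Y) V \<longrightarrow>
      (fs_regular Y V g \<longleftrightarrow> fs_regular X {x \<in> topspace (fs_top X). f x \<in> V} (g \<circ> f)))"

definition fs_isomorphic :: "'a fspace \<Rightarrow> 'b fspace \<Rightarrow> bool"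
    (infix \<open>\<cong>\<^sub>f\<^sub>s\<close> 50)
  where "X \<cong>\<^sub>f\<^sub>s Y \<longleftrightarrow> (\<exists>f. fs_isomorphism X Y f)"


subsection \<open>Projective spaces\<close>

text \<open>
  \<open>\<P>(V)\<close> is the space of lines in the complex vector space \<open>V\<close>. Its local coordinates are the
  ratios \<open>l'/l\<close> of linear functionals, defined on the lines where \<open>l\<close> does not vanish. The scalar
  multiplication of the ambient space is a parameter.
\<close>

definition proj_points :: "(complex \<Rightarrow> 'v \<Rightarrow> 'v) \<Rightarrow> 'v::ab_group_add set \<Rightarrow> 'v set set"
  where "proj_points sc V = {module.span sc {v} | v. v \<in> V \<and> v \<noteq> 0}"

definition proj_coords ::
  "(complex \<Rightarrow> 'v \<Rightarrow> 'v) \<Rightarrow> ('v::ab_group_add set set \<times> ('v set \<Rightarrow> complex)) set"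
  where "proj_coords sc =
    {({L. \<exists>v\<in>L. l v \<noteq> 0}, \<lambda>L. THE z. \<forall>v\<in>L. l' v = z * l v) | l l'.
      Vector_Spaces.linear sc (*) l \<and> Vector_Spaces.linear sc (*) l'}"

definition proj_space :: "(complex \<Rightarrow> 'v \<Rightarrow> 'v) \<Rightarrow> 'v::ab_group_add set \<Rightarrow> 'v set fspace"
  where "proj_space sc V = generated_fspace (proj_points sc V) (proj_coords sc)"

abbreviation P1 :: "(complex ^ 2) set fspace"
  where "P1 \<equiv> proj_space (*s) UNIV"

abbreviation P2 :: "(complex ^ 3) set fspace"
  where "P2 \<equiv> proj_space (*s) UNIV"


subsection \<open>Local coordinates on spaces of homogeneous ideals\<close>

text \<open>
  In degree \<open>k\<close>, the ideal \<open>I\<close> is seen as the point \<open>I\<^sub>k\<close> of a Grassmannian of subspaces of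
  \<open>S\<^sub>k\<close>. A set \<open>B\<close> of monomials of degree \<open>k\<close> gives the standard affine chart of those \<open>I\<close>
  for which \<open>B\<close> maps to a basis of \<open>S\<^sub>k / I\<^sub>k\<close>; the coordinates on it are the coefficients
  \<open>c\<^sub>m\<^sub>b\<close> in the congruences \<open>m \<equiv> \<Sum>b\<in>B. c\<^sub>m\<^sub>b b\<close> modulo \<open>I\<^sub>k\<close>. The parameter \<open>K\<close> is the set of
  degrees that are used.
\<close>

definition chart_domain :: "nat \<Rightarrow> expo set \<Rightarrow> tpoly set set"
  where "chart_domain k B =
    {I. \<forall>q\<in>graded_piece k. \<exists>!p. supp p \<subseteq> B \<and> q - p \<in> I}"

definition chart_coord :: "expo set \<Rightarrow> expo \<Rightarrow> expo \<Rightarrow> tpoly set \<Rightarrow> complex"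
  where "chart_coord B m b I = coef (THE p. supp p \<subseteq> B \<and> monomial_poly m - p \<in> I) b"

definition ideal_coords :: "nat set \<Rightarrow> (tpoly set set \<times> (tpoly set \<Rightarrow> complex)) set"
  where "ideal_coords K = {(chart_domain k B, chart_coord B m b) | k B m b.
    k \<in> K \<and> B \<subseteq> {m. mdeg m = k} \<and> mdeg m = k \<and> b \<in> B}"


section \<open>Multigraded Hilbert scheme, Hilbert scheme of points, Slip\<close>

definition multigraded_hilb :: "(nat \<Rightarrow> nat) \<Rightarrow> tpoly set set"
  where "multigraded_hilb h = {J. homogeneous_ideal J \<and> (\<forall>k. hilbert_function J k = h k)}"

text \<open>
  The multigraded Hilbert scheme is a closed subscheme of a finite product of Grassmannians
  of the graded pieces; the \<open>J\<^sub>k\<close> in the remaining degrees depend regularly on the point, so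
  using all degrees does not change the structure.
\<close>

definition multigraded_hilb_space :: "(nat \<Rightarrow> nat) \<Rightarrow> tpoly set fspace"
  where "multigraded_hilb_space h = generated_fspace (multigraded_hilb h) (ideal_coords UNIV)"

definition generic_hf :: "nat \<Rightarrow> nat \<Rightarrow> nat"
  where "generic_hf r k = min r (tpoly.dim (graded_piece k))"

text \<open>The ideal of a set of points of the plane, given as lines in \<open>\<complex>\<^sup>3\<close>.\<close>

definition vanishing_ideal :: "(complex ^ 3) set set \<Rightarrow> tpoly set"
  where "vanishing_ideal \<Gamma> = {p. \<forall>L\<in>\<Gamma>. \<forall>v\<in>L. poly_eval p v = 0}"

definition points_locus :: "nat \<Rightarrow> tpoly set set"
  where "points_locus r = {vanishing_ideal \<Gamma> | \<Gamma>.
    \<Gamma> \<subseteq> proj_points (*s) UNIV \<and> finite \<Gamma> \<and> card \<Gamma> = r} \<inter> multigraded_hilb (generic_hf r)"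

definition Slip :: "nat \<Rightarrow> tpoly set set"
  where "Slip r = fs_top (multigraded_hilb_space (generic_hf r)) closure_of points_locus r"

text \<open>Closed subschemes with constant Hilbert polynomial \<open>r\<close>.\<close>

definition Hilb :: "nat \<Rightarrow> tpoly set set"
  where "Hilb r = {I. homogeneous_ideal I \<and> saturation I = I \<and>
    (\<exists>k0. \<forall>k\<ge>k0. hilbert_function I k = r)}"

definition phi :: "nat \<Rightarrow> tpoly set \<Rightarrow> tpoly set"
  where "phi r = restrict Proj_quot (Slip r)"


section \<open>Varieties of sums of powers\<close>

definition VSP :: "tpoly \<Rightarrow> nat \<Rightarrow> tpoly set set"
  where "VSP F r = {J \<in> Slip r. J \<subseteq> Ann F}"

definition VPS :: "tpoly \<Rightarrow> nat \<Rightarrow> tpoly set set"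
  where "VPS F r = {I \<in> Hilb r. I \<subseteq> Ann F}"

definition VSP_space :: "tpoly \<Rightarrow> nat \<Rightarrow> tpoly set fspace"
  where "VSP_space F r = generated_fspace (VSP F r) (ideal_coords UNIV)"

text \<open>
  The Hilbert scheme of \<open>r\<close> points embeds into the Grassmannian of subspaces of codimension \<open>r\<close>
  of \<open>S\<^sub>k\<close> for every \<open>k \<ge> r\<close>, since \<open>r\<close> is the Gotzmann number of the constant polynomial \<open>r\<close>.
  In smaller degrees the Hilbert function may jump, so those coordinates are not used.
\<close>

definition VPS_space :: "tpoly \<Rightarrow> nat \<Rightarrow> tpoly set fspace"
  where "VPS_space F r = generated_fspace (VPS F r) (ideal_coords {r..})"

definition VSP_of_fiber_type :: "tpoly \<Rightarrow> nat \<Rightarrow> bool"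
  where "VSP_of_fiber_type F r \<longleftrightarrow> VSP F r = {J \<in> Slip r. phi r J \<in> VPS F r}"

end

theory Submission
  imports Defs
begin

text \<open>
  Let \<open>A = Ann F\<close>, a monomial ideal. The Hilbert function of \<open>S/A\<close> is \<open>r - 1\<close>, \<open>r - 1\<close>, \<open>r - 3\<close> in
  degrees \<open>c\<close>, \<open>c + 1\<close>, \<open>c + 2\<close>, and \<open>A\<close> has no generators in degree \<open>c + 2\<close>. A homogeneous ideal
  \<open>I\<close> in \<open>A\<close> whose Hilbert function is at most \<open>r\<close>, at most \<open>r\<close> and at least \<open>r - 1\<close> there must
  therefore satisfy \<open>S\<^sub>1 A\<^sub>c \<subseteq> I\<close>, so its saturation contains the generators of \<open>A\<close> of degree at
  most \<open>c\<close>; moreover \<open>I\<close> has codimension at most one in \<open>A\<close> in degree \<open>c + 1\<close>. Both facts together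
  put a complete intersection of length \<open>r\<close> into the saturation, which then equals it. This applies
  to all ideals in \<open>Slip\<close> below \<open>A\<close>, whose Hilbert function is generic, and to all ideals in \<open>VPS\<close>,
  because the Hilbert function of a saturated ideal is nondecreasing. In all three cases the
  complete intersections are generated by powers of variables and binomials in \<open>N\<close>-th powers of
  variables, and the coordinates of the Grassmannian charts are ratios of monomials in the parameters.
\<close>

subsection \<open>Dimensions modulo a subspace\<close>

text \<open>The three cases are the possible numbers n of variables whose exponent in F equals c:
  since c = a + b - 1, this number is 3 for a = b = 1, it is 2 for a = 1 < b, and 1 for a \<ge> 2.
  The other 3 - n variables have their pure powers in A in degree at most c, so these powers lie in
  the saturation. The remaining n pure powers have degree c + 1, where I has codimension at most one
  in A, so at least n - 1 independent combinations of them lie in I. This makes 3 - n + n - 1 = 2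
  equations, with a point of projective (n-1)-space as parameter; hence one family indexed by a
  finite type of n elements serves all cases. The bound in degree c + 2 has a slack of one because
  for ideals in VPS monotonicity of the Hilbert function yields only r - 1 there. Monotonicity needs
  a linear nonzerodivisor, which is found by counting, without primary decomposition. Fiber type
  requires no description of Slip; only the case a = b = 1 has to exhibit elements of Slip, and
  obtains them as limits of ideals of four points.\<close>

context vector_space
begin

text \<open>Coefficients are attached to indices, not to vectors, so repetitions in the family
  \<open>v\<close> do no harm.\<close>

lemma span_image_eq_sums:
  assumes "finite A" "x \<in> span (v ` A)"
  shows "\<exists>c. x = (\<Sum>i\<in>A. scale (c i) (v i))"
proof -
  let ?S = "{\<Sum>i\<in>A. scale (c i) (v i) | c. True}"
  have "subspace ?S"
  proof (rule subspaceI)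
    show "0 \<in> ?S" by (auto intro!: exI[of _ "\<lambda>_. 0"])
    show "x + y \<in> ?S" if "x \<in> ?S" "y \<in> ?S" for x y
    proof -
      from that obtain c c' where "x = (\<Sum>i\<in>A. scale (c i) (v i))" "y = (\<Sum>i\<in>A. scale (c' i) (v i))"
        by auto
      then have "x + y = (\<Sum>i\<in>A. scale (c i + c' i) (v i))"
        by (simp add: scale_left_distrib sum.distrib)
      then show ?thesis by (auto intro!: exI[of _ "\<lambda>i. c i + c' i"])
    qed
    show "scale a x \<in> ?S" if "x \<in> ?S" for a x
    proof -
      from that obtain c where "x = (\<Sum>i\<in>A. scale (c i) (v i))" by auto
      then have "scale a x = (\<Sum>i\<in>A. scale (a * c i) (v i))"
        by (simp add: scale_sum_right)
      then show ?thesis by (auto intro!: exI[of _ "\<lambda>i. a * c i"])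
    qed
  qed
  moreover have "v ` A \<subseteq> ?S"
  proof
    fix y assume "y \<in> v ` A"
    then obtain j where j: "j \<in> A" "y = v j" by auto
    have "(\<Sum>i\<in>A. scale (if i = j then 1 else 0) (v i)) = (\<Sum>i\<in>A. if i = j then v i else 0)"
      by (intro sum.cong) auto
    also have "\<dots> = y" using j assms(1) by simp
    finally show "y \<in> ?S" by (auto intro!: exI[of _ "\<lambda>i. if i = j then 1 else 0"])
  qed
  ultimately have "span (v ` A) \<subseteq> ?S" by (rule span_minimal[rotated])
  then show ?thesis using assms(2) by auto
qed

lemma finite_basis_of_subspace:
  assumes "finite T" "V \<subseteq> span T" "subspace J" "J \<subseteq> V"
  obtains B where "finite B" "B \<subseteq> J" "independent B" "span B = J" "card B = dim J"
proof -
  obtain B where B: "B \<subseteq> J" "independent B" "J \<subseteq> span B" "card B = dim J"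
    using basis_exists by blast
  have "B \<subseteq> span T" using B(1) assms by blast
  then have "finite B" using independent_span_bound[OF assms(1) B(2)] by simp
  moreover have "span B = J" using B assms(3) span_subspace by blast
  ultimately show ?thesis using B that by blast
qed

text \<open>A basis of \<open>J\<close> is extended by the \<open>v i\<close> one at a time;
  hypothesis \<open>ind\<close> is independence modulo \<open>J\<close>, so lower bounds on
  codimensions need no quotient space. The set \<open>T\<close> keeps \<open>V\<close>
  finite-dimensional inside an ambient space that will be infinite-dimensional.\<close>

lemma dim_add_card_le:
  assumes "finite T" "V \<subseteq> span T" "subspace V" "subspace J" "J \<subseteq> V"
    and "finite A" "v ` A \<subseteq> V"
    and ind: "\<And>c. (\<Sum>i\<in>A. scale (c i) (v i)) \<in> J \<Longrightarrow> \<forall>i\<in>A. c i = 0"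
  shows "dim J + card A \<le> dim V"
proof -
  obtain B where B: "finite B" "B \<subseteq> J" "independent B" "span B = J" "card B = dim J"
    using finite_basis_of_subspace[OF assms(1,2,4,5)] .
  have "independent (B \<union> v ` A) \<and> card (B \<union> v ` A) = card B + card A"
    using assms(6) ind
  proof (induction A)
    case empty
    then show ?case using B by simp
  next
    case (insert i A)
    have IH: "independent (B \<union> v ` A) \<and> card (B \<union> v ` A) = card B + card A"
    proof (rule insert.IH)
      fix c assume "(\<Sum>i\<in>A. scale (c i) (v i)) \<in> J"
      moreover have "(\<Sum>j\<in>insert i A. scale ((if j = i then 0 else c j)) (v j)) = (\<Sum>i\<in>A. scale (c i) (v i))"
        using insert.hyps by (auto intro!: sum.cong)
      ultimately have "\<forall>j\<in>insert i A. (if j = i then 0 else c j) = 0"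
        using insert.prems[of "\<lambda>j. if j = i then 0 else c j"] by auto
      then show "\<forall>i\<in>A. c i = 0" using insert.hyps by (metis insertCI)
    qed
    have "v i \<notin> span (B \<union> v ` A)"
    proof
      assume "v i \<in> span (B \<union> v ` A)"
      then obtain x y where xy: "v i = x + y" "x \<in> J" "y \<in> span (v ` A)"
        unfolding span_Un B(4) by auto
      then obtain c where c: "y = (\<Sum>i\<in>A. scale (c i) (v i))"
        using span_image_eq_sums insert.hyps by blast
      have "(\<Sum>j\<in>insert i A. scale ((if j = i then 1 else - c j)) (v j))
          = v i + (\<Sum>j\<in>A. scale (- c j) (v j))"
        using insert.hyps by (auto intro!: sum.cong)
      also have "\<dots> = x" using xy(1) c by (simp add: sum_negf)
      finally have "\<forall>j\<in>insert i A. (if j = i then 1 else - c j) = 0"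
        using insert.prems[of "\<lambda>j. if j = i then 1 else - c j"] xy(2) by auto
      then show False by (metis insertI1 one_neq_zero)
    qed
    then have "independent (insert (v i) (B \<union> v ` A))" and nin: "v i \<notin> B \<union> v ` A"
      using IH independent_insertI span_base by auto
    moreover have "card (insert (v i) (B \<union> v ` A)) = card B + card (insert i A)"
      using IH insert.hyps B(1) nin by simp
    ultimately show ?case by simp
  qed
  then have ind: "independent (B \<union> v ` A)" and c: "card (B \<union> v ` A) = card B + card A" by auto
  obtain D where D: "finite D" "span D = V" "card D = dim V"
    using finite_basis_of_subspace[OF assms(1,2,3) subset_refl] by metis
  have "B \<union> v ` A \<subseteq> span D" using B(2) D(2) assms(5,7) by auto
  from independent_span_bound[OF D(1) ind this] show ?thesis
    using B(5) D(3) c by simp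
qed

text \<open>The opposite bound: a basis of \<open>J\<close> together with a family spanning
  \<open>V\<close> modulo \<open>J\<close> spans \<open>V\<close>.\<close>

lemma dim_le_dim_add_card:
  assumes "finite T" "V \<subseteq> span T" "subspace J" "J \<subseteq> V" "finite A"
    and gen: "\<And>p. p \<in> V \<Longrightarrow> \<exists>c. p - (\<Sum>i\<in>A. scale (c i) (v i)) \<in> J"
  shows "dim V \<le> dim J + card A"
proof -
  obtain B where B: "finite B" "B \<subseteq> J" "independent B" "span B = J" "card B = dim J"
    using finite_basis_of_subspace[OF assms(1-4)] .
  have "V \<subseteq> span (B \<union> v ` A)"
  proof
    fix p assume "p \<in> V"
    then obtain c where c: "p - (\<Sum>i\<in>A. scale (c i) (v i)) \<in> J" using gen by blast
    have "(\<Sum>i\<in>A. scale (c i) (v i)) \<in> span (v ` A)"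
      by (intro span_sum span_scale span_base) auto
    then show "p \<in> span (B \<union> v ` A)"
      unfolding span_Un B(4) using c by (smt (verit) diff_add_cancel mem_Collect_eq)
  qed
  then have "dim V \<le> card (B \<union> v ` A)"
    by (rule dim_le_card) (use B assms in auto)
  also have "\<dots> \<le> card B + card A"
    by (meson card_Un_le card_image_le add_left_mono assms(5) order_trans)
  finally show ?thesis using B by simp
qed

lemma complement_basis_exists:
  assumes "finite T" "V \<subseteq> span T" "subspace V" "subspace J" "J \<subseteq> V"
  obtains C where "finite C" "C \<subseteq> V" "card C = dim V - dim J"
    "\<And>c. (\<Sum>v\<in>C. scale (c v) v) \<in> J \<Longrightarrow> \<forall>v\<in>C. c v = 0"
proof -
  obtain B where B: "finite B" "B \<subseteq> J" "independent B" "span B = J" "card B = dim J"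
    using finite_basis_of_subspace[OF assms(1,2,4,5)] .
  have "B \<subseteq> V" using B assms by blast
  then obtain D where D: "B \<subseteq> D" "D \<subseteq> V" "independent D" "V \<subseteq> span D"
    using maximal_independent_subset_extend[OF _ B(3)] by blast
  have fD: "finite D"
    using independent_span_bound[OF assms(1) D(3)] D(2) assms(2) by blast
  show ?thesis
  proof (rule that[of "D - B"])
    show "finite (D - B)" "D - B \<subseteq> V" using fD D by auto
    show "card (D - B) = dim V - dim J"
      using D B basis_card_eq_dim[OF D(2,4,3)] by (simp add: card_Diff_subset)
    fix c assume "(\<Sum>v\<in>D - B. scale (c v) v) \<in> J"
    then obtain u where u: "(\<Sum>v\<in>D - B. scale (c v) v) = (\<Sum>v\<in>B. scale (u v) v)"
      unfolding B(4)[symmetric] span_finite[OF B(1)] by auto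
    \<comment> \<open>A relation modulo \<open>J\<close> becomes a genuine relation on the basis
      \<open>D\<close> once its value in \<open>J\<close> is written in \<open>B\<close> and moved
      to the other side.\<close>
    have "(\<Sum>v\<in>D. scale (if v \<in> B then - u v else c v) v)
       = (\<Sum>v\<in>D - B. scale (if v \<in> B then - u v else c v) v) + (\<Sum>v\<in>B. scale (if v \<in> B then - u v else c v) v)"
      by (rule sum.subset_diff[OF D(1) fD])
    also have "\<dots> = (\<Sum>v\<in>D - B. scale (c v) v) + (\<Sum>v\<in>B. scale (- u v) v)"
      by (intro arg_cong2[where f="(+)"] sum.cong) auto
    also have "\<dots> = 0" using u by (simp add: sum_negf)
    finally have "\<forall>v\<in>D. (if v \<in> B then - u v else c v) = 0"
      using independentD[OF D(3) fD subset_refl, of "\<lambda>v. if v \<in> B then - u v else c v"] by blast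
    then show "\<forall>v\<in>D - B. c v = 0" by auto
  qed
qed

lemma subspace_eq_if_dim_le:
  assumes "finite T" "V \<subseteq> span T" "subspace V" "subspace J" "J \<subseteq> V" "dim V \<le> dim J"
  shows "J = V"
proof (rule ccontr)
  assume "J \<noteq> V"
  then obtain p where p: "p \<in> V" "p \<notin> J" using assms by blast
  have "dim J + card {p} \<le> dim V"
  proof (rule dim_add_card_le[OF assms(1-5), where v="\<lambda>x. x"])
    show "\<forall>i\<in>{p}. c i = 0" if "(\<Sum>i\<in>{p}. scale (c i) i) \<in> J" for c
    proof (rule ccontr)
      assume "\<not> ?thesis"
      then have "c p \<noteq> 0" by simp
      moreover have "scale (c p) p \<in> J" using that by simp
      ultimately have "p \<in> J" using subspace_scale[OF assms(4), of "scale (c p) p" "inverse (c p)"] by simp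
      then show False using p by simp
    qed
  qed (use p in auto)
  then show False using assms(6) by simp
qed

lemma codim_one_multiple:
  assumes "finite T" "V \<subseteq> span T" "subspace V" "subspace J" "J \<subseteq> V" "dim V \<le> dim J + 1"
    and u: "u \<in> V" "u \<notin> J" and p: "p \<in> V"
  shows "\<exists>c. p - scale c u \<in> J"
proof (rule ccontr)
  assume H: "\<not> ?thesis"
  \<comment> \<open>If no multiple of \<open>u\<close> worked, \<open>u\<close> and \<open>p\<close>
    would be independent modulo \<open>J\<close> and the codimension at least two. With
    \<open>bool\<close> as index set, the count 2 does not presuppose that the vectors
    differ.\<close>
  define v where "v = (\<lambda>b. if b then u else p)"
  have "dim J + card (UNIV :: bool set) \<le> dim V"
  proof (rule dim_add_card_le[OF assms(1-5), where v=v])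
    show "range v \<subseteq> V" using u p by (auto simp: v_def)
    fix c assume "(\<Sum>i\<in>UNIV. scale (c i) (v i)) \<in> J"
    then have J: "scale (c False) p + scale (c True) u \<in> J"
      by (simp add: UNIV_bool v_def)
    have F: "c False = 0"
    proof (rule ccontr)
      assume "c False \<noteq> 0"
      then have "scale (inverse (c False)) (scale (c False) p + scale (c True) u)
         = p - scale (- inverse (c False) * c True) u"
        by (simp add: scale_right_distrib)
      then show False using H subspace_scale[OF assms(4) J] by metis
    qed
    have "c True = 0"
    proof (rule ccontr)
      assume "c True \<noteq> 0"
      then have "scale (inverse (c True)) (scale (c False) p + scale (c True) u) = u"
        by (simp add: F)
      then show False using u subspace_scale[OF assms(4) J] by metis
    qed
    then show "\<forall>i\<in>UNIV. c i = 0" using F by (metis (full_types))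
  qed simp
  then show False using assms(6) by simp
qed

end

subsection \<open>Ternary polynomials\<close>

lemma coef_pscale [simp]: "coef (pscale c p) m = c * coef p m"
proof -
  have "pscale c p = Poly_Mapping.map ((*) c) p"
    by (simp add: pscale_def mult_map_scale_conv_mult)
  then show ?thesis by (simp add: map.rep_eq when_def)
qed

lemma pscale_single [simp]: "pscale c (Poly_Mapping.single m d) = Poly_Mapping.single m (c * d)"
  by (simp only: pscale_def mult_single add_0)

lemma pscale_mult_left: "pscale c p * q = pscale c (p * q)"
  by (simp only: pscale_def mult.assoc)

lemma pscale_mult_right: "p * pscale c q = pscale c (p * q)"
  by (simp only: pscale_def mult.left_commute)

lemma sum_single_superset:
  assumes "finite M" "supp p \<subseteq> M"
  shows "p = (\<Sum>m\<in>M. Poly_Mapping.single m (coef p m))"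
proof (rule poly_mapping_eqI)
  fix k
  have "coef (\<Sum>m\<in>M. Poly_Mapping.single m (coef p m)) k = (\<Sum>m\<in>M. if m = k then coef p m else 0)"
    by (simp add: lookup_sum lookup_single when_def)
  also have "\<dots> = coef p k" using assms
    by (simp add: sum.delta) (meson in_keys_iff subsetD)
  finally show "coef p k = coef (\<Sum>m\<in>M. Poly_Mapping.single m (coef p m)) k" by simp
qed

lemmas sum_single = sum_single_superset[OF finite_keys subset_refl]

lemma mdeg_zero [simp]: "mdeg 0 = 0"
  by (simp add: mdeg_def)

lemma mdeg_add [simp]: "mdeg (m + n) = mdeg m + mdeg n"
  by (simp add: mdeg_def lookup_add sum.distrib)

lemma mdeg_single [simp]: "mdeg (Poly_Mapping.single i n) = n"
  by (simp add: mdeg_def lookup_single when_def)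

lemma coef_single_mult_add:
  fixes p :: tpoly
  shows "coef (Poly_Mapping.single n c * p) (n + m) = c * coef p m"
proof -
  have "Poly_Mapping.single n c * p = (\<Sum>k\<in>supp p. Poly_Mapping.single (n + k) (c * coef p k))"
    by (subst sum_single[of p]) (simp add: sum_distrib_left mult_single)
  then have "coef (Poly_Mapping.single n c * p) (n + m) = (\<Sum>k\<in>supp p. if k = m then c * coef p k else 0)"
    by (simp add: lookup_sum lookup_single when_def)
  also have "\<dots> = c * coef p m"
    by (simp add: sum.delta in_keys_iff)
  finally show ?thesis .
qed

lemma supp_single_mult: "supp (Poly_Mapping.single n c * (p :: tpoly)) \<subseteq> (+) n ` supp p"
proof -
  have "Poly_Mapping.single n c * p = (\<Sum>k\<in>supp p. Poly_Mapping.single (n + k) (c * coef p k))"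
    by (subst sum_single[of p]) (simp add: sum_distrib_left mult_single)
  then have "supp (Poly_Mapping.single n c * p) \<subseteq> (\<Union>k\<in>supp p. supp (Poly_Mapping.single (n + k) (c * coef p k)))"
    by (simp only: keys_sum)
  also have "\<dots> \<subseteq> (+) n ` supp p" by (auto split: if_splits)
  finally show ?thesis .
qed

lemma poly_mult_eq_sum: "(p :: tpoly) * q = (\<Sum>m\<in>supp p. Poly_Mapping.single m (coef p m) * q)"
  by (subst sum_single[of p]) (rule sum_distrib_right)

section \<open>Graded pieces and homogeneous components\<close>

lemma graded_pieceI: "(\<And>m. coef p m \<noteq> 0 \<Longrightarrow> mdeg m = k) \<Longrightarrow> p \<in> graded_piece k"
  by (auto simp: graded_piece_def in_keys_iff)

lemma graded_pieceD: "p \<in> graded_piece k \<Longrightarrow> coef p m \<noteq> 0 \<Longrightarrow> mdeg m = k"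
  by (auto simp: graded_piece_def in_keys_iff)

text \<open>Graded pieces, monomial ideals and their intersections all have this shape, and their
  dimensions are counts of monomials.\<close>

lemma subspace_coef_constraint:
  "tpoly.subspace {p. \<forall>m. coef p m \<noteq> 0 \<longrightarrow> P m}"
proof (rule tpoly.subspaceI)
  show "x + y \<in> {p. \<forall>m. coef p m \<noteq> 0 \<longrightarrow> P m}"
    if "x \<in> {p. \<forall>m. coef p m \<noteq> 0 \<longrightarrow> P m}" "y \<in> {p. \<forall>m. coef p m \<noteq> 0 \<longrightarrow> P m}" for x y
  proof -
    have "coef x m = 0 \<and> coef y m = 0" if "\<not> P m" for m
      using that \<open>x \<in> _\<close> \<open>y \<in> _\<close> by blast
    then have "P m" if "coef x m + coef y m \<noteq> 0" for m
      using that by (cases "P m") auto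
    then show ?thesis by (simp add: lookup_add)
  qed
qed auto

lemma graded_piece_eq: "graded_piece k = {p. \<forall>m. coef p m \<noteq> 0 \<longrightarrow> mdeg m = k}"
  by (auto simp: graded_piece_def in_keys_iff)

lemma subspace_graded_piece [simp]: "tpoly.subspace (graded_piece k)"
  unfolding graded_piece_eq by (rule subspace_coef_constraint)

lemma single_in_graded_piece: "mdeg m = k \<Longrightarrow> Poly_Mapping.single m c \<in> graded_piece k"
  by (auto simp: graded_piece_def)

lemma graded_piece_mult:
  assumes "p \<in> graded_piece j" "q \<in> graded_piece k"
  shows "p * q \<in> graded_piece (j + k)"
proof -
  have "supp (p * q) \<subseteq> {a + b | a b. a \<in> supp p \<and> b \<in> supp q}" by (rule keys_mult)
  then show ?thesis using assms unfolding graded_piece_def by fastforce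
qed

lemma coef_hom_component: "coef (hom_component k p) m = (if mdeg m = k then coef p m else 0)"
proof -
  have "coef (hom_component k p) m = (\<Sum>n\<in>{n \<in> supp p. mdeg n = k}. if n = m then coef p n else 0)"
    by (simp add: hom_component_def lookup_sum lookup_single when_def)
  also have "\<dots> = (if mdeg m = k then coef p m else 0)"
    by (subst sum.delta) (auto simp: in_keys_iff)
  finally show ?thesis .
qed

lemma hom_component_graded [simp]: "hom_component k p \<in> graded_piece k"
  by (rule graded_pieceI) (simp add: coef_hom_component split: if_splits)

lemma hom_component_sum: "hom_component k (sum f A) = (\<Sum>a\<in>A. hom_component k (f a))"
  by (rule poly_mapping_eqI) (simp add: coef_hom_component lookup_sum)

lemma hom_component_of_graded:
  "p \<in> graded_piece j \<Longrightarrow> hom_component k p = (if j = k then p else 0)"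
  by (rule poly_mapping_eqI) (auto simp: coef_hom_component dest: graded_pieceD)

lemma sum_hom_component: "p = (\<Sum>k\<in>mdeg ` supp p. hom_component k p)"
proof (rule poly_mapping_eqI)
  fix m
  have "coef (\<Sum>k\<in>mdeg ` supp p. hom_component k p) m
      = (\<Sum>k\<in>mdeg ` supp p. if k = mdeg m then coef p m else 0)"
    by (simp add: lookup_sum coef_hom_component eq_commute)
  also have "\<dots> = coef p m"
    by (subst sum.delta) (auto simp: in_keys_iff)
  finally show "coef p m = coef (\<Sum>k\<in>mdeg ` supp p. hom_component k p) m" by simp
qed

lemma hom_component_mult:
  assumes "q \<in> graded_piece n"
  shows "hom_component k (q * p) = (if n \<le> k then q * hom_component (k - n) p else 0)"
proof -
  have "hom_component k (q * p) = (\<Sum>j\<in>mdeg ` supp p. hom_component k (q * hom_component j p))"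
    by (subst sum_hom_component[of p]) (simp add: sum_distrib_left hom_component_sum)
  also have "\<dots> = (\<Sum>j\<in>mdeg ` supp p. if n + j = k then q * hom_component j p else 0)"
    by (intro sum.cong refl) (simp add: hom_component_of_graded[OF graded_piece_mult[OF assms hom_component_graded]])
  also have "\<dots> = (if n \<le> k then q * hom_component (k - n) p else 0)"
  proof (cases "n \<le> k")
    case True
    then have "(\<Sum>j\<in>mdeg ` supp p. if n + j = k then q * hom_component j p else 0)
       = (\<Sum>j\<in>mdeg ` supp p. if j = k - n then q * hom_component j p else 0)"
      by (intro sum.cong) auto
    also have "\<dots> = (if k - n \<in> mdeg ` supp p then q * hom_component (k - n) p else 0)"
      by (subst sum.delta) auto
    also have "\<dots> = q * hom_component (k - n) p"
    proof (cases "k - n \<in> mdeg ` supp p")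
      case False
      then have "hom_component (k - n) p = 0"
        by (intro poly_mapping_eqI) (force simp: coef_hom_component in_keys_iff)
      then show ?thesis by simp
    qed simp
    finally show ?thesis using True by simp
  next
    case False
    then have "n + j \<noteq> k" for j by auto
    then show ?thesis using False by simp
  qed
  finally show ?thesis .
qed

lemma finite_mdeg_eq [simp]: "finite {m. mdeg m = k}"
proof -
  have "{m. mdeg m = k} \<subseteq> (\<lambda>f. Abs_poly_mapping f) ` (UNIV \<rightarrow>\<^sub>E {..k})"
  proof
    fix m assume "m \<in> {m. mdeg m = k}"
    then have "coef m i \<le> k" for i
      using member_le_sum[of i UNIV "coef m"] by (simp add: mdeg_def)
    moreover have "m = Abs_poly_mapping (coef m)" by simp
    ultimately show "m \<in> (\<lambda>f. Abs_poly_mapping f) ` (UNIV \<rightarrow>\<^sub>E {..k})"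
      by (metis (no_types, lifting) PiE_UNIV_domain PiE_I UNIV_I atMost_iff image_eqI)
  qed
  moreover have "finite ((UNIV :: 3 set) \<rightarrow>\<^sub>E {..k})"
    by (rule finite_PiE) auto
  ultimately show ?thesis using finite_subset by blast
qed

lemma coef_monomial_poly: "coef (monomial_poly m) k = (if k = m then 1 else 0)"
  by (simp add: monomial_poly_def lookup_single when_def)

lemma monomial_poly_graded: "monomial_poly m \<in> graded_piece (mdeg m)"
  by (auto simp: monomial_poly_def graded_piece_def)

lemma pscale_monomial_poly: "pscale c (monomial_poly m) = Poly_Mapping.single m c"
  by (simp add: monomial_poly_def)

lemma in_span_monomials:
  assumes "finite M" "supp p \<subseteq> M"
  shows "p \<in> tpoly.span (monomial_poly ` M)"
proof -
  have "p = (\<Sum>m\<in>M. pscale (coef p m) (monomial_poly m))"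
    using sum_single_superset[OF assms] by (simp add: pscale_monomial_poly)
  moreover have "\<dots> \<in> tpoly.span (monomial_poly ` M)"
    by (intro tpoly.span_sum tpoly.span_scale tpoly.span_base) auto
  ultimately show ?thesis by simp
qed

lemma graded_piece_finitely_spanned:
  "graded_piece k \<subseteq> tpoly.span (monomial_poly ` {m. mdeg m = k})"
  using in_span_monomials[OF finite_mdeg_eq] by (auto simp: graded_piece_def)

lemma dim_coef_constraint:
  assumes "finite {m. P m}"
  shows "tpoly.dim {p. \<forall>m. coef p m \<noteq> 0 \<longrightarrow> P m} = card {m. P m}"
proof (rule tpoly.dim_unique)
  let ?B = "monomial_poly ` {m. P m}"
  show "?B \<subseteq> {p. \<forall>m. coef p m \<noteq> 0 \<longrightarrow> P m}"
    by (auto simp: coef_monomial_poly split: if_splits)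
  show "{p. \<forall>m. coef p m \<noteq> 0 \<longrightarrow> P m} \<subseteq> tpoly.span ?B"
    using in_span_monomials[OF assms] by (auto simp: in_keys_iff)
  have inj: "inj_on monomial_poly M" for M
    using inj_single by (auto simp: inj_on_def monomial_poly_def poly_mapping_eq_iff fun_eq_iff lookup_single when_def)
  then show "card ?B = card {m. P m}" by (simp add: card_image)
  show "tpoly.independent ?B"
  proof (rule tpoly.independent_if_scalars_zero)
    show "finite ?B" using assms by simp
    fix f x assume s: "(\<Sum>x\<in>?B. pscale (f x) x) = 0" and "x \<in> ?B"
    then obtain m where m: "P m" "x = monomial_poly m" by auto
    have "(\<Sum>x\<in>?B. pscale (f x) x) = (\<Sum>m\<in>{m. P m}. Poly_Mapping.single m (f (monomial_poly m)))"
      by (subst sum.reindex[OF inj]) (simp add: pscale_monomial_poly)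
    then have "0 = coef (\<Sum>m\<in>{m. P m}. Poly_Mapping.single m (f (monomial_poly m))) m"
      using s by simp
    also have "\<dots> = f (monomial_poly m)"
      using m assms by (simp add: lookup_sum lookup_single when_def)
    finally show "f x = 0" using m by simp
  qed
qed

lemma dim_graded_piece: "tpoly.dim (graded_piece k) = card {m. mdeg m = k}"
  unfolding graded_piece_eq by (rule dim_coef_constraint) simp

subsection \<open>Homogeneous ideals\<close>

lemma ideal_subspace: "tideal.subspace I \<Longrightarrow> tpoly.subspace I"
  by (rule tpoly.subspaceI)
    (auto simp: pscale_def tideal.subspace_0 tideal.subspace_add tideal.subspace_scale)

lemma ideal_span_subset: "tideal.subspace I \<Longrightarrow> G \<subseteq> I \<Longrightarrow> tideal.span G \<subseteq> I"
  by (rule tideal.span_minimal)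

lemma ideal_mult: "tideal.subspace I \<Longrightarrow> p \<in> I \<Longrightarrow> q * p \<in> I"
  by (rule tideal.subspace_scale)

lemma ideal_pscale: "tideal.subspace I \<Longrightarrow> p \<in> I \<Longrightarrow> pscale c p \<in> I"
  by (simp add: pscale_def tideal.subspace_scale)

lemma subspace_ideal_graded:
  "tideal.subspace I \<Longrightarrow> tpoly.subspace (I \<inter> graded_piece k)"
  by (simp add: ideal_subspace tpoly.subspace_inter)

text \<open>Membership in a saturation quantifies over all forms of some degree; by linearity
  monomials suffice.\<close>

lemma graded_mult_mem:
  assumes "tideal.subspace I" "q \<in> graded_piece n"
    and "\<And>m. mdeg m = n \<Longrightarrow> monomial_poly m * p \<in> I"
  shows "q * p \<in> I"
proof -
  have "Poly_Mapping.single m (coef q m) * p \<in> I" if "m \<in> supp q" for m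
  proof -
    have "Poly_Mapping.single m (coef q m) * p = pscale (coef q m) (monomial_poly m * p)"
      by (simp add: pscale_mult_left[symmetric] pscale_monomial_poly)
    then show ?thesis using assms that ideal_pscale by (auto simp: graded_piece_def)
  qed
  then show ?thesis
    unfolding poly_mult_eq_sum[of q p] by (rule tideal.subspace_sum[OF assms(1)])
qed

lemma monomial_factor_var:
  assumes "mdeg m = Suc n"
  obtains i m' where "m = Poly_Mapping.single i 1 + m'" "mdeg m' = n"
proof -
  obtain i where i: "coef m i > 0"
  proof (rule ccontr)
    assume "\<not> thesis"
    then have "coef m i = 0" for i using that by blast
    then show False using assms by (simp add: mdeg_def)
  qed
  have e: "m = Poly_Mapping.single i 1 + (m - Poly_Mapping.single i 1)"
    by (rule poly_mapping_eqI) (use i in \<open>auto simp: lookup_add lookup_minus lookup_single when_def\<close>)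
  then have "mdeg m = 1 + mdeg (m - Poly_Mapping.single i 1)"
    by (metis mdeg_add mdeg_single)
  then show ?thesis using that e assms by auto
qed

lemma monomial_poly_add: "monomial_poly (m + n) = monomial_poly m * monomial_poly n"
  by (simp add: monomial_poly_def mult_single)

lemma Var_eq_monomial: "Var i = monomial_poly (Poly_Mapping.single i 1)"
  by (simp add: Var_def monomial_poly_def)

lemma Var_power: "Var i ^ n = monomial_poly (Poly_Mapping.single i n)"
  by (induction n)
    (simp_all add: Var_eq_monomial monomial_poly_def mult_single single_add[symmetric])

text \<open>Every monomial of degree k + 1 is a variable times one of degree k. This gives finitely
  many elements of a saturation a common exponent.\<close>

lemma graded_mult_mem_mono:
  assumes I: "tideal.subspace I" and "n \<le> k"
    and "\<forall>q\<in>graded_piece n. q * p \<in> I"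
  shows "\<forall>q\<in>graded_piece k. q * p \<in> I"
  using \<open>n \<le> k\<close>
proof (induction k rule: dec_induct)
  case base
  then show ?case using assms by simp
next
  case (step k)
  show ?case
  proof
    fix q assume "q \<in> graded_piece (Suc k)"
    then show "q * p \<in> I"
    proof (rule graded_mult_mem[OF I])
      fix m assume "mdeg m = Suc k"
      then obtain i m' where m: "m = Poly_Mapping.single i 1 + m'" "mdeg m' = k"
        by (rule monomial_factor_var)
      have "monomial_poly m' * p \<in> I" using step.IH m(2) monomial_poly_graded by blast
      then have "Var i * (monomial_poly m' * p) \<in> I" by (rule ideal_mult[OF I])
      then show "monomial_poly m * p \<in> I"
        by (simp only: m(1) monomial_poly_add Var_eq_monomial mult.assoc)
    qed
  qed
qed

lemma subset_saturation: "tideal.subspace I \<Longrightarrow> I \<subseteq> saturation I"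
  by (auto simp: saturation_def intro: ideal_mult)

lemma ideal_saturation:
  assumes I: "tideal.subspace I"
  shows "tideal.subspace (saturation I)"
proof (rule tideal.subspaceI)
  show "0 \<in> saturation I" using I by (auto simp: saturation_def tideal.subspace_0)
  show "p + p' \<in> saturation I" if "p \<in> saturation I" "p' \<in> saturation I" for p p'
  proof -
    from that obtain n n' where n: "\<forall>q\<in>graded_piece n. q * p \<in> I" "\<forall>q\<in>graded_piece n'. q * p' \<in> I"
      by (auto simp: saturation_def)
    have "\<forall>q\<in>graded_piece (max n n'). q * (p + p') \<in> I"
      using graded_mult_mem_mono[OF I _ n(1), of "max n n'"] graded_mult_mem_mono[OF I _ n(2), of "max n n'"] I
      by (auto simp: distrib_left tideal.subspace_add)
    then show ?thesis unfolding saturation_def by blast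
  qed
  show "s * p \<in> saturation I" if "p \<in> saturation I" for s p
  proof -
    from that obtain n where "\<forall>q\<in>graded_piece n. q * p \<in> I" by (auto simp: saturation_def)
    then have "\<forall>q\<in>graded_piece n. q * (s * p) \<in> I"
      using ideal_mult[OF I, of _ s] by (metis mult.left_commute)
    then show ?thesis by (auto simp: saturation_def)
  qed
qed

lemma dim_ideal_graded_le:
  assumes "tideal.subspace I"
  shows "tpoly.dim (I \<inter> graded_piece k) \<le> tpoly.dim (graded_piece k)"
proof -
  have "tpoly.dim (I \<inter> graded_piece k) + card ({} :: nat set) \<le> tpoly.dim (graded_piece k)"
    by (rule tpoly.dim_add_card_le[OF _ graded_piece_finitely_spanned subspace_graded_piece
          subspace_ideal_graded[OF assms]]) auto
  then show ?thesis by simp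
qed

text \<open>For \<open>q = 0\<close>, uniqueness in \<open>chart_domain\<close> makes
  \<open>B\<close> independent modulo the ideal; existence for all \<open>q\<close> makes it
  spanning.\<close>

lemma hilbert_function_eq_card:
  assumes I: "tideal.subspace I" and c: "I \<in> chart_domain k B" and B: "B \<subseteq> {m. mdeg m = k}"
  shows "hilbert_function I k = card B"
proof -
  have fB: "finite B" using B finite_mdeg_eq finite_subset by blast
  have sub: "tpoly.subspace (I \<inter> graded_piece k)" by (rule subspace_ideal_graded[OF I])
  have sums: "(\<Sum>b\<in>B. pscale (c b) (monomial_poly b)) = p" if "\<And>b. b \<in> B \<Longrightarrow> c b = coef p b" "supp p \<subseteq> B" for c p
  proof -
    have "(\<Sum>b\<in>B. pscale (c b) (monomial_poly b)) = (\<Sum>b\<in>B. Poly_Mapping.single b (coef p b))"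
      by (intro sum.cong) (simp_all add: pscale_monomial_poly that(1))
    then show ?thesis using sum_single_superset[OF fB that(2)] by simp
  qed
  have gB: "monomial_poly ` B \<subseteq> graded_piece k"
    using monomial_poly_graded B by force
  have "tpoly.dim (I \<inter> graded_piece k) + card B \<le> tpoly.dim (graded_piece k)"
  proof (rule tpoly.dim_add_card_le[OF _ graded_piece_finitely_spanned subspace_graded_piece sub _ fB gB])
    fix c :: "expo \<Rightarrow> complex"
    let ?p = "\<Sum>b\<in>B. pscale (c b) (monomial_poly b)"
    assume "?p \<in> I \<inter> graded_piece k"
    then have "0 - ?p \<in> I" using I by (simp add: tideal.subspace_neg)
    moreover have cf: "coef ?p m = (if m \<in> B then c m else 0)" for m
      using fB by (simp add: lookup_sum pscale_monomial_poly lookup_single when_def)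
    then have "supp ?p \<subseteq> B" by (auto simp: in_keys_iff split: if_splits)
    moreover have "\<exists>!p. supp p \<subseteq> B \<and> 0 - p \<in> I"
      using c tpoly.subspace_0[OF subspace_graded_piece] unfolding chart_domain_def by blast
    moreover have "supp 0 \<subseteq> B \<and> 0 - 0 \<in> I" using I by (simp add: tideal.subspace_0)
    ultimately have "?p = 0" by metis
    then have "coef ?p b = 0" for b by simp
    then show "\<forall>b\<in>B. c b = 0" unfolding cf by (metis (full_types))
  qed auto
  moreover have "tpoly.dim (graded_piece k) \<le> tpoly.dim (I \<inter> graded_piece k) + card B"
  proof (rule tpoly.dim_le_dim_add_card[OF _ graded_piece_finitely_spanned sub _ fB])
    fix q assume q: "q \<in> graded_piece k"
    then obtain p where p: "supp p \<subseteq> B" "q - p \<in> I" using c unfolding chart_domain_def by blast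
    have "p \<in> graded_piece k" using p(1) B by (auto simp: graded_piece_def)
    then have "q - p \<in> I \<inter> graded_piece k" using p q tpoly.subspace_diff[OF subspace_graded_piece] by blast
    then show "\<exists>c. q - (\<Sum>b\<in>B. pscale (c b) (monomial_poly b)) \<in> I \<inter> graded_piece k"
      using sums[OF refl p(1)] by (intro exI[of _ "coef p"]) simp
  qed auto
  ultimately show ?thesis by (simp add: hilbert_function_def)
qed

lemma hilbert_function_add_dim:
  "tideal.subspace I \<Longrightarrow> hilbert_function I k + tpoly.dim (I \<inter> graded_piece k) = card {m. mdeg m = k}"
  using dim_ideal_graded_le[of I k] by (simp add: hilbert_function_def dim_graded_piece)

subsection \<open>A family of complete intersections\<close>

text \<open>
  The ideals generated by the powers \<open>y\<^sub>j\<close> to the \<open>bd j\<close> of the variables outside the range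
  of \<open>x\<close> and by the combinations of the \<open>N\<close>-th powers of the variables \<open>y\<^bsub>x i\<^esub>\<close> whose
  coefficient vectors annihilate \<open>w\<close>. Modulo such an ideal, a monomial vanishes or is a multiple,
  by a monomial in \<open>w\<close>, of any other one in its residue class, so membership is decided by one
  linear functional for each residue class.
\<close>

locale diagonal_family =
  fixes x :: "'n::finite \<Rightarrow> 3" and N :: nat and bd :: "3 \<Rightarrow> nat"
  assumes inj_x: "inj x" and N_pos: "0 < N"
begin

text \<open>The degree in the finest grading for which the binomials in the N-th powers are
  homogeneous: exponent vectors are identified when they differ by moving multiples of
  \<open>N\<close> among the variables in the range of \<open>x\<close>.\<close>

definition cls :: "expo \<Rightarrow> nat \<times> (3 \<Rightarrow> nat)"
  where "cls m = (mdeg m, \<lambda>j. if j \<in> range x then coef m j mod N else coef m j)"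

definition ok :: "expo \<Rightarrow> bool"
  where "ok m \<longleftrightarrow> (\<forall>j. j \<notin> range x \<longrightarrow> coef m j < bd j)"

definition ex :: "expo \<Rightarrow> 'n \<Rightarrow> nat"
  where "ex m i = coef m (x i) div N"

text \<open>The value of the N-th power part of the monomial when each \<open>y_(x i)^N\<close> is
  replaced by \<open>w $ i\<close>.\<close>

definition lam :: "complex ^ 'n \<Rightarrow> expo \<Rightarrow> complex"
  where "lam w m = (if ok m then \<Prod>i\<in>UNIV. (w $ i) ^ ex m i else 0)"

definition csum :: "complex ^ 'n \<Rightarrow> nat \<times> (3 \<Rightarrow> nat) \<Rightarrow> tpoly \<Rightarrow> complex"
  where "csum w C p = (\<Sum>m\<in>supp p. if cls m = C then coef p m * lam w m else 0)"

definition J :: "complex ^ 'n \<Rightarrow> tpoly set"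
  where "J w = {p. \<forall>C. csum w C p = 0}"

text \<open>The standard monomials when the N-th powers with index i \<noteq> p are eliminated in
  favour of the one with index p.\<close>

definition NF :: "'n \<Rightarrow> expo set"
  where "NF p = {m. ok m \<and> (\<forall>i. i \<noteq> p \<longrightarrow> coef m (x i) < N)}"

text \<open>Meant for \<open>w $ p\<close> nonzero. Then the binomial with \<open>i = p\<close> is
  zero, and keeping it avoids a side condition on \<open>i\<close>.\<close>

definition gens :: "'n \<Rightarrow> complex ^ 'n \<Rightarrow> tpoly set"
  where "gens p w = {Var j ^ bd j | j. j \<notin> range x} \<union>
    {Var (x i) ^ N - pscale (w $ i / w $ p) (Var (x p) ^ N) | i. True}"

section \<open>The class functionals and the ideal they cut out\<close>

lemma csum_superset:
  assumes "finite M" "supp p \<subseteq> M"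
  shows "csum w C p = (\<Sum>m\<in>M. if cls m = C then coef p m * lam w m else 0)"
  unfolding csum_def by (rule sum.mono_neutral_left) (use assms in \<open>auto simp: in_keys_iff\<close>)

lemma csum_add: "csum w C (p + q) = csum w C p + csum w C q"
proof -
  let ?M = "supp p \<union> supp q"
  have "csum w C (p + q) = (\<Sum>m\<in>?M. if cls m = C then coef (p + q) m * lam w m else 0)"
    by (rule csum_superset) (use keys_add[of p q] in auto)
  also have "\<dots> = (\<Sum>m\<in>?M. if cls m = C then coef p m * lam w m else 0)
      + (\<Sum>m\<in>?M. if cls m = C then coef q m * lam w m else 0)"
    unfolding sum.distrib[symmetric] by (intro sum.cong) (auto simp: lookup_add distrib_right)
  also have "\<dots> = csum w C p + csum w C q"
    using csum_superset[of ?M p] csum_superset[of ?M q] by simp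
  finally show ?thesis .
qed

lemma csum_0 [simp]: "csum w C 0 = 0"
  by (simp add: csum_def)

lemma csum_pscale: "csum w C (pscale c p) = c * csum w C p"
proof -
  have "supp (pscale c p) \<subseteq> supp p" by (auto simp: in_keys_iff)
  then have "csum w C (pscale c p) = (\<Sum>m\<in>supp p. if cls m = C then coef (pscale c p) m * lam w m else 0)"
    by (intro csum_superset) auto
  then show ?thesis
    by (simp add: csum_def sum_distrib_left if_distrib[of "(*) c"] mult.assoc cong: if_cong)
qed

lemma csum_sum: "csum w C (sum f A) = (\<Sum>a\<in>A. csum w C (f a))"
  by (induction A rule: infinite_finite_induct) (simp_all add: csum_add)

lemma csum_minus: "csum w C (- p) = - csum w C p"
  using csum_add[of w C p "- p"] by (simp add: eq_neg_iff_add_eq_0 add.commute)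

lemma csum_diff: "csum w C (p - q) = csum w C p - csum w C q"
  using csum_add[of w C p "- q"] by (simp add: csum_minus)

lemma csum_single: "csum w C (Poly_Mapping.single m c) = (if cls m = C then c * lam w m else 0)"
proof -
  have "csum w C (Poly_Mapping.single m c)
      = (\<Sum>k\<in>{m}. if cls k = C then coef (Poly_Mapping.single m c) k * lam w k else 0)"
    by (rule csum_superset) auto
  then show ?thesis by simp
qed

lemma csum_monomial: "csum w C (monomial_poly m) = (if cls m = C then lam w m else 0)"
  by (simp add: monomial_poly_def csum_single)

lemma mod_add_left_cancel: "(n + m) mod N = (n + m') mod N \<longleftrightarrow> m mod N = (m' :: nat) mod N"
proof
  assume *: "(n + m) mod N = (n + m') mod N"
  \<comment> \<open>The number \<open>N * n - n\<close> completes \<open>n\<close> to a multiple of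
    \<open>N\<close>, which plays the part of subtracting \<open>n\<close> modulo
    \<open>N\<close>.\<close>
  have "n \<le> N * n" using N_pos by simp
  then have e: "(N * n - n) + (n + k) = N * n + k" for k by simp
  have "((N * n - n) + (n + m)) mod N = ((N * n - n) + (n + m')) mod N"
    using * by (metis mod_add_right_eq)
  then show "m mod N = m' mod N" unfolding e by simp
next
  assume "m mod N = m' mod N"
  then show "(n + m) mod N = (n + m') mod N" by (metis mod_add_right_eq)
qed

lemma cls_add_cancel: "cls (n + m) = cls (n + m') \<longleftrightarrow> cls m = cls m'"
  unfolding cls_def prod.inject fun_eq_iff
  by (simp add: lookup_add mod_add_left_cancel)

lemma cls_mdeg: "cls m = cls m' \<Longrightarrow> mdeg m = mdeg m'"
  by (simp add: cls_def)

lemma cls_mod: "cls m = cls m' \<Longrightarrow> coef m (x i) mod N = coef m' (x i) mod N"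
  unfolding cls_def prod.inject fun_eq_iff by (metis rangeI)

lemma cls_outside: "cls m = cls m' \<Longrightarrow> j \<notin> range x \<Longrightarrow> coef m j = coef m' j"
  unfolding cls_def prod.inject fun_eq_iff by metis

lemma ok_cls: "cls m = cls m' \<Longrightarrow> ok m = ok m'"
  unfolding ok_def using cls_outside by metis

lemma ok_addD: "ok (n + m) \<Longrightarrow> ok m"
  unfolding ok_def by (simp add: lookup_add) (meson add_lessD1 le_add2 le_less_trans)

lemma mdeg_split: "mdeg m = (\<Sum>i\<in>UNIV. coef m (x i)) + (\<Sum>j\<in>- range x. coef m j)"
proof -
  have "mdeg m = (\<Sum>j\<in>range x. coef m j) + (\<Sum>j\<in>- range x. coef m j)"
    unfolding mdeg_def by (subst sum.union_disjoint[symmetric]) auto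
  then show ?thesis by (simp add: sum.reindex[OF inj_x])
qed

text \<open>Degree and residues are constant on a class, hence so is the total number of N-th
  powers. On each class \<open>lam\<close> is therefore homogeneous in \<open>w\<close> of a single
  degree, and \<open>J w\<close> depends only on the line through \<open>w\<close>.\<close>

lemma sum_ex_cls:
  assumes "cls m = cls m'"
  shows "(\<Sum>i\<in>UNIV. ex m i) = (\<Sum>i\<in>UNIV. ex m' i)"
proof -
  have e: "(\<Sum>i\<in>UNIV. coef k (x i)) = N * (\<Sum>i\<in>UNIV. ex k i) + (\<Sum>i\<in>UNIV. coef k (x i) mod N)" for k
    by (simp add: ex_def sum_distrib_left sum.distrib[symmetric])
  have "(\<Sum>j\<in>- range x. coef m j) = (\<Sum>j\<in>- range x. coef m' j)"
    using cls_outside[OF assms] by (intro sum.cong) auto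
  moreover have "(\<Sum>i\<in>UNIV. coef m (x i) mod N) = (\<Sum>i\<in>UNIV. coef m' (x i) mod N)"
    using cls_mod[OF assms] by simp
  ultimately have "N * (\<Sum>i\<in>UNIV. ex m i) = N * (\<Sum>i\<in>UNIV. ex m' i)"
    using cls_mdeg[OF assms] mdeg_split[of m] mdeg_split[of m'] e[of m] e[of m'] by linarith
  then show ?thesis using N_pos by simp
qed

text \<open>The exponent of \<open>w $ i\<close> gained on multiplication by \<open>n\<close>: the
  full N-th powers in \<open>n\<close> and the carry of the residues in base \<open>N\<close>. It
  depends on \<open>m\<close> only through its class.\<close>

definition carry :: "expo \<Rightarrow> expo \<Rightarrow> 'n \<Rightarrow> nat"
  where "carry n m i = ex n i + (coef n (x i) mod N + coef m (x i) mod N) div N"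

lemma ex_add: "ex (n + m) i = carry n m i + ex m i"
  unfolding ex_def carry_def lookup_add
  by (subst div_add1_eq) simp

lemma carry_cls: "cls m = cls m' \<Longrightarrow> carry n m = carry n m'"
  by (rule ext) (simp only: carry_def cls_mod[of m m'])

lemma lam_add:
  "lam w (n + m) = (if ok (n + m) then \<Prod>i\<in>UNIV. (w $ i) ^ carry n m i else 0) * lam w m"
  using ok_addD[of n m] by (auto simp: lam_def ex_add power_add prod.distrib)

text \<open>Multiplication by a monomial maps classes injectively to classes and multiplies all
  \<open>lam\<close> values on a class by one common factor. This is why the common kernel of the
  functionals is an ideal.\<close>

lemma csum_single_mult:
  "csum w (cls (n + m)) (Poly_Mapping.single n c * p)
    = c * (if ok (n + m) then \<Prod>i\<in>UNIV. (w $ i) ^ carry n m i else 0) * csum w (cls m) p"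
proof -
  let ?\<mu> = "if ok (n + m) then \<Prod>i\<in>UNIV. (w $ i) ^ carry n m i else 0"
  let ?q = "Poly_Mapping.single n c * p"
  have "csum w (cls (n + m)) ?q
      = (\<Sum>k\<in>(+) n ` supp p. if cls k = cls (n + m) then coef ?q k * lam w k else 0)"
    by (rule csum_superset) (use supp_single_mult in auto)
  also have "\<dots> = (\<Sum>k\<in>supp p. if cls (n + k) = cls (n + m) then coef ?q (n + k) * lam w (n + k) else 0)"
    by (subst sum.reindex) (auto simp: inj_on_def)
  also have "\<dots> = (\<Sum>k\<in>supp p. if cls k = cls m then c * ?\<mu> * (coef p k * lam w k) else 0)"
  proof (rule sum.cong[OF refl])
    fix k assume "k \<in> supp p"
    show "(if cls (n + k) = cls (n + m) then coef ?q (n + k) * lam w (n + k) else 0)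
       = (if cls k = cls m then c * ?\<mu> * (coef p k * lam w k) else 0)"
    proof (cases "cls k = cls m")
      case True
      then have 1: "cls (n + k) = cls (n + m)" by (simp add: cls_add_cancel)
      have "lam w (n + k) = ?\<mu> * lam w k"
        unfolding lam_add[of w n k] ok_cls[OF 1] carry_cls[OF True] ..
      then show ?thesis unfolding coef_single_mult_add using True 1 by (simp add: ac_simps)
    qed (simp add: cls_add_cancel)
  qed
  also have "\<dots> = c * ?\<mu> * csum w (cls m) p"
    unfolding csum_def sum_distrib_left by (intro sum.cong) auto
  finally show ?thesis .
qed

lemma J_D: "p \<in> J w \<Longrightarrow> csum w C p = 0"
  unfolding J_def by blast

lemma single_mult_J:
  assumes "p \<in> J w"
  shows "Poly_Mapping.single n c * p \<in> J w"
proof -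
  have "csum w C (Poly_Mapping.single n c * p) = 0" for C
  proof (cases "\<exists>m. C = cls (n + m)")
    case True
    then obtain m where "C = cls (n + m)" by blast
    then show ?thesis using J_D[OF assms, of "cls m"] by (simp only: csum_single_mult mult_zero_right)
  next
    case False
    then show ?thesis
      unfolding csum_def using supp_single_mult[of n c p] by (intro sum.neutral) auto
  qed
  then show ?thesis by (simp add: J_def)
qed

lemma ideal_J: "tideal.subspace (J w)"
proof (rule tideal.subspaceI)
  show "0 \<in> J w" by (simp add: J_def)
  show "p + q \<in> J w" if "p \<in> J w" "q \<in> J w" for p q
    using that by (simp add: J_def csum_add)
  show "q * p \<in> J w" if "p \<in> J w" for q p
  proof -
    have "csum w C (q * p) = 0" for C
      unfolding poly_mult_eq_sum[of q p] csum_sum by (intro sum.neutral ballI J_D single_mult_J that)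
    then show ?thesis by (simp add: J_def)
  qed
qed

lemma csum_hom_component: "csum w C (hom_component k p) = (if fst C = k then csum w C p else 0)"
proof -
  have "supp (hom_component k p) \<subseteq> supp p"
    by (auto simp: in_keys_iff coef_hom_component split: if_splits)
  then have "csum w C (hom_component k p)
      = (\<Sum>m\<in>supp p. if cls m = C then coef (hom_component k p) m * lam w m else 0)"
    by (intro csum_superset) auto
  also have "\<dots> = (if fst C = k then csum w C p else 0)"
    unfolding csum_def by (auto simp: coef_hom_component cls_def intro!: sum.cong sum.neutral)
  finally show ?thesis .
qed

lemma homogeneous_J: "homogeneous_ideal (J w)"
  using ideal_J by (auto simp: homogeneous_ideal_def J_def csum_hom_component)

text \<open>Multiplication by this variable multiplies each functional on an \<open>ok\<close> class
  by a power of \<open>w $ p\<close> only, which is nonzero; so the variable is a nonzerodivisor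
  modulo \<open>J w\<close>, and saturatedness follows.\<close>

lemma J_cancel_var:
  assumes "w $ p \<noteq> 0" "Var (x p) * f \<in> J w"
  shows "f \<in> J w"
proof -
  let ?n = "Poly_Mapping.single (x p) (1::nat)"
  have "csum w C f = 0" for C
  proof (cases "\<exists>m. C = cls m \<and> ok m")
    case True
    then obtain m where m: "C = cls m" "ok m" by blast
    have ok: "ok (?n + m)"
      using m(2) by (auto simp: ok_def lookup_add lookup_single when_def)
    have "carry ?n m i = 0" if "i \<noteq> p" for i
    proof -
      have "coef ?n (x i) = 0" using that injD[OF inj_x] by (force simp: lookup_single when_def)
      then show ?thesis using N_pos by (simp add: carry_def ex_def)
    qed
    then have nz: "(\<Prod>i\<in>UNIV. (w $ i) ^ carry ?n m i) \<noteq> 0"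
      using assms(1) by (auto, metis power_0 zero_neq_one)
    have "csum w (cls (?n + m)) (Var (x p) * f) = 0" using J_D[OF assms(2)] .
    then show ?thesis unfolding Var_def csum_single_mult using ok nz m(1) by auto
  next
    case False
    then have "lam w m = 0" if "cls m = C" for m using that by (auto simp: lam_def)
    then show ?thesis unfolding csum_def by (intro sum.neutral) auto
  qed
  then show ?thesis by (simp add: J_def)
qed

lemma J_cancel_var_power:
  "w $ p \<noteq> 0 \<Longrightarrow> Var (x p) ^ k * f \<in> J w \<Longrightarrow> f \<in> J w"
proof (induction k)
  case (Suc k)
  then have "Var (x p) * (Var (x p) ^ k * f) \<in> J w" by (simp only: power_Suc mult.assoc)
  then show ?case using Suc J_cancel_var by blast
qed simp

lemma saturation_J:
  assumes "w \<noteq> 0"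
  shows "saturation (J w) = J w"
proof
  show "J w \<subseteq> saturation (J w)" by (rule subset_saturation[OF ideal_J])
  obtain p where p: "w $ p \<noteq> 0" using assms by (metis vec_eq_iff zero_index)
  show "saturation (J w) \<subseteq> J w"
  proof
    fix f assume "f \<in> saturation (J w)"
    then obtain n where n: "\<forall>q\<in>graded_piece n. q * f \<in> J w" by (auto simp: saturation_def)
    have "Var (x p) ^ n \<in> graded_piece n"
      unfolding Var_power using monomial_poly_graded[of "Poly_Mapping.single (x p) n"] by simp
    then show "f \<in> J w" using n J_cancel_var_power[OF p] by blast
  qed
qed

lemma lam_scale: "lam (c *s w) m = c ^ (\<Sum>i\<in>UNIV. ex m i) * lam w m"
  by (simp add: lam_def power_mult_distrib prod.distrib power_sum)

lemma J_scale:
  assumes "c \<noteq> 0"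
  shows "J (c *s w) = J w"
proof -
  have "csum (c *s w) C p = 0 \<longleftrightarrow> csum w C p = 0" for C p
  proof (cases "\<exists>m. C = cls m")
    case True
    then obtain m where m: "C = cls m" by blast
    have "csum (c *s w) C p = c ^ (\<Sum>i\<in>UNIV. ex m i) * csum w C p"
      unfolding csum_def sum_distrib_left
      by (intro sum.cong) (auto simp: lam_scale m dest: sum_ex_cls)
    then show ?thesis using assms by simp
  next
    case False
    then have "csum v C p = 0" for v unfolding csum_def by (intro sum.neutral) auto
    then show ?thesis by simp
  qed
  then show ?thesis by (simp add: J_def)
qed

lemma x_eq_iff: "x i = x j \<longleftrightarrow> i = j"
  using inj_x by (auto dest: injD)

lemma cls_N_power: "cls (Poly_Mapping.single (x i) N) = cls (Poly_Mapping.single (x j) N)"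
  by (auto simp: cls_def fun_eq_iff lookup_single when_def)

lemma lam_N_power:
  assumes "\<And>j. j \<notin> range x \<Longrightarrow> 0 < bd j"
  shows "lam w (Poly_Mapping.single (x i) N) = w $ i"
proof -
  have "ok (Poly_Mapping.single (x i) N)"
    using assms by (auto simp: ok_def lookup_single when_def)
  moreover have "ex (Poly_Mapping.single (x i) N) k = (if k = i then 1 else 0)" for k
    using N_pos by (auto simp: ex_def lookup_single when_def x_eq_iff)
  then have "(\<Prod>k\<in>UNIV. (w $ k) ^ ex (Poly_Mapping.single (x i) N) k) = (\<Prod>k\<in>UNIV. if k = i then w $ k else 1)"
    by (intro prod.cong) auto
  ultimately show ?thesis by (simp add: lam_def)
qed

lemma lam_not_ok: "\<not> ok m \<Longrightarrow> lam w m = 0"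
  by (simp add: lam_def)

lemma monomial_in_J: "\<not> ok m \<Longrightarrow> monomial_poly m \<in> J w"
  by (simp add: J_def csum_monomial lam_not_ok)

lemma gens_subset_J:
  assumes "w $ p \<noteq> 0"
  shows "gens p w \<subseteq> J w"
proof -
  have "Var (x i) ^ N - pscale (w $ i / w $ p) (Var (x p) ^ N) \<in> J w" for i
  proof -
    have "lam w (Poly_Mapping.single (x i) N) = w $ i / w $ p * lam w (Poly_Mapping.single (x p) N)"
    proof (cases "\<forall>j. j \<notin> range x \<longrightarrow> 0 < bd j")
      case True
      then show ?thesis using assms lam_N_power by simp
    next
      case False
      \<comment> \<open>Degenerate case: some \<open>bd j\<close> is 0, the monomials in question
        are not \<open>ok\<close>, and both sides vanish.\<close>
      then have "\<not> ok m" if "\<And>j. j \<notin> range x \<Longrightarrow> coef m j = 0" for m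
        using that by (auto simp: ok_def)
      note not_ok = this
      have "\<not> ok (Poly_Mapping.single (x i) N)" for i
        by (rule not_ok) (auto simp: lookup_single when_def)
      then show ?thesis by (simp add: lam_not_ok)
    qed
    then show ?thesis
      using cls_N_power[of i p] by (simp add: J_def Var_power csum_diff csum_pscale csum_monomial)
  qed
  moreover have "Var j ^ bd j \<in> J w" if "j \<notin> range x" for j
    using that unfolding Var_power by (intro monomial_in_J) (auto simp: ok_def)
  ultimately show ?thesis by (auto simp: gens_def)
qed

section \<open>Normal forms modulo a member of the family\<close>

lemma expo_split: "k \<le> coef m j \<Longrightarrow> m = Poly_Mapping.single j k + (m - Poly_Mapping.single j k)"
  for m :: expo
  by (rule poly_mapping_eqI) (auto simp: lookup_add lookup_minus lookup_single when_def)

lemma monomial_in_span_gens: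
  assumes "\<not> ok m"
  shows "monomial_poly m \<in> tideal.span (gens p w)"
proof -
  obtain j where j: "j \<notin> range x" "bd j \<le> coef m j" using assms by (auto simp: ok_def not_less)
  let ?m' = "m - Poly_Mapping.single j (bd j)"
  have "monomial_poly m = monomial_poly ?m' * Var j ^ bd j"
    using expo_split[OF j(2)] unfolding Var_power by (metis monomial_poly_add add.commute)
  moreover have "Var j ^ bd j \<in> tideal.span (gens p w)"
    using j(1) by (intro tideal.span_base) (auto simp: gens_def)
  ultimately show ?thesis by (simp only: tideal.span_scale)
qed

text \<open>The binomial for \<open>i\<close> trades an N-th power of one variable for that of the
  pivot variable. The class is kept, and the total exponent away from the pivot drops by
  \<open>N\<close>, so the process stops at a standard monomial.\<close>

lemma monomial_reduction:
  assumes "w $ p \<noteq> 0" "ok m"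
  shows "\<exists>m'\<in>NF p. cls m' = cls m \<and>
    (\<exists>c. monomial_poly m - pscale c (monomial_poly m') \<in> tideal.span (gens p w))"
  using assms(2)
proof (induction "\<Sum>i\<in>- {p}. coef m (x i)" arbitrary: m rule: less_induct)
  case less
  show ?case
  proof (cases "m \<in> NF p")
    case True
    moreover have "monomial_poly m - pscale 1 (monomial_poly m) \<in> tideal.span (gens p w)"
      by (simp add: tideal.span_zero)
    ultimately show ?thesis by blast
  next
    case False
    then obtain i where i: "i \<noteq> p" "N \<le> coef m (x i)"
      using less.prems by (auto simp: NF_def not_less)
    define k where "k = m - Poly_Mapping.single (x i) N"
    have m: "m = Poly_Mapping.single (x i) N + k" unfolding k_def by (rule expo_split[OF i(2)])
    define m2 where "m2 = Poly_Mapping.single (x p) N + k"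
    have cls2: "cls m2 = cls m"
      unfolding m m2_def add.commute[of _ k] cls_add_cancel by (rule cls_N_power)
    have "(\<Sum>l\<in>- {p}. coef m2 (x l)) < (\<Sum>l\<in>- {p}. coef m (x l))"
    proof (rule sum_strict_mono_ex1)
      show "\<forall>l\<in>- {p}. coef m2 (x l) \<le> coef m (x l)"
        by (auto simp: m m2_def lookup_add lookup_single when_def x_eq_iff)
      show "\<exists>l\<in>- {p}. coef m2 (x l) < coef m (x l)"
        using i N_pos by (intro bexI[of _ i]) (auto simp: m m2_def lookup_add lookup_single when_def x_eq_iff)
    qed simp
    moreover have "ok m2" using less.prems ok_cls[OF cls2] by simp
    ultimately obtain m' c where m': "m' \<in> NF p" "cls m' = cls m2"
      "monomial_poly m2 - pscale c (monomial_poly m') \<in> tideal.span (gens p w)"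
      using less.hyps by blast
    let ?a = "w $ i / w $ p"
    let ?g = "Var (x i) ^ N - pscale ?a (Var (x p) ^ N)"
    have "?g \<in> tideal.span (gens p w)"
      by (intro tideal.span_base) (auto simp: gens_def)
    then have "monomial_poly k * ?g \<in> tideal.span (gens p w)" by (rule tideal.span_scale)
    moreover have "monomial_poly k * ?g = monomial_poly m - pscale ?a (monomial_poly m2)"
      unfolding m m2_def right_diff_distrib pscale_mult_right Var_power monomial_poly_add
      by (simp only: mult.commute)
    moreover have "pscale ?a (monomial_poly m2 - pscale c (monomial_poly m')) \<in> tideal.span (gens p w)"
      unfolding pscale_def[of ?a] by (rule tideal.span_scale[OF m'(3)])
    ultimately have "(monomial_poly m - pscale ?a (monomial_poly m2))
        + pscale ?a (monomial_poly m2 - pscale c (monomial_poly m')) \<in> tideal.span (gens p w)"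
      using tideal.span_add by metis
    moreover have "(monomial_poly m - pscale ?a (monomial_poly m2))
        + pscale ?a (monomial_poly m2 - pscale c (monomial_poly m'))
        = monomial_poly m - pscale (?a * c) (monomial_poly m')"
      by (simp add: tpoly.scale_right_diff_distrib)
    ultimately show ?thesis using m'(1,2) cls2 by auto
  qed
qed

lemma reduction:
  assumes w: "w $ p \<noteq> 0" and f: "f \<in> graded_piece k"
  shows "\<exists>g. supp g \<subseteq> NF p \<inter> {m. mdeg m = k} \<and> f - g \<in> tideal.span (gens p w)"
proof -
  have "\<exists>g. supp g \<subseteq> NF p \<inter> {m. mdeg m = k} \<and>
      monomial_poly m - g \<in> tideal.span (gens p w)" if m: "mdeg m = k" for m
  proof (cases "ok m")
    case True
    from monomial_reduction[OF w this] obtain m' c where m': "m' \<in> NF p" "cls m' = cls m"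
      "monomial_poly m - pscale c (monomial_poly m') \<in> tideal.span (gens p w)" by blast
    have "supp (pscale c (monomial_poly m')) \<subseteq> {m'}"
      by (auto simp: pscale_monomial_poly split: if_splits)
    then have "supp (pscale c (monomial_poly m')) \<subseteq> NF p \<inter> {m. mdeg m = k}"
      using m'(1) cls_mdeg[OF m'(2)] m by auto
    then show ?thesis using m'(3) by blast
  next
    case False
    then show ?thesis using monomial_in_span_gens by (intro exI[of _ 0]) simp
  qed
  then obtain G where G: "\<And>m. mdeg m = k \<Longrightarrow> supp (G m) \<subseteq> NF p \<inter> {m. mdeg m = k}"
    "\<And>m. mdeg m = k \<Longrightarrow> monomial_poly m - G m \<in> tideal.span (gens p w)" by metis
  have deg: "mdeg m = k" if "m \<in> supp f" for m using f that by (auto simp: graded_piece_def)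
  define g where "g = (\<Sum>m\<in>supp f. pscale (coef f m) (G m))"
  have "supp g \<subseteq> (\<Union>m\<in>supp f. supp (pscale (coef f m) (G m)))"
    unfolding g_def by (rule keys_sum)
  also have "\<dots> \<subseteq> (\<Union>m\<in>supp f. supp (G m))"
    by (auto simp: in_keys_iff)
  also have "\<dots> \<subseteq> NF p \<inter> {m. mdeg m = k}" using G(1) deg by blast
  finally have "supp g \<subseteq> NF p \<inter> {m. mdeg m = k}" .
  moreover have "f - g = (\<Sum>m\<in>supp f. pscale (coef f m) (monomial_poly m - G m))"
    by (subst sum_single[of f])
      (simp add: g_def tpoly.scale_right_diff_distrib sum_subtractf pscale_monomial_poly)
  moreover have "\<dots> \<in> tideal.span (gens p w)"
    unfolding pscale_def by (intro tideal.span_sum tideal.span_scale G(2) deg)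
  ultimately show ?thesis by metis
qed

text \<open>Away from the pivot a standard exponent is below \<open>N\<close>, so it equals its
  residue, or it is part of the class; the pivot exponent is then forced by the degree.\<close>

lemma NF_unique:
  assumes "m \<in> NF p" "m' \<in> NF p" "cls m = cls m'"
  shows "m = m'"
proof (rule poly_mapping_eqI)
  have off: "coef m (x i) = coef m' (x i)" if "i \<noteq> p" for i
    using cls_mod[OF assms(3), of i] assms(1,2) that by (simp add: NF_def)
  have out: "coef m j = coef m' j" if "j \<notin> range x" for j
    using cls_outside[OF assms(3) that] .
  have eq: "coef m j = coef m' j" if "j \<noteq> x p" for j
    using off out that by (metis rangeE)
  then have "(\<Sum>j\<in>- {x p}. coef m j) = (\<Sum>j\<in>- {x p}. coef m' j)"
    by (intro sum.cong) auto
  moreover have "mdeg k = coef k (x p) + (\<Sum>j\<in>- {x p}. coef k j)" for k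
    unfolding mdeg_def by (subst sum.remove[of _ "x p"]) (auto simp: Compl_eq_Diff_UNIV)
  ultimately have "coef m (x p) = coef m' (x p)" using cls_mdeg[OF assms(3)] by simp
  then show "coef m j = coef m' j" for j using eq by (cases "j = x p") auto
qed

lemma lam_NF:
  assumes "w $ p \<noteq> 0" "m \<in> NF p"
  shows "lam w m \<noteq> 0"
proof -
  have "ex m i = 0" if "i \<noteq> p" for i using assms(2) that by (simp add: NF_def ex_def)
  then have "(\<Prod>i\<in>UNIV. (w $ i) ^ ex m i) \<noteq> 0" using assms(1) by (auto, metis power_0 zero_neq_one)
  then show ?thesis using assms(2) by (simp add: lam_def NF_def)
qed

text \<open>The sets of monomials that give a basis of the quotient by a general member in degree \<open>k\<close>.\<close>

definition transversal :: "nat \<Rightarrow> expo set \<Rightarrow> bool"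
  where "transversal k B \<longleftrightarrow> B \<subseteq> {m. mdeg m = k} \<and> (\<forall>b\<in>B. ok b) \<and>
    (\<forall>m. ok m \<and> mdeg m = k \<longrightarrow> (\<exists>!b. b \<in> B \<and> cls b = cls m))"

lemma transversal_finite:
  assumes "transversal k B"
  shows "finite B"
  by (rule finite_subset[OF _ finite_mdeg_eq[of k]]) (use assms in \<open>simp add: transversal_def\<close>)

lemma transversal_cls:
  assumes "transversal k B" "ok m" "mdeg m = k"
  shows "\<exists>!b. b \<in> B \<and> cls b = cls m"
  using assms by (simp add: transversal_def)

lemma transversalD:
  assumes "transversal k B" "b \<in> B"
  shows "ok b" "mdeg b = k"
  using assms by (auto simp: transversal_def)

lemma transversal_inj:
  assumes B: "transversal k B" and "b \<in> B" "b' \<in> B" "cls b = cls b'"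
  shows "b = b'"
  using transversal_cls[OF B transversalD[OF B assms(2)]] assms(2-4) by auto

lemma csum_on_transversal:
  assumes B: "transversal k B" and b: "b \<in> B" and p: "supp p \<subseteq> B"
  shows "csum w (cls b) p = coef p b * lam w b"
proof -
  have "csum w (cls b) p = (\<Sum>m\<in>B. if cls m = cls b then coef p m * lam w m else 0)"
    by (rule csum_superset[OF transversal_finite[OF B] p])
  also have "\<dots> = (\<Sum>m\<in>B. if m = b then coef p m * lam w m else 0)"
    using transversal_inj[OF B _ b] by (intro sum.cong) auto
  also have "\<dots> = coef p b * lam w b" using b transversal_finite[OF B] by simp
  finally show ?thesis .
qed

lemma transversal_unique:
  assumes B: "transversal k B" and nz: "\<And>b. b \<in> B \<Longrightarrow> lam w b \<noteq> 0" and p: "supp p \<subseteq> B" "p \<in> J w"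
  shows "p = 0"
proof (rule poly_mapping_eqI)
  fix b
  show "coef p b = coef 0 b"
  proof (cases "b \<in> B")
    case True
    then show ?thesis using csum_on_transversal[OF B True p(1), of w] J_D[OF p(2)] nz[OF True] by simp
  next
    case False
    then show ?thesis using p(1) by (auto simp: in_keys_iff)
  qed
qed

text \<open>On a transversal each functional sees exactly one monomial, so the system for the
  coefficients is diagonal and solved by division by \<open>lam w b\<close>.\<close>

lemma transversal_normal_form:
  assumes B: "transversal k B" and nz: "\<And>b. b \<in> B \<Longrightarrow> lam w b \<noteq> 0" and q: "q \<in> graded_piece k"
  defines "p \<equiv> \<Sum>b\<in>B. Poly_Mapping.single b (csum w (cls b) q / lam w b)"
  shows "supp p \<subseteq> B" "q - p \<in> J w" "b \<in> B \<Longrightarrow> coef p b = csum w (cls b) q / lam w b"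
proof -
  have cf: "coef p m = (if m \<in> B then csum w (cls m) q / lam w m else 0)" for m
    using transversal_finite[OF B] by (simp add: p_def lookup_sum lookup_single when_def)
  then show sp: "supp p \<subseteq> B" and "b \<in> B \<Longrightarrow> coef p b = csum w (cls b) q / lam w b"
    by (auto simp: in_keys_iff split: if_splits)
  have "csum w C (q - p) = 0" for C
  proof (cases "\<exists>m. ok m \<and> mdeg m = k \<and> cls m = C")
    case True
    then obtain b where b: "b \<in> B" "cls b = C" using transversal_cls[OF B] by blast
    then show ?thesis
      using csum_on_transversal[OF B b(1) sp, of w] nz cf by (auto simp: csum_diff)
  next
    case False
    have "csum w C r = 0" if "supp r \<subseteq> {m. mdeg m = k}" for r
      unfolding csum_def using False that lam_not_ok by (intro sum.neutral) auto
    moreover have "supp p \<subseteq> {m. mdeg m = k}" using sp B by (auto simp: transversal_def)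
    moreover have "supp q \<subseteq> {m. mdeg m = k}" using q by (auto simp: graded_piece_def)
    ultimately show ?thesis by (simp add: csum_diff)
  qed
  then show "q - p \<in> J w" by (simp add: J_def)
qed

lemma transversal_chart:
  assumes B: "transversal k B" and nz: "\<And>b. b \<in> B \<Longrightarrow> lam w b \<noteq> 0"
  shows "J w \<in> chart_domain k B"
proof -
  have "\<exists>!p. supp p \<subseteq> B \<and> q - p \<in> J w" if q: "q \<in> graded_piece k" for q
  proof (rule ex_ex1I)
    show "\<exists>p. supp p \<subseteq> B \<and> q - p \<in> J w"
      using transversal_normal_form(1,2)[OF B nz q] by blast
    show "p = p'" if "supp p \<subseteq> B \<and> q - p \<in> J w" "supp p' \<subseteq> B \<and> q - p' \<in> J w" for p p'
    proof -
      have "(q - p') - (q - p) \<in> J w" using that ideal_J tideal.subspace_diff by blast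
      then have "p - p' \<in> J w" by simp
      moreover have "supp (p - p') \<subseteq> B" using that keys_diff[of p p'] by auto
      ultimately have "p - p' = 0" using transversal_unique[OF B nz] by blast
      then show ?thesis by simp
    qed
  qed
  then show ?thesis by (auto simp: chart_domain_def)
qed

text \<open>The Grassmannian coordinates of a member: zero, or a ratio of monomials in
  \<open>w\<close>. Both regularity of the parametrisation and its continuity come from this
  formula.\<close>

lemma chart_coord_J:
  assumes B: "transversal k B" and nz: "\<And>b. b \<in> B \<Longrightarrow> lam w b \<noteq> 0"
    and m: "mdeg m = k" and b: "b \<in> B"
  shows "chart_coord B m b (J w) = (if cls m = cls b then lam w m / lam w b else 0)"
proof -
  have q: "monomial_poly m \<in> graded_piece k" using monomial_poly_graded m by blast
  let ?p = "\<Sum>b\<in>B. Poly_Mapping.single b (csum w (cls b) (monomial_poly m) / lam w b)"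
  have "\<exists>!p. supp p \<subseteq> B \<and> monomial_poly m - p \<in> J w"
    using transversal_chart[OF B nz] q unfolding chart_domain_def by blast
  then have "(THE p. supp p \<subseteq> B \<and> monomial_poly m - p \<in> J w) = ?p"
    by (rule the1_equality) (intro conjI transversal_normal_form(1,2)[OF B nz q])
  then show ?thesis
    unfolding chart_coord_def using transversal_normal_form(3)[OF B nz q b]
    by (simp add: csum_monomial)
qed

lemma NF_transversal: "transversal k (NF p \<inter> {m. mdeg m = k})"
proof -
  have "\<exists>!b. b \<in> NF p \<inter> {m. mdeg m = k} \<and> cls b = cls m" if m: "ok m" "mdeg m = k" for m
  proof -
    \<comment> \<open>The class of the reduced monomial does not involve \<open>w\<close>, so any
      vector with nonzero entry at \<open>p\<close> may be used.\<close>
    have "((\<chi> i. 1) :: complex ^ 'n) $ p \<noteq> 0" by simp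
    then obtain m' where m': "m' \<in> NF p" "cls m' = cls m"
      using monomial_reduction[OF _ m(1)] by blast
    show ?thesis
    proof (rule ex1I[of _ m'])
      show "m' \<in> NF p \<inter> {m. mdeg m = k} \<and> cls m' = cls m"
        using m' cls_mdeg[OF m'(2)] m(2) by simp
      show "b = m'" if "b \<in> NF p \<inter> {m. mdeg m = k} \<and> cls b = cls m" for b
        using that m' NF_unique[of b p m'] by simp
    qed
  qed
  then show ?thesis unfolding transversal_def by (simp add: NF_def)
qed

lemma NF_chart: "w $ p \<noteq> 0 \<Longrightarrow> J w \<in> chart_domain k (NF p \<inter> {m. mdeg m = k})"
  by (rule transversal_chart[OF NF_transversal]) (simp add: lam_NF)

lemma hilbert_function_J:
  "w $ p \<noteq> 0 \<Longrightarrow> hilbert_function (J w) k = card (NF p \<inter> {m. mdeg m = k})"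
  by (rule hilbert_function_eq_card[OF ideal_J NF_chart]) auto

text \<open>The normal form of an element of \<open>J w\<close> modulo the generators lies again in
  \<open>J w\<close> and is supported on a transversal, so it is zero.\<close>

lemma J_eq_span:
  assumes w: "w $ p \<noteq> 0"
  shows "J w = tideal.span (gens p w)"
proof
  show "tideal.span (gens p w) \<subseteq> J w"
    by (rule ideal_span_subset[OF ideal_J gens_subset_J[OF w]])
  show "J w \<subseteq> tideal.span (gens p w)"
  proof
    fix f assume f: "f \<in> J w"
    have "hom_component k f \<in> tideal.span (gens p w)" for k
    proof -
      have fk: "hom_component k f \<in> J w" using f homogeneous_J by (auto simp: homogeneous_ideal_def)
      obtain g where g: "supp g \<subseteq> NF p \<inter> {m. mdeg m = k}"
        "hom_component k f - g \<in> tideal.span (gens p w)"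
        using reduction[OF w hom_component_graded] by blast
      then have "hom_component k f - g \<in> J w"
        using ideal_span_subset[OF ideal_J gens_subset_J[OF w]] by blast
      then have "hom_component k f - (hom_component k f - g) \<in> J w"
        using fk ideal_J tideal.subspace_diff by blast
      then have "g \<in> J w" by simp
      then have "g = 0" using transversal_unique[OF NF_transversal _ g(1)] lam_NF[OF w] by blast
      then show ?thesis using g(2) by simp
    qed
    then show "f \<in> tideal.span (gens p w)"
      by (subst sum_hom_component) (rule tideal.span_sum)
  qed
qed

text \<open>Converse of \<open>transversal_chart\<close>: a chart containing one member comes from a
  transversal. Whether another member lies in it is then decided by finitely many inequalities
  \<open>lam w b \<noteq> 0\<close>.\<close>

lemma chart_domain_transversal:
  assumes w: "w \<noteq> 0" and B: "B \<subseteq> {m. mdeg m = k}" and c: "J w \<in> chart_domain k B"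
  shows "transversal k B" "b \<in> B \<Longrightarrow> lam w b \<noteq> 0"
proof -
  have inj: "p = 0" if "supp p \<subseteq> B" "p \<in> J w" for p
  proof -
    have "\<exists>!p. supp p \<subseteq> B \<and> 0 - p \<in> J w"
      using c tpoly.subspace_0[OF subspace_graded_piece] unfolding chart_domain_def by blast
    moreover have "supp 0 \<subseteq> B \<and> 0 - 0 \<in> J w" using ideal_J by (simp add: tideal.subspace_0)
    moreover have "0 - p \<in> J w" using that(2) ideal_J by (simp add: tideal.subspace_neg)
    ultimately show ?thesis using that(1) by metis
  qed
  show nz: "lam w b \<noteq> 0" if "b \<in> B" for b
  proof
    assume "lam w b = 0"
    then have "monomial_poly b \<in> J w" by (simp add: J_def csum_monomial)
    then have "monomial_poly b = 0" using that by (intro inj) (auto simp: monomial_poly_def)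
    then have "coef (monomial_poly b) b = 0" by simp
    then show False by (simp add: coef_monomial_poly)
  qed
  have uni: "b = b'" if "b \<in> B" "b' \<in> B" "cls b = cls b'" for b b'
  proof (rule ccontr)
    assume "b \<noteq> b'"
    \<comment> \<open>Two monomials of one class are proportional modulo \<open>J w\<close>; this is
      their relation.\<close>
    let ?p = "pscale (lam w b') (monomial_poly b) - pscale (lam w b) (monomial_poly b')"
    have "?p \<in> J w" using that(3) by (simp add: J_def csum_diff csum_pscale csum_monomial)
    moreover have "supp ?p \<subseteq> {b, b'}"
      by (auto simp: in_keys_iff lookup_minus coef_monomial_poly split: if_splits)
    ultimately have "?p = 0" using that by (intro inj) auto
    then have "coef ?p b = 0" by simp
    then show False using \<open>b \<noteq> b'\<close> nz[OF that(2)] by (simp add: lookup_minus coef_monomial_poly)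
  qed
  have "\<exists>b\<in>B. cls b = cls m" if m: "ok m" "mdeg m = k" for m
  proof (rule ccontr)
    assume H: "\<not> ?thesis"
    obtain i where i: "w $ i \<noteq> 0" using w by (metis vec_eq_iff zero_index)
    obtain m' where m': "m' \<in> NF i" "cls m' = cls m" using monomial_reduction[OF i m(1)] by blast
    have "monomial_poly m' \<in> graded_piece k" using monomial_poly_graded cls_mdeg[OF m'(2)] m(2) by metis
    \<comment> \<open>A standard monomial of a class missed by \<open>B\<close> has a nonzero
      functional value, while anything supported on \<open>B\<close> has value zero on that
      class.\<close>
    then obtain p where p: "supp p \<subseteq> B" "monomial_poly m' - p \<in> J w"
      using c unfolding chart_domain_def by blast
    have "csum w (cls m) p = 0" unfolding csum_def using p(1) H by (intro sum.neutral) auto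
    then have "csum w (cls m) (monomial_poly m') = 0"
      using J_D[OF p(2), of "cls m"] by (simp add: csum_diff)
    then show False using m' lam_NF[OF i m'(1)] by (simp add: csum_monomial)
  qed
  moreover have "ok b" if "b \<in> B" for b using nz[OF that] lam_not_ok by blast
  ultimately show "transversal k B" using B uni by (auto simp: transversal_def) (metis (no_types))
qed

end

subsection \<open>Saturated ideals of finite colength\<close>

text \<open>Coefficient vectors on the moment curve, so that independence of any three is a
  Vandermonde determinant and there are infinitely many forms to choose from.\<close>

definition line_form :: "complex \<Rightarrow> tpoly"
  where "line_form t = Var 0 + pscale t (Var 1) + pscale (t\<^sup>2) (Var 2)"

lemma Var_graded: "Var i \<in> graded_piece 1"
  unfolding Var_eq_monomial using monomial_poly_graded[of "Poly_Mapping.single i 1"] by simp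

lemma line_form_graded: "line_form t \<in> graded_piece 1"
  unfolding line_form_def
  by (intro tpoly.subspace_add[OF subspace_graded_piece] tpoly.subspace_scale[OF subspace_graded_piece]
      Var_graded)

lemma UNIV_three: "(UNIV :: 3 set) = {0, 1, 2}"
  using UNIV_3 by auto

lemma three_cases: "(i :: 3) = 0 \<or> i = 1 \<or> i = 2"
  using UNIV_three by blast

text \<open>Inversion of the Vandermonde matrix by divided differences: first differences eliminate
  \<open>A\<close>, a second one isolates \<open>C\<close>.\<close>

lemma three_line_forms:
  assumes I: "tpoly.subspace I" and t: "card {t1, t2, t3 :: complex} = 3"
    and mem: "\<And>t. t \<in> {t1, t2, t3} \<Longrightarrow> A + pscale t B + pscale (t\<^sup>2) C \<in> I"
  shows "A \<in> I \<and> B \<in> I \<and> C \<in> I"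
proof -
  have ne: "t1 \<noteq> t2" "t1 \<noteq> t3" "t2 \<noteq> t3" using t by (auto simp: card_insert_if split: if_splits)
  have pair: "B + pscale (s + t) C \<in> I"
    if "s \<in> {t1, t2, t3}" "t \<in> {t1, t2, t3}" "s \<noteq> t" for s t
  proof -
    have "pscale (inverse (s - t))
        ((A + pscale s B + pscale (s\<^sup>2) C) - (A + pscale t B + pscale (t\<^sup>2) C)) \<in> I"
      using mem that I tpoly.subspace_diff tpoly.subspace_scale by blast
    moreover have "pscale (inverse (s - t))
        ((A + pscale s B + pscale (s\<^sup>2) C) - (A + pscale t B + pscale (t\<^sup>2) C)) = B + pscale (s + t) C"
    proof (rule poly_mapping_eqI)
      fix m
      have "coef (pscale (inverse (s - t))
        ((A + pscale s B + pscale (s\<^sup>2) C) - (A + pscale t B + pscale (t\<^sup>2) C))) m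
        = inverse (s - t) * ((s - t) * (coef B m + (s + t) * coef C m))"
        by (simp add: lookup_add lookup_minus power2_eq_square ring_distribs)
      then show "coef (pscale (inverse (s - t))
        ((A + pscale s B + pscale (s\<^sup>2) C) - (A + pscale t B + pscale (t\<^sup>2) C))) m
        = coef (B + pscale (s + t) C) m"
        using that(3) by (simp add: lookup_add)
    qed
    ultimately show ?thesis by simp
  qed
  have "pscale (inverse (t2 - t3)) ((B + pscale (t1 + t2) C) - (B + pscale (t1 + t3) C)) \<in> I"
    using pair ne I tpoly.subspace_diff tpoly.subspace_scale by (metis insertCI)
  moreover have "pscale (inverse (t2 - t3)) ((B + pscale (t1 + t2) C) - (B + pscale (t1 + t3) C)) = C"
  proof (rule poly_mapping_eqI)
    fix m
    have "coef (pscale (inverse (t2 - t3)) ((B + pscale (t1 + t2) C) - (B + pscale (t1 + t3) C))) m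
      = inverse (t2 - t3) * ((t2 - t3) * coef C m)"
      by (simp add: lookup_add lookup_minus ring_distribs)
    then show "coef (pscale (inverse (t2 - t3)) ((B + pscale (t1 + t2) C) - (B + pscale (t1 + t3) C))) m = coef C m"
      using ne by simp
  qed
  ultimately have C: "C \<in> I" by simp
  have "(B + pscale (t1 + t2) C) - pscale (t1 + t2) C \<in> I"
    using pair[of t1 t2] ne C I tpoly.subspace_diff tpoly.subspace_scale by blast
  then have B: "B \<in> I" by simp
  have "(A + pscale t1 B + pscale (t1\<^sup>2) C) - pscale (t1\<^sup>2) C - pscale t1 B \<in> I"
    using mem[of t1] B C I tpoly.subspace_diff tpoly.subspace_scale by blast
  then have "A \<in> I" by simp
  then show ?thesis using B C by simp
qed

lemma mem_saturated_if_vars: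
  assumes I: "tideal.subspace I" and "\<And>i. Var i * v \<in> I"
  shows "v \<in> saturation I"
proof -
  have "q * v \<in> I" if "q \<in> graded_piece 1" for q
  proof (rule graded_mult_mem[OF I that])
    fix m :: expo assume "mdeg m = 1"
    then obtain i m' where m: "m = Poly_Mapping.single i 1 + m'" "mdeg m' = 0"
      using monomial_factor_var by (metis One_nat_def)
    have "monomial_poly m * v = monomial_poly m' * (Var i * v)"
      unfolding m(1) monomial_poly_add Var_eq_monomial by (simp only: ac_simps)
    then show "monomial_poly m * v \<in> I" by (simp only: ideal_mult[OF I assms(2)])
  qed
  then show ?thesis unfolding saturation_def by blast
qed

text \<open>
  The forms \<open>line_form t\<close>, any three of which are independent, cannot all be zero divisors:
  elements with maximal, pairwise different sets of annihilating forms are independent modulo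
  \<open>I\<close>, while the Hilbert function is bounded.
\<close>

lemma linear_nonzerodivisor_exists:
  assumes hom: "homogeneous_ideal I" and sat: "saturation I = I"
    and bound: "\<And>k. k0 \<le> k \<Longrightarrow> hilbert_function I k \<le> r"
  shows "\<exists>l\<in>graded_piece 1. \<forall>k. \<forall>v\<in>graded_piece k. l * v \<in> I \<longrightarrow> v \<in> I"
proof (rule ccontr)
  assume H: "\<not> ?thesis"
  have I: "tideal.subspace I" using hom by (simp add: homogeneous_ideal_def)
  note Isub = ideal_subspace[OF I]
  define P where "P v \<longleftrightarrow> v \<notin> I \<and> (\<exists>k. v \<in> graded_piece k)" for v
  define T where "T v = {t. line_form t * v \<in> I}" for v
  \<comment> \<open>Three annihilating forms would span all linear forms, so every variable would
    take \<open>v\<close> into \<open>I\<close>, and saturatedness would give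
    \<open>v \<in> I\<close>.\<close>
  have T_small: "finite (T v) \<and> card (T v) \<le> 2" if "P v" for v
  proof (rule ccontr)
    assume *: "\<not> ?thesis"
    have "\<exists>S\<subseteq>T v. finite S \<and> card S = 3"
    proof (cases "finite (T v)")
      case True
      then have "3 \<le> card (T v)" using * by simp
      then show ?thesis using obtain_subset_with_card_n True finite_subset by metis
    next
      case False
      then show ?thesis using infinite_arbitrarily_large by blast
    qed
    then obtain S where S: "S \<subseteq> T v" "card S = 3" by blast
    then obtain t1 t2 t3 where t: "S = {t1, t2, t3}" by (metis card_3_iff)
    have "Var 0 * v \<in> I \<and> Var 1 * v \<in> I \<and> Var 2 * v \<in> I"
    proof (rule three_line_forms[OF Isub])
      show "card {t1, t2, t3} = 3" using S t by simp
      fix t assume "t \<in> {t1, t2, t3}"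
      then have "line_form t * v \<in> I" using S t by (auto simp: T_def)
      then show "Var 0 * v + pscale t (Var 1 * v) + pscale (t\<^sup>2) (Var 2 * v) \<in> I"
        by (simp only: line_form_def distrib_right pscale_mult_left)
    qed
    then have "Var i * v \<in> I" for i using three_cases[of i] by auto
    then have "v \<in> I" using mem_saturated_if_vars[OF I] sat by blast
    then show False using that by (simp add: P_def)
  qed
  \<comment> \<open>By assumption every form kills something outside \<open>I\<close>; a maximal
    annihilating set exists because these sets have at most two elements.\<close>
  have "\<exists>v. (P v \<and> t \<in> T v) \<and> (\<forall>v'. P v' \<and> t \<in> T v' \<longrightarrow> card (T v') \<le> card (T v))" for t
  proof -
    from H line_form_graded obtain k v where "v \<in> graded_piece k" "line_form t * v \<in> I" "v \<notin> I"
      by blast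
    then have "P v \<and> t \<in> T v" by (auto simp: P_def T_def)
    moreover have "\<forall>v'. P v' \<and> t \<in> T v' \<longrightarrow> card (T v') < 3"
    proof (intro allI impI)
      fix v' assume "P v' \<and> t \<in> T v'"
      then show "card (T v') < 3" using T_small[of v'] by simp
    qed
    ultimately show ?thesis
      by (rule ex_has_greatest_nat[where P="\<lambda>v. P v \<and> t \<in> T v" and f="\<lambda>v. card (T v)"])
  qed
  then have "\<exists>V. \<forall>t. (P (V t) \<and> t \<in> T (V t)) \<and> (\<forall>v'. P v' \<and> t \<in> T v' \<longrightarrow> card (T v') \<le> card (T (V t)))"
    by (intro choice allI)
  then obtain V where PV: "\<And>t. P (V t)" and TV: "\<And>t. t \<in> T (V t)"
    and max: "\<And>t v. P v \<Longrightarrow> t \<in> T v \<Longrightarrow> card (T v) \<le> card (T (V t))" by blast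
  \<comment> \<open>A multiple is killed by at least the same forms, and by maximality by no others
    as long as it stays outside \<open>I\<close>.\<close>
  have T_mult: "T (q * V t) = T (V t)" if "P (q * V t)" for q t
  proof -
    have "T (V t) \<subseteq> T (q * V t)"
      unfolding T_def using ideal_mult[OF I] by (auto simp only: mem_Collect_eq mult.left_commute[of _ q])
    moreover have "card (T (q * V t)) \<le> card (T (V t))"
      using max[OF that] TV calculation by blast
    ultimately show ?thesis using T_small[OF that] by (metis card_seteq)
  qed
  have step: "P (line_form s * (q * V t))" if "P (q * V t)" "s \<notin> T (V t)" for s q t
  proof -
    have "line_form s * (q * V t) \<notin> I" using T_mult[OF that(1)] that(2) by (auto simp: T_def)
    then show ?thesis using that(1) graded_piece_mult[OF line_form_graded] unfolding P_def by blast
  qed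
  \<comment> \<open>Finitely many finite sets cannot cover the complex numbers, but each
    \<open>t\<close> lies in its own set.\<close>
  have "infinite (range (\<lambda>t. T (V t)))"
  proof
    assume "finite (range (\<lambda>t. T (V t)))"
    then have "finite (\<Union>(range (\<lambda>t. T (V t))))" using T_small PV by (intro finite_Union) auto
    moreover have "\<Union>(range (\<lambda>t. T (V t))) = UNIV" using TV by blast
    ultimately show False using infinite_UNIV_char_0[where 'a=complex] by simp
  qed
  then obtain F where F: "F \<subseteq> range (\<lambda>t. T (V t))" "finite F" "card F = Suc r"
    using infinite_arbitrarily_large by blast
  have "\<forall>A\<in>F. \<exists>t. T (V t) = A" using F(1) by blast
  then obtain \<tau> where \<tau>: "\<And>A. A \<in> F \<Longrightarrow> T (V (\<tau> A)) = A" by metis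
  have "\<exists>d. \<forall>A. V (\<tau> A) \<in> graded_piece (d A)" using PV by (intro choice) (auto simp: P_def)
  then obtain d where d: "\<And>A. V (\<tau> A) \<in> graded_piece (d A)" by blast
  have "finite (\<Union>F)"
  proof (rule finite_Union[OF F(2)])
    show "finite A" if "A \<in> F" for A using T_small[OF PV] \<tau>[OF that] by metis
  qed
  \<comment> \<open>Powers of \<open>line_form s\<close> lift the chosen elements to a common degree
    \<open>K\<close> without entering \<open>I\<close> and without changing their annihilating
    sets.\<close>
  then obtain s where s: "s \<notin> \<Union>F" using infinite_UNIV_char_0 ex_new_if_finite by blast
  define K where "K = k0 + (\<Sum>A\<in>F. d A)"
  have dK: "d A \<le> K" if "A \<in> F" for A
    using member_le_sum[OF that _ F(2), of d] by (simp add: K_def)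
  define u where "u A = line_form s ^ (K - d A) * V (\<tau> A)" for A
  have pow: "P (line_form s ^ n * V (\<tau> A))" if "A \<in> F" for A n
  proof (induction n)
    case 0
    then show ?case using PV by simp
  next
    case (Suc n)
    have "s \<notin> T (V (\<tau> A))" using s \<tau> that by blast
    from step[OF Suc this] show ?case by (simp only: power_Suc mult.assoc)
  qed
  have Pu: "P (u A)" if "A \<in> F" for A unfolding u_def by (rule pow[OF that])
  have Tu: "T (u A) = A" if "A \<in> F" for A
    using T_mult[OF pow[OF that]] \<tau>[OF that] by (simp add: u_def)
  have pow_graded: "line_form s ^ n \<in> graded_piece n" for n
  proof (induction n)
    case 0
    have "(1 :: tpoly) = Poly_Mapping.single 0 1" by simp
    then show ?case using single_in_graded_piece[of 0 0 1] by (simp only: power_0 mdeg_zero)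
  next
    case (Suc n)
    then show ?case using graded_piece_mult[OF line_form_graded Suc] by simp
  qed
  have uK: "u A \<in> graded_piece K" if "A \<in> F" for A
    using graded_piece_mult[OF pow_graded d, of "K - d A" A] dK[OF that] by (simp add: u_def)
  have "tpoly.dim (I \<inter> graded_piece K) + card F \<le> tpoly.dim (graded_piece K)"
  proof (rule tpoly.dim_add_card_le[OF _ graded_piece_finitely_spanned subspace_graded_piece
        subspace_ideal_graded[OF I] _ F(2)])
    show "u ` F \<subseteq> graded_piece K" using uK by blast
    fix c assume c: "(\<Sum>A\<in>F. pscale (c A) (u A)) \<in> I \<inter> graded_piece K"
    show "\<forall>A\<in>F. c A = 0"
    proof (rule ballI, rule ccontr)
      fix A assume A: "A \<in> F" and cA: "c A \<noteq> 0"
      \<comment> \<open>A proper inclusion of \<open>B\<close> in \<open>A\<close> would give a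
        larger annihilating set containing the parameter for which \<open>B\<close> was
        maximal.\<close>
      have "\<exists>t. t \<in> B \<and> t \<notin> A" if B: "B \<in> F" "B \<noteq> A" for B
      \<comment> \<open>The resulting product \<open>?Q\<close> below contains, for each
        \<open>B\<close> other than \<open>A\<close>, a form that kills \<open>u B\<close>, but none
        that kills \<open>u A\<close>; it isolates the coefficient \<open>c A\<close>.\<close>
      proof (rule ccontr)
        assume "\<not> ?thesis"
        then have "B \<subset> A" using B by blast
        moreover have "finite A" using T_small[OF Pu[OF A]] Tu[OF A] by simp
        ultimately have "card B < card A" by (rule psubset_card_mono[rotated])
        moreover have "\<tau> B \<in> T (u A)" using TV[of "\<tau> B"] \<tau>[OF B(1)] Tu[OF A] \<open>B \<subset> A\<close> by auto
        from max[OF Pu[OF A] this] have "card A \<le> card B" using \<tau>[OF B(1)] Tu[OF A] by simp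
        ultimately show False by simp
      qed
      then obtain f where f: "\<And>B. B \<in> F - {A} \<Longrightarrow> f B \<in> B \<and> f B \<notin> A" by (metis Diff_iff singletonI)
      let ?Q = "\<Prod>B\<in>F - {A}. line_form (f B)"
      have P_prod: "P ((\<Prod>B\<in>G. line_form (f B)) * u A)" if "finite G" "G \<subseteq> F - {A}" for G
        using that
      proof (induction G)
        case empty
        then show ?case using Pu[OF A] by simp
      next
        case (insert B G)
        let ?q = "(\<Prod>B\<in>G. line_form (f B)) * line_form s ^ (K - d A)"
        have "P (?q * V (\<tau> A))" using insert.IH insert.prems by (simp only: u_def mult.assoc) simp
        moreover have "f B \<notin> T (V (\<tau> A))" using f[of B] insert.prems \<tau>[OF A] by auto
        ultimately have "P (line_form (f B) * (?q * V (\<tau> A)))" by (rule step)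
        then show ?case unfolding prod.insert[OF insert.hyps] u_def by (simp only: mult.assoc)
      qed
      have other: "?Q * u B \<in> I" if B: "B \<in> F - {A}" for B
      proof -
        have "line_form (f B) * u B \<in> I" using f[OF B] Tu[of B] B by (auto simp: T_def)
        then have "(\<Prod>B\<in>F - {A} - {B}. line_form (f B)) * (line_form (f B) * u B) \<in> I"
          by (rule ideal_mult[OF I])
        moreover have "?Q = line_form (f B) * (\<Prod>B\<in>F - {A} - {B}. line_form (f B))"
          using B F(2) by (intro prod.remove) auto
        ultimately show ?thesis by (simp only: ac_simps)
      qed
      have "?Q * (\<Sum>B\<in>F. pscale (c B) (u B)) \<in> I" using c ideal_mult[OF I] by blast
      moreover have "?Q * (\<Sum>B\<in>F. pscale (c B) (u B))
          = pscale (c A) (?Q * u A) + (\<Sum>B\<in>F - {A}. pscale (c B) (?Q * u B))"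
        unfolding sum_distrib_left pscale_mult_right by (rule sum.remove[OF F(2) A])
      moreover have "(\<Sum>B\<in>F - {A}. pscale (c B) (?Q * u B)) \<in> I"
        by (intro tpoly.subspace_sum[OF Isub] tpoly.subspace_scale[OF Isub] other)
      moreover have "a \<in> I" if "s \<in> I" "s = a + b" "b \<in> I" for a b s
        using tpoly.subspace_diff[OF Isub that(1,3)] that(2) by simp
      ultimately have "pscale (c A) (?Q * u A) \<in> I" by blast
      then have "pscale (inverse (c A)) (pscale (c A) (?Q * u A)) \<in> I"
        by (rule tpoly.subspace_scale[OF Isub])
      then have "?Q * u A \<in> I"
        unfolding tpoly.scale_scale left_inverse[OF cA] tpoly.scale_one .
      then show False using P_prod[OF finite_Diff[OF F(2)] subset_refl] unfolding P_def by blast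
    qed
  qed auto
  then have "hilbert_function I K \<ge> Suc r" by (simp add: hilbert_function_def F(3))
  then show False using bound[of K] by (simp add: K_def)
qed

text \<open>A complement of the ideal in degree k stays independent modulo the ideal after
  multiplication by \<open>l\<close>.\<close>

lemma hilbert_function_mono_step:
  assumes I: "tideal.subspace I" and l: "l \<in> graded_piece 1"
    and nzd: "\<And>v. v \<in> graded_piece k \<Longrightarrow> l * v \<in> I \<Longrightarrow> v \<in> I"
  shows "hilbert_function I k \<le> hilbert_function I (Suc k)"
proof -
  obtain C where C: "finite C" "C \<subseteq> graded_piece k"
    "card C = tpoly.dim (graded_piece k) - tpoly.dim (I \<inter> graded_piece k)"
    "\<And>c. (\<Sum>v\<in>C. pscale (c v) v) \<in> I \<inter> graded_piece k \<Longrightarrow> \<forall>v\<in>C. c v = 0"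
    by (rule tpoly.complement_basis_exists[OF _ graded_piece_finitely_spanned subspace_graded_piece
          subspace_ideal_graded[OF I], of k k]) auto
  have "tpoly.dim (I \<inter> graded_piece (Suc k)) + card C \<le> tpoly.dim (graded_piece (Suc k))"
  proof (rule tpoly.dim_add_card_le[OF _ graded_piece_finitely_spanned subspace_graded_piece
        subspace_ideal_graded[OF I] _ C(1)])
    show "(*) l ` C \<subseteq> graded_piece (Suc k)" using graded_piece_mult[OF l] C(2) by fastforce
    fix c assume "(\<Sum>v\<in>C. pscale (c v) (l * v)) \<in> I \<inter> graded_piece (Suc k)"
    then have "l * (\<Sum>v\<in>C. pscale (c v) v) \<in> I"
      by (simp add: sum_distrib_left pscale_mult_right)
    moreover have "(\<Sum>v\<in>C. pscale (c v) v) \<in> graded_piece k"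
      using C(2) by (intro tpoly.subspace_sum[OF subspace_graded_piece]
          tpoly.subspace_scale[OF subspace_graded_piece]) auto
    ultimately show "\<forall>v\<in>C. c v = 0" using nzd C(4) by blast
  qed auto
  then show ?thesis using C(3) by (simp add: hilbert_function_def)
qed

lemma hilbert_function_saturated_mono:
  assumes hom: "homogeneous_ideal I" and sat: "saturation I = I"
    and bound: "\<And>k. k0 \<le> k \<Longrightarrow> hilbert_function I k \<le> r" and "j \<le> k"
  shows "hilbert_function I j \<le> hilbert_function I k"
proof -
  obtain l where l: "l \<in> graded_piece 1" "\<forall>k. \<forall>v\<in>graded_piece k. l * v \<in> I \<longrightarrow> v \<in> I"
    using linear_nonzerodivisor_exists[OF hom sat bound] by blast
  have "hilbert_function I k \<le> hilbert_function I (Suc k)" for k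
    using hilbert_function_mono_step[OF _ l(1)] l(2) hom by (auto simp: homogeneous_ideal_def)
  then show ?thesis using \<open>j \<le> k\<close> by (rule lift_Suc_mono_le)
qed

section \<open>Recognising a member of the family as a saturation\<close>

context diagonal_family
begin

lemma finite_gens: "finite (gens p w)"
  by (simp add: gens_def full_SetCompr_eq setcompr_eq_image)

lemma gens_graded:
  assumes "g \<in> gens p w"
  shows "\<exists>k. g \<in> graded_piece k"
proof -
  have V: "Var j ^ k \<in> graded_piece k" for j k
    unfolding Var_power using monomial_poly_graded[of "Poly_Mapping.single j k"] by simp
  have "Var (x i) ^ N - pscale c (Var (x p) ^ N) \<in> graded_piece N" for i c
    by (intro tpoly.subspace_diff[OF subspace_graded_piece] tpoly.subspace_scale[OF subspace_graded_piece] V)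
  then show ?thesis using assms V unfolding gens_def by blast
qed

text \<open>An element of \<open>saturation I\<close> enters \<open>I\<close> after multiplication
  by forms of some degree. Beyond the sum of these degrees and the degrees of the generators, every
  coefficient of a generator has large enough degree.\<close>

lemma J_large_degree:
  assumes w: "w $ p \<noteq> 0" and I: "homogeneous_ideal I" and g: "gens p w \<subseteq> saturation I"
  shows "\<exists>k0. \<forall>k\<ge>k0. J w \<inter> graded_piece k \<subseteq> I"
proof -
  have Is: "tideal.subspace I" using I by (simp add: homogeneous_ideal_def)
  have "\<forall>g\<in>gens p w. \<exists>n. \<forall>q\<in>graded_piece n. q * g \<in> I"
    using g by (auto simp: saturation_def)
  then obtain n where n: "\<And>g. g \<in> gens p w \<Longrightarrow> \<forall>q\<in>graded_piece (n g). q * g \<in> I" by metis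
  obtain d where d: "\<And>g. g \<in> gens p w \<Longrightarrow> g \<in> graded_piece (d g)" using gens_graded by metis
  define k0 where "k0 = (\<Sum>g\<in>gens p w. n g + d g)"
  have "f \<in> I" if k: "k0 \<le> k" and f: "f \<in> J w" "f \<in> graded_piece k" for f k
  proof -
    obtain s where s: "f = (\<Sum>g\<in>gens p w. s g * g)"
      using f(1) unfolding J_eq_span[OF w] tideal.span_finite[OF finite_gens] by auto
    \<comment> \<open>Passing to degree \<open>k\<close> replaces the arbitrary coefficients by
      homogeneous ones of degree \<open>k - d g\<close>.\<close>
    have "f = hom_component k f" using f(2) by (simp add: hom_component_of_graded)
    also have "\<dots> = (\<Sum>g\<in>gens p w. hom_component k (g * s g))"
      by (simp only: s hom_component_sum mult.commute)
    also have "\<dots> \<in> I"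
    proof (rule tideal.subspace_sum[OF Is])
      fix g assume g: "g \<in> gens p w"
      have "n g + d g \<le> k0"
        unfolding k0_def using member_le_sum[OF g _ finite_gens, of "\<lambda>g. n g + d g"] by simp
      then have "n g \<le> k - d g" "d g \<le> k" using k by auto
      then have "hom_component (k - d g) (s g) * g \<in> I"
        using graded_mult_mem_mono[OF Is _ n[OF g]] by simp
      moreover have "hom_component k (g * s g) = hom_component (k - d g) (s g) * g"
        unfolding hom_component_mult[OF d[OF g]] using \<open>d g \<le> k\<close> by (simp only: if_True mult.commute)
      ultimately show "hom_component k (g * s g) \<in> I" by simp
    qed
    finally show ?thesis .
  qed
  then show ?thesis by (intro exI[of _ k0]) blast
qed

text \<open>In large degrees \<open>J w\<close> lies in \<open>I\<close>, and the Hilbert functions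
  force equality there. Ideals that agree in large degrees have the same saturation, and
  \<open>J w\<close> is its own.\<close>

lemma saturation_eq_J:
  assumes w: "w $ p \<noteq> 0" and I: "homogeneous_ideal I" and g: "gens p w \<subseteq> saturation I"
    and hf: "\<And>k. k1 \<le> k \<Longrightarrow> hilbert_function I k \<ge> hilbert_function (J w) k"
  shows "saturation I = J w"
proof
  have Is: "tideal.subspace I" using I by (simp add: homogeneous_ideal_def)
  have w0: "w \<noteq> 0" using w by auto
  show "J w \<subseteq> saturation I"
    unfolding J_eq_span[OF w] by (rule ideal_span_subset[OF ideal_saturation[OF Is] g])
  obtain k0 where k0: "\<And>k. k0 \<le> k \<Longrightarrow> J w \<inter> graded_piece k \<subseteq> I"
    using J_large_degree[OF w I g] by blast
  have eq: "J w \<inter> graded_piece k = I \<inter> graded_piece k" if k: "k0 + k1 \<le> k" for k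
  proof (rule tpoly.subspace_eq_if_dim_le[where T = "monomial_poly ` {m. mdeg m = k}"])
    show "I \<inter> graded_piece k \<subseteq> tpoly.span (monomial_poly ` {m. mdeg m = k})"
      using graded_piece_finitely_spanned by blast
    show "tpoly.dim (I \<inter> graded_piece k) \<le> tpoly.dim (J w \<inter> graded_piece k)"
      using hf[of k] k hilbert_function_add_dim[OF Is, of k] hilbert_function_add_dim[OF ideal_J, of w k]
      by linarith
    show "J w \<inter> graded_piece k \<subseteq> I \<inter> graded_piece k" using k0[of k] k by auto
  qed (simp_all add: subspace_ideal_graded Is ideal_J)
  show "saturation I \<subseteq> J w"
  proof
    fix f assume "f \<in> saturation I"
    then obtain n where n: "\<forall>q\<in>graded_piece n. q * f \<in> I" by (auto simp: saturation_def)
    let ?M = "n + k0 + k1"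
    have M: "\<forall>q\<in>graded_piece ?M. q * f \<in> I" by (rule graded_mult_mem_mono[OF Is _ n]) simp
    have "hom_component j f \<in> J w" for j
    proof -
      have "q * hom_component j f \<in> J w" if q: "q \<in> graded_piece ?M" for q
      proof -
        have "hom_component (?M + j) (q * f) \<in> I"
          using M q I by (auto simp: homogeneous_ideal_def)
        then have "q * hom_component j f \<in> I" unfolding hom_component_mult[OF q] by simp
        moreover have "q * hom_component j f \<in> graded_piece (?M + j)"
          using graded_piece_mult[OF q] by simp
        ultimately show ?thesis using eq[of "?M + j"] by auto
      qed
      then have "hom_component j f \<in> saturation (J w)" unfolding saturation_def by blast
      then show ?thesis by (simp add: saturation_J[OF w0])
    qed
    then show "f \<in> J w"
      by (subst sum_hom_component) (rule tideal.subspace_sum[OF ideal_J])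
  qed
qed

end

text \<open>The exponent at \<open>q\<close> is determined by the degree, and it is nonnegative
  because \<open>k\<close> is at least the largest possible sum of the other exponents; so the count
  is that of a full box.\<close>

lemma card_box:
  fixes B :: "3 \<Rightarrow> nat"
  assumes "(\<Sum>j\<in>- {q}. B j - 1) \<le> k"
  shows "card {m. mdeg m = k \<and> (\<forall>j. j \<noteq> q \<longrightarrow> coef m j < B j)} = (\<Prod>j\<in>- {q}. B j)"
proof -
  let ?M = "{m. mdeg m = k \<and> (\<forall>j. j \<noteq> q \<longrightarrow> coef m j < B j)}"
  have md: "mdeg m = coef m q + (\<Sum>j\<in>- {q}. coef m j)" for m
    unfolding mdeg_def by (subst sum.remove[of _ q]) (auto simp: Compl_eq_Diff_UNIV)
  have "bij_betw (\<lambda>m. restrict (coef m) (- {q})) ?M (PiE (- {q}) (\<lambda>j. {..<B j}))"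
  proof (rule bij_betwI')
    fix m m' assume m: "m \<in> ?M" and m': "m' \<in> ?M"
    show "(restrict (coef m) (- {q}) = restrict (coef m') (- {q})) = (m = m')"
    proof
      assume *: "restrict (coef m) (- {q}) = restrict (coef m') (- {q})"
      have off: "coef m j = coef m' j" if "j \<noteq> q" for j
        using fun_cong[OF *, of j] that by simp
      then have "(\<Sum>j\<in>- {q}. coef m j) = (\<Sum>j\<in>- {q}. coef m' j)" by (intro sum.cong) auto
      then have "coef m q = coef m' q" using m m' md[of m] md[of m'] by simp
      then show "m = m'" using off by (metis poly_mapping_eqI)
    qed simp
  next
    fix m assume "m \<in> ?M"
    then show "restrict (coef m) (- {q}) \<in> PiE (- {q}) (\<lambda>j. {..<B j})" by auto
  next
    fix f assume f: "f \<in> PiE (- {q}) (\<lambda>j. {..<B j})"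
    then have fB: "f j < B j" if "j \<noteq> q" for j using that by auto
    define m :: expo where "m = Abs_poly_mapping (\<lambda>j. if j = q then k - (\<Sum>j\<in>- {q}. f j) else f j)"
    have cm: "coef m j = (if j = q then k - (\<Sum>j\<in>- {q}. f j) else f j)" for j
      unfolding m_def by simp
    have "f j \<le> B j - 1" if "j \<in> - {q}" for j using fB[of j] that by auto
    then have "(\<Sum>j\<in>- {q}. f j) \<le> (\<Sum>j\<in>- {q}. B j - 1)" by (rule sum_mono)
    then have "(\<Sum>j\<in>- {q}. f j) \<le> k" using assms by simp
    moreover have "(\<Sum>j\<in>- {q}. coef m j) = (\<Sum>j\<in>- {q}. f j)"
      by (intro sum.cong) (auto simp: cm)
    ultimately have "mdeg m = k" using md[of m] cm[of q] by simp
    then have "m \<in> ?M" using fB by (auto simp: cm)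
    moreover have "f = restrict (coef m) (- {q})"
    proof
      fix j show "f j = restrict (coef m) (- {q}) j"
        using f by (cases "j = q") (auto simp: cm PiE_def extensional_def)
    qed
    ultimately show "\<exists>m\<in>?M. f = restrict (coef m) (- {q})" by blast
  qed
  then have "card ?M = card (PiE (- {q}) (\<lambda>j. {..<B j}))" by (rule bij_betw_same_card)
  then show ?thesis by (simp add: card_PiE)
qed

context diagonal_family
begin

lemma card_NF:
  assumes "(\<Sum>j\<in>- {x p}. (if j \<in> range x then N else bd j) - 1) \<le> k"
  shows "card (NF p \<inter> {m. mdeg m = k}) = (\<Prod>j\<in>- {x p}. if j \<in> range x then N else bd j)"
proof -
  have "NF p \<inter> {m. mdeg m = k}
    = {m. mdeg m = k \<and> (\<forall>j. j \<noteq> x p \<longrightarrow> coef m j < (if j \<in> range x then N else bd j))}"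
    by (auto simp: NF_def ok_def x_eq_iff)
  then show ?thesis using card_box[OF assms] by simp
qed

end

subsection \<open>The apolar ideal of a monomial\<close>

lemma mdeg_expand: "mdeg m = coef m 0 + coef m 1 + coef m 2"
proof -
  have "(3 :: 3) = 0" by simp
  then show ?thesis unfolding mdeg_def sum_3 by (simp only: ac_simps)
qed

lemma expo_eqI:
  fixes m n :: expo
  assumes "coef m 0 = coef n 0" "coef m 1 = coef n 1" "coef m 2 = coef n 2"
  shows "m = n"
proof (rule poly_mapping_eqI)
  show "coef m i = coef n i" for i using three_cases[of i] assms by auto
qed

lemma pdiff_single:
  "pdiff i (Poly_Mapping.single m c)
    = Poly_Mapping.single (m - Poly_Mapping.single i 1) (of_nat (coef m i) * c)"
  by (cases "c = 0") (simp_all add: pdiff_def)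

lemma pdiff_power_single:
  "(pdiff i ^^ n) (Poly_Mapping.single m c)
    = Poly_Mapping.single (m - Poly_Mapping.single i n) ((\<Prod>l<n. of_nat (coef m i - l)) * c)"
proof (induction n)
  case 0
  then show ?case by simp
next
  case (Suc n)
  have "m - Poly_Mapping.single i n - Poly_Mapping.single i 1 = m - Poly_Mapping.single i (Suc n)"
    by (rule poly_mapping_eqI) (simp add: lookup_minus lookup_single when_def)
  moreover have "coef (m - Poly_Mapping.single i n) i = coef m i - n"
    by (simp add: lookup_minus)
  ultimately show ?case unfolding funpow.simps(2) comp_def Suc pdiff_single by (simp add: mult_ac)
qed

text \<open>The falling factorial from an n-fold derivative. Truncated subtraction agrees with it,
  since the factor with \<open>l = k\<close> is already zero.\<close>

lemma prod_diff_eq_0_iff: "(\<Prod>l<n. of_nat (k - l) :: complex) = 0 \<longleftrightarrow> k < n"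
  by auto

definition below :: "nat \<Rightarrow> nat \<Rightarrow> nat \<Rightarrow> expo \<Rightarrow> bool"
  where "below a b c m \<longleftrightarrow> coef m 0 \<le> a \<and> coef m 1 \<le> b \<and> coef m 2 \<le> c"

definition monomial_ann :: "nat \<Rightarrow> nat \<Rightarrow> nat \<Rightarrow> tpoly set"
  where "monomial_ann a b c = {p. \<forall>m. coef p m \<noteq> 0 \<longrightarrow> \<not> below a b c m}"

lemma iterated_pdiff_single:
  "(pdiff 0 ^^ coef n 0) ((pdiff 1 ^^ coef n 1) ((pdiff 2 ^^ coef n 2) (Poly_Mapping.single v 1)))
    = Poly_Mapping.single (v - n) ((\<Prod>l<coef n 0. of_nat (coef v 0 - l)) *
       ((\<Prod>l<coef n 1. of_nat (coef v 1 - l)) * (\<Prod>l<coef n 2. of_nat (coef v 2 - l))))"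
proof -
  have "v - Poly_Mapping.single 2 (coef n 2) - Poly_Mapping.single 1 (coef n 1)
      - Poly_Mapping.single 0 (coef n 0) = v - n"
    by (rule expo_eqI) (simp_all add: lookup_minus lookup_single when_def)
  then show ?thesis
    by (simp add: pdiff_power_single lookup_minus lookup_single when_def)
qed

text \<open>A monomial that does not divide \<open>monomial_poly v\<close> kills it. Distinct
  divisors send it to distinct monomials with nonzero coefficients, so no cancellation can
  occur.\<close>

lemma Ann_monomial:
  assumes "coef v 0 = a" "coef v 1 = b" "coef v 2 = c"
  shows "Ann (monomial_poly v) = monomial_ann a b c"
proof -
  define C :: "expo \<Rightarrow> complex" where "C n = (\<Prod>l<coef n 0. of_nat (coef v 0 - l)) *
       ((\<Prod>l<coef n 1. of_nat (coef v 1 - l)) * (\<Prod>l<coef n 2. of_nat (coef v 2 - l)))" for n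
  have C0: "C n = 0 \<longleftrightarrow> \<not> below a b c n" for n
    unfolding C_def mult_eq_0_iff prod_diff_eq_0_iff below_def using assms by auto
  have act: "apolar_act p (monomial_poly v) = (\<Sum>n\<in>supp p. Poly_Mapping.single (v - n) (coef p n * C n))" for p
    unfolding apolar_act_def monomial_poly_def iterated_pdiff_single C_def by simp
  have "apolar_act p (monomial_poly v) = 0 \<longleftrightarrow> p \<in> monomial_ann a b c" for p
  proof
    assume p: "p \<in> monomial_ann a b c"
    have "C n = 0" if "n \<in> supp p" for n
      using that p C0 by (simp add: monomial_ann_def in_keys_iff)
    then show "apolar_act p (monomial_poly v) = 0" unfolding act by (intro sum.neutral) simp
  next
    assume z: "apolar_act p (monomial_poly v) = 0"
    show "p \<in> monomial_ann a b c"
    proof (rule ccontr)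
      assume "p \<notin> monomial_ann a b c"
      then obtain n where n: "coef p n \<noteq> 0" "below a b c n" by (auto simp: monomial_ann_def)
      \<comment> \<open>Exponent subtraction truncates at 0; it is injective only on the divisors of
        \<open>v\<close>.\<close>
      have eq: "k = n" if "below a b c k" "v - k = v - n" for k
      proof -
        have "coef v i - coef k i = coef v i - coef n i" for i
          using arg_cong[OF that(2), of "\<lambda>m. coef m i"] by (simp add: lookup_minus)
        from this[of 0] this[of 1] this[of 2] show ?thesis
          using that(1) n(2) assms by (intro expo_eqI) (auto simp: below_def)
      qed
      have "coef (apolar_act p (monomial_poly v)) (v - n)
          = (\<Sum>k\<in>supp p. if v - k = v - n then coef p k * C k else 0)"
        unfolding act by (simp add: lookup_sum lookup_single when_def)
      also have "\<dots> = (\<Sum>k\<in>supp p. if k = n then coef p k * C k else 0)"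
        using eq C0 by (intro sum.cong) auto
      also have "\<dots> = coef p n * C n" using n(1) by (simp add: in_keys_iff)
      finally show False using z n C0 by simp
    qed
  qed
  then show ?thesis by (auto simp: Ann_def)
qed

lemma Ann_power_product:
  "Ann (Var 0 ^ a * Var 1 ^ b * Var 2 ^ c) = monomial_ann a b c"
proof -
  let ?v = "Poly_Mapping.single 0 a + Poly_Mapping.single 1 b + Poly_Mapping.single 2 c :: expo"
  have "Var 0 ^ a * Var 1 ^ b * Var 2 ^ c = monomial_poly ?v"
    by (simp only: Var_power monomial_poly_add)
  moreover have "Ann (monomial_poly ?v) = monomial_ann a b c"
    by (rule Ann_monomial) (simp_all add: lookup_add lookup_single when_def)
  ultimately show ?thesis by simp
qed

lemma ideal_monomial_ann: "tideal.subspace (monomial_ann a b c)"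
proof (rule tideal.subspaceI)
  show "0 \<in> monomial_ann a b c" by (simp add: monomial_ann_def)
  show "p + q \<in> monomial_ann a b c" if "p \<in> monomial_ann a b c" "q \<in> monomial_ann a b c" for p q
    using that unfolding monomial_ann_def by (rule tpoly.subspace_add[OF subspace_coef_constraint])
  show "q * p \<in> monomial_ann a b c" if p: "p \<in> monomial_ann a b c" for q p
    unfolding monomial_ann_def
  proof (intro CollectI allI impI)
    fix m assume "coef (q * p) m \<noteq> 0"
    then have "m \<in> {s + t | s t. s \<in> supp q \<and> t \<in> supp p}"
      using keys_mult[of q p] by (auto simp: in_keys_iff)
    then obtain s t where "m = s + t" "t \<in> supp p" by blast
    then show "\<not> below a b c m"
      using p by (auto simp: monomial_ann_def below_def lookup_add in_keys_iff)
  qed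
qed

lemma monomial_in_ann: "\<not> below a b c m \<Longrightarrow> monomial_poly m \<in> monomial_ann a b c"
  by (auto simp: monomial_ann_def coef_monomial_poly)

lemma hilbert_function_monomial_ann:
  "hilbert_function (monomial_ann a b c) k = card {m. mdeg m = k \<and> below a b c m}"
proof -
  have fin: "finite {m. mdeg m = k \<and> P m}" for P by (rule finite_subset[OF _ finite_mdeg_eq[of k]]) auto
  have "monomial_ann a b c \<inter> graded_piece k = {p. \<forall>m. coef p m \<noteq> 0 \<longrightarrow> mdeg m = k \<and> \<not> below a b c m}"
    by (auto simp: monomial_ann_def graded_piece_eq)
  then have "tpoly.dim (monomial_ann a b c \<inter> graded_piece k) = card {m. mdeg m = k \<and> \<not> below a b c m}"
    by (simp only: dim_coef_constraint[OF fin])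
  moreover have "card {m. mdeg m = k} = card {m. mdeg m = k \<and> below a b c m} + card {m. mdeg m = k \<and> \<not> below a b c m}"
  proof -
    have "{m. mdeg m = k \<and> below a b c m} \<union> {m. mdeg m = k \<and> \<not> below a b c m} = {m. mdeg m = k}"
      by auto
    moreover have "card ({m. mdeg m = k \<and> below a b c m} \<union> {m. mdeg m = k \<and> \<not> below a b c m})
        = card {m. mdeg m = k \<and> below a b c m} + card {m. mdeg m = k \<and> \<not> below a b c m}"
      by (rule card_Un_disjoint[OF fin fin]) auto
    ultimately show ?thesis by simp
  qed
  ultimately show ?thesis by (simp add: hilbert_function_def dim_graded_piece)
qed

lemma exists_expo: "\<exists>m :: expo. coef m 0 = i \<and> coef m 1 = j \<and> coef m 2 = l"
  by (rule exI[of _ "Poly_Mapping.single 0 i + Poly_Mapping.single 1 j + Poly_Mapping.single 2 l"])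
    (simp add: lookup_add lookup_single when_def)

lemma card_below:
  "card {m. mdeg m = k \<and> below a b c m}
    = card {(i, j). i \<le> a \<and> j \<le> b \<and> i + j \<le> k \<and> k - (i + j) \<le> c}"
proof (rule bij_betw_same_card)
  show "bij_betw (\<lambda>m. (coef m 0, coef m 1)) {m. mdeg m = k \<and> below a b c m}
      {(i, j). i \<le> a \<and> j \<le> b \<and> i + j \<le> k \<and> k - (i + j) \<le> c}"
  proof (rule bij_betwI')
    show "((coef m 0, coef m 1) = (coef m' 0, coef m' 1)) = (m = m')"
      if "m \<in> {m. mdeg m = k \<and> below a b c m}" "m' \<in> {m. mdeg m = k \<and> below a b c m}" for m m'
      using that by (auto simp: mdeg_expand intro: expo_eqI)
    show "(coef m 0, coef m 1) \<in> {(i, j). i \<le> a \<and> j \<le> b \<and> i + j \<le> k \<and> k - (i + j) \<le> c}"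
      if "m \<in> {m. mdeg m = k \<and> below a b c m}" for m
      using that by (auto simp: mdeg_expand below_def)
    fix y assume "y \<in> {(i, j). i \<le> a \<and> j \<le> b \<and> i + j \<le> k \<and> k - (i + j) \<le> c}"
    then obtain i j where y: "y = (i, j)" "i \<le> a" "j \<le> b" "i + j \<le> k" "k - (i + j) \<le> c" by auto
    obtain m :: expo where "coef m 0 = i" "coef m 1 = j" "coef m 2 = k - (i + j)"
      using exists_expo by blast
    then show "\<exists>m\<in>{m. mdeg m = k \<and> below a b c m}. y = (coef m 0, coef m 1)"
      using y by (intro bexI[of _ m]) (auto simp: mdeg_expand below_def)
  qed
qed

section \<open>The numerical conditions on ideals below the apolar ideal\<close>

context
  fixes a b c r :: nat
  assumes a: "0 < a" and b: "0 < b" and c: "c = a + b - 1" and r: "r = (a + 1) * (b + 1)"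
begin

text \<open>Count pairs in the box of size (a + 1)(b + 1), the third exponent being the complement
  to the degree. In degree c only the corner (a, b) fails, as its sum is c + 1; in degree c + 1 only
  (0, 0), whose third exponent would be c + 1; in degree c + 2 the three pairs of sum at most
  1.\<close>

lemma hf_ann_c: "hilbert_function (monomial_ann a b c) c = r - 1"
proof -
  have "{(i, j). i \<le> a \<and> j \<le> b \<and> i + j \<le> c \<and> c - (i + j) \<le> c} = {..a} \<times> {..b} - {(a, b)}"
    using a b c by auto
  then show ?thesis unfolding hilbert_function_monomial_ann card_below using r
    by (simp add: card_Diff_subset card_cartesian_product)
qed

lemma hf_ann_Suc_c: "hilbert_function (monomial_ann a b c) (Suc c) = r - 1"
proof -
  have "{(i, j). i \<le> a \<and> j \<le> b \<and> i + j \<le> Suc c \<and> Suc c - (i + j) \<le> c} = {..a} \<times> {..b} - {(0, 0)}"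
    using a b c by auto
  then show ?thesis unfolding hilbert_function_monomial_ann card_below using r
    by (simp add: card_Diff_subset card_cartesian_product)
qed

lemma hf_ann_Suc_Suc_c: "hilbert_function (monomial_ann a b c) (Suc (Suc c)) = r - 3"
proof -
  have "{(i, j). i \<le> a \<and> j \<le> b \<and> i + j \<le> Suc (Suc c) \<and> Suc (Suc c) - (i + j) \<le> c}
      = {..a} \<times> {..b} - {(0, 0), (0, 1), (1, 0)}"
    using a b c by auto
  moreover have "card ({..a} \<times> {..b} - {(0, 0), (0, 1), (1, 0)}) = r - 3"
    using r a b by (subst card_Diff_subset) (auto simp: card_cartesian_product)
  ultimately show ?thesis unfolding hilbert_function_monomial_ann card_below by simp
qed

lemma r_ge_4: "4 \<le> r"
proof -
  have "2 * 2 \<le> (a + 1) * (b + 1)" using a b by (intro mult_le_mono) auto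
  then show ?thesis using r by simp
qed

text \<open>The minimal generators of the apolar ideal are pure powers of degree at most c + 1, so a
  monomial of degree c + 2 in it is a proper multiple of one of them and can lose a
  variable.\<close>

lemma not_below_factor_var:
  assumes m: "mdeg m = Suc (Suc c)" "\<not> below a b c m"
  obtains j m' where "m = Poly_Mapping.single j 1 + m'" "mdeg m' = Suc c" "\<not> below a b c m'"
proof -
  have split: "\<exists>m'. m = Poly_Mapping.single j 1 + m' \<and> mdeg m' = Suc c \<and>
      (\<forall>i. coef m' i = (if i = j then coef m i - 1 else coef m i))"
    if "0 < coef m j" for j
  proof -
    let ?m' = "m - Poly_Mapping.single j 1"
    have e: "m = Poly_Mapping.single j 1 + ?m'"
      by (rule poly_mapping_eqI) (use that in \<open>auto simp: lookup_add lookup_minus lookup_single when_def\<close>)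
    then have "mdeg m = 1 + mdeg ?m'" by (metis mdeg_add mdeg_single)
    then show ?thesis using e m(1)
      by (intro exI[of _ ?m']) (auto simp: lookup_minus lookup_single when_def)
  qed
  have s: "coef m 0 + coef m 1 + coef m 2 = a + b + 1" using m(1) a b c by (simp add: mdeg_expand)
  have "\<exists>j. 0 < coef m j \<and> \<not> (coef m 0 - (if j = 0 then 1 else 0) \<le> a \<and>
      coef m 1 - (if j = 1 then 1 else 0) \<le> b \<and> coef m 2 - (if j = 2 then 1 else 0) \<le> c)"
  proof -
    have "(0 < coef m 0 \<and> \<not> (coef m 0 - 1 \<le> a \<and> coef m 1 \<le> b \<and> coef m 2 \<le> c)) \<or>
      (0 < coef m 1 \<and> \<not> (coef m 0 \<le> a \<and> coef m 1 - 1 \<le> b \<and> coef m 2 \<le> c)) \<or>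
      (0 < coef m 2 \<and> \<not> (coef m 0 \<le> a \<and> coef m 1 \<le> b \<and> coef m 2 - 1 \<le> c))"
      using s a b c m(2) unfolding below_def by arith
    then show ?thesis
    proof (elim disjE)
      assume "0 < coef m 0 \<and> \<not> (coef m 0 - 1 \<le> a \<and> coef m 1 \<le> b \<and> coef m 2 \<le> c)"
      then show ?thesis by (intro exI[of _ 0]) simp
    next
      assume "0 < coef m 1 \<and> \<not> (coef m 0 \<le> a \<and> coef m 1 - 1 \<le> b \<and> coef m 2 \<le> c)"
      then show ?thesis by (intro exI[of _ 1]) simp
    next
      assume "0 < coef m 2 \<and> \<not> (coef m 0 \<le> a \<and> coef m 1 \<le> b \<and> coef m 2 - 1 \<le> c)"
      then show ?thesis by (intro exI[of _ 2]) simp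
    qed
  qed
  then obtain j where j: "0 < coef m j" "\<not> (coef m 0 - (if j = 0 then 1 else 0) \<le> a \<and>
      coef m 1 - (if j = 1 then 1 else 0) \<le> b \<and> coef m 2 - (if j = 2 then 1 else 0) \<le> c)" by blast
  obtain m' where m': "m = Poly_Mapping.single j 1 + m'" "mdeg m' = Suc c"
    "\<And>i. coef m' i = (if i = j then coef m i - 1 else coef m i)" using split[OF j(1)] by blast
  have "\<not> below a b c m'" unfolding below_def m'(3) using j(2) by (auto split: if_splits)
  then show ?thesis using that m' by blast
qed

context
  fixes I
  assumes I: "tideal.subspace I" and sub: "I \<subseteq> monomial_ann a b c"
begin

lemma ann_codim_one:
  assumes hf: "hilbert_function I (Suc c) \<le> r"
    and u: "u \<in> monomial_ann a b c" "u \<in> graded_piece (Suc c)" "u \<notin> I"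
    and p: "p \<in> monomial_ann a b c" "p \<in> graded_piece (Suc c)"
  shows "\<exists>k. p - pscale k u \<in> I"
proof -
  let ?k = "Suc c"
  have "\<exists>k. p - pscale k u \<in> I \<inter> graded_piece ?k"
  proof (rule tpoly.codim_one_multiple[where V = "monomial_ann a b c \<inter> graded_piece ?k"
        and T = "monomial_poly ` {m. mdeg m = ?k}"])
    show "monomial_ann a b c \<inter> graded_piece ?k \<subseteq> tpoly.span (monomial_poly ` {m. mdeg m = ?k})"
      using graded_piece_finitely_spanned by blast
    show "tpoly.dim (monomial_ann a b c \<inter> graded_piece ?k) \<le> tpoly.dim (I \<inter> graded_piece ?k) + 1"
      using hf hf_ann_Suc_c r_ge_4 hilbert_function_add_dim[OF I, of ?k]
        hilbert_function_add_dim[OF ideal_monomial_ann, of a b c ?k] by linarith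
  qed (use sub u p in \<open>auto simp: subspace_ideal_graded I ideal_monomial_ann\<close>)
  then show ?thesis by blast
qed

text \<open>
  In degrees \<open>c\<close>, \<open>c + 1\<close>, \<open>c + 2\<close> the apolar ideal has codimension \<open>r - 1\<close>, \<open>r - 1\<close>, \<open>r - 3\<close>. If
  \<open>y\<^sub>i u\<close> were not in \<open>I\<close>, it would span the apolar ideal modulo \<open>I\<close> in degree \<open>c + 1\<close>, and then
  \<open>y\<^sub>i\<^sup>2 u\<close> would do so in degree \<open>c + 2\<close>, where \<open>I\<close> has codimension at least \<open>2\<close>.
\<close>

lemma var_mult_ann_mem:
  assumes hf: "hilbert_function I (Suc c) \<le> r" "r \<le> hilbert_function I (Suc (Suc c)) + 1"
    and u: "u \<in> monomial_ann a b c" "u \<in> graded_piece c"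
  shows "Var i * u \<in> I"
proof (rule ccontr)
  assume nI: "Var i * u \<notin> I"
  let ?A = "monomial_ann a b c" and ?k = "Suc (Suc c)"
  note Isub = ideal_subspace[OF I]
  define w where "w = Var i * u"
  have uj: "Var j * u \<in> ?A" "Var j * u \<in> graded_piece (Suc c)" for j
    using ideal_mult[OF ideal_monomial_ann u(1)] graded_piece_mult[OF Var_graded u(2)] by auto
  have rep: "\<exists>k. p - pscale k w \<in> I" if "p \<in> ?A" "p \<in> graded_piece (Suc c)" for p
    using ann_codim_one[OF hf(1) uj nI that] by (simp add: w_def)
  let ?z = "Var i * w"
  have mono: "\<exists>k. monomial_poly m - pscale k ?z \<in> I" if m: "mdeg m = ?k" "\<not> below a b c m" for m
  proof -
    obtain j m' where m': "m = Poly_Mapping.single j 1 + m'" "mdeg m' = Suc c" "\<not> below a b c m'"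
      using not_below_factor_var[OF m] by blast
    obtain k1 where k1: "monomial_poly m' - pscale k1 w \<in> I"
      using rep[OF monomial_in_ann[OF m'(3)]] monomial_poly_graded[of m'] m'(2) by auto
    obtain k2 where k2: "Var j * u - pscale k2 w \<in> I" using rep[OF uj] by blast
    \<comment> \<open>Since \<open>y_j w = y_i (y_j u)\<close>, the congruence for
      \<open>y_j u\<close> becomes one for \<open>y_j w\<close>: modulo \<open>I\<close> the
      monomial is \<open>k1 y_j w\<close>, hence \<open>k1 k2 ?z\<close>.\<close>
    have "Var j * (monomial_poly m' - pscale k1 w) \<in> I" by (rule ideal_mult[OF I k1])
    moreover have "pscale k1 (Var i * (Var j * u - pscale k2 w)) \<in> I"
      by (rule ideal_pscale[OF I ideal_mult[OF I k2]])
    ultimately have "Var j * (monomial_poly m' - pscale k1 w)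
        + pscale k1 (Var i * (Var j * u - pscale k2 w)) \<in> I"
      by (rule tpoly.subspace_add[OF Isub])
    moreover have "Var j * (monomial_poly m' - pscale k1 w)
        + pscale k1 (Var i * (Var j * u - pscale k2 w)) = monomial_poly m - pscale (k1 * k2) ?z"
    proof -
      have "Var j * pscale k1 w = pscale k1 (Var i * (Var j * u))"
        unfolding w_def pscale_mult_right by (simp only: mult.left_commute)
      moreover have "Var j * monomial_poly m' = monomial_poly m"
        by (simp only: m'(1) monomial_poly_add Var_eq_monomial)
      ultimately show ?thesis
        by (simp only: right_diff_distrib pscale_mult_right tpoly.scale_right_diff_distrib
            tpoly.scale_scale) simp
    qed
    ultimately show ?thesis by metis
  qed
  then obtain K where K: "\<And>m. mdeg m = ?k \<Longrightarrow> \<not> below a b c m \<Longrightarrow> monomial_poly m - pscale (K m) ?z \<in> I"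
    by metis
  have gen: "\<exists>d. p - (\<Sum>t\<in>{()}. pscale (d t) ?z) \<in> I \<inter> graded_piece ?k"
    if p: "p \<in> ?A \<inter> graded_piece ?k" for p
  proof -
    have zk: "?z \<in> graded_piece ?k"
      using graded_piece_mult[OF Var_graded uj(2)[of i], of i] by (simp add: w_def)
    let ?d = "\<Sum>m\<in>supp p. coef p m * K m"
    have "p - pscale ?d ?z = (\<Sum>m\<in>supp p. pscale (coef p m) (monomial_poly m - pscale (K m) ?z))"
      by (subst (1) sum_single[of p])
        (simp only: tpoly.scale_sum_left tpoly.scale_right_diff_distrib sum_subtractf
          pscale_monomial_poly tpoly.scale_scale)
    also have "\<dots> \<in> I"
    proof (intro tpoly.subspace_sum[OF Isub] tpoly.subspace_scale[OF Isub] K)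
      fix m assume "m \<in> supp p"
      then show "mdeg m = ?k" "\<not> below a b c m"
        using p by (auto simp: monomial_ann_def graded_piece_eq in_keys_iff)
    qed
    finally have "p - pscale ?d ?z \<in> I" .
    moreover have "p - pscale ?d ?z \<in> graded_piece ?k"
      using p zk by (intro tpoly.subspace_diff[OF subspace_graded_piece]
          tpoly.subspace_scale[OF subspace_graded_piece]) auto
    ultimately show ?thesis by (intro exI[of _ "\<lambda>_. ?d"]) simp
  qed
  have "tpoly.dim (?A \<inter> graded_piece ?k) \<le> tpoly.dim (I \<inter> graded_piece ?k) + card {()}"
  proof (rule tpoly.dim_le_dim_add_card[where T = "monomial_poly ` {m. mdeg m = ?k}", OF _ _ _ _ _ gen])
    show "?A \<inter> graded_piece ?k \<subseteq> tpoly.span (monomial_poly ` {m. mdeg m = ?k})"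
      using graded_piece_finitely_spanned by blast
  qed (use sub in \<open>auto simp: subspace_ideal_graded I\<close>)
  \<comment> \<open>The codimension r - 3 of the apolar ideal would bound that of \<open>I\<close>
    by r - 2, while at least r - 1 is assumed; \<open>r_ge_4\<close> controls the truncated
    subtractions.\<close>
  then show False
    using hf hf_ann_Suc_Suc_c r_ge_4 hilbert_function_add_dim[OF I, of ?k]
      hilbert_function_add_dim[OF ideal_monomial_ann, of a b c ?k] by simp
qed

text \<open>The witness for the saturation is the degree c - n + 1: it raises the power to degree c
  + 1, where each monomial multiple is a variable times an apolar form of degree c.\<close>

lemma var_power_in_saturation:
  assumes hf: "hilbert_function I (Suc c) \<le> r" "r \<le> hilbert_function I (Suc (Suc c)) + 1"
    and n: "n \<le> c" and nb: "\<not> below a b c (Poly_Mapping.single j n)"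
  shows "Var j ^ n \<in> saturation I"
proof -
  have "q * Var j ^ n \<in> I" if q: "q \<in> graded_piece (Suc (c - n))" for q
  proof (rule graded_mult_mem[OF I q])
    fix m assume "mdeg m = Suc (c - n)"
    then obtain i m' where m: "m = Poly_Mapping.single i 1 + m'" "mdeg m' = c - n"
      by (rule monomial_factor_var)
    let ?u = "monomial_poly m' * Var j ^ n"
    have "?u \<in> monomial_ann a b c"
      unfolding Var_power by (rule ideal_mult[OF ideal_monomial_ann monomial_in_ann[OF nb]])
    moreover have "?u \<in> graded_piece c"
      using monomial_poly_graded[of "m' + Poly_Mapping.single j n"] m(2) n
      by (simp add: Var_power monomial_poly_add)
    ultimately have "Var i * ?u \<in> I" by (rule var_mult_ann_mem[OF hf])
    then show "monomial_poly m * Var j ^ n \<in> I"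
      by (simp only: m(1) monomial_poly_add Var_eq_monomial mult.assoc)
  qed
  then show ?thesis unfolding saturation_def by blast
qed

end

end

subsection \<open>Morphisms of spaces with functions\<close>

lemma rational_expr_subset: "rational_expr X G U f \<Longrightarrow> U \<subseteq> X"
  by (induction rule: rational_expr.induct) auto

text \<open>Adding \<open>0 * g\<close> cuts the domain down to that of \<open>g\<close> without
  changing a value.\<close>

lemma rational_expr_restrict:
  assumes "rational_expr X G U f" "rational_expr X G V g"
  shows "rational_expr X G (U \<inter> V) f"
proof -
  have "rational_expr X G (X \<inter> V) (\<lambda>x. 0 * g x)"
    by (rule rational_expr.mult[OF rational_expr.const assms(2)])
  from rational_expr.add[OF assms(1) this]
  have "rational_expr X G (U \<inter> (X \<inter> V)) (\<lambda>x. f x + 0 * g x)" .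
  moreover have "U \<inter> (X \<inter> V) = U \<inter> V" using rational_expr_subset[OF assms(2)] by auto
  ultimately show ?thesis by simp
qed

lemma rational_expr_restrict':
  assumes "rational_expr X G U f" "rational_expr X G V g" "V \<subseteq> U"
  shows "rational_expr X G V f"
  using rational_expr_restrict[OF assms(1,2)] assms(3) by (simp add: Int_absorb1)

lemma rational_expr_const:
  "rational_expr X G U h \<Longrightarrow> rational_expr X G U (\<lambda>_. c)"
  using rational_expr_restrict'[OF rational_expr.const] rational_expr_subset by blast

lemma rational_expr_mult:
  "rational_expr X G U f \<Longrightarrow> rational_expr X G U g \<Longrightarrow> rational_expr X G U (\<lambda>x. f x * g x)"
  using rational_expr.mult[of X G U f U g] by simp

lemma rational_expr_add:
  "rational_expr X G U f \<Longrightarrow> rational_expr X G U g \<Longrightarrow> rational_expr X G U (\<lambda>x. f x + g x)"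
  using rational_expr.add[of X G U f U g] by simp

lemma rational_expr_power:
  "rational_expr X G U f \<Longrightarrow> rational_expr X G U (\<lambda>x. f x ^ n)"
  by (induction n) (auto intro: rational_expr_const rational_expr_mult)

lemma rational_expr_prod:
  assumes "rational_expr X G U h" "\<And>i. i \<in> A \<Longrightarrow> rational_expr X G U (f i)"
  shows "rational_expr X G U (\<lambda>x. \<Prod>i\<in>A. f i x)"
  using assms(2)
  by (induction A rule: infinite_finite_induct)
    (auto intro: rational_expr_const[OF assms(1)] rational_expr_mult)

lemma rational_expr_sum:
  assumes "rational_expr X G U h" "\<And>i. i \<in> A \<Longrightarrow> rational_expr X G U (f i)"
  shows "rational_expr X G U (\<lambda>x. \<Sum>i\<in>A. f i x)"
  using assms(2)
  by (induction A rule: infinite_finite_induct)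
    (auto intro: rational_expr_const[OF assms(1)] rational_expr_add)

lemma fs_regular_generated:
  "fs_regular (generated_fspace X G) V f \<longleftrightarrow>
    (\<forall>x\<in>V. \<exists>U g. rational_expr X G U g \<and> x \<in> U \<and> U \<subseteq> V \<and> (\<forall>y\<in>U. f y = g y))"
  by (simp add: generated_fspace_def)

lemma topspace_generated [simp]: "topspace (fs_top (generated_fspace X G)) = X"
proof -
  have "\<Union>{U. \<exists>g. rational_expr X G U g} = X"
    using rational_expr_subset[of X G] rational_expr.const[of X G] by blast
  then show ?thesis by (simp add: generated_fspace_def)
qed

text \<open>The domains of expressions are closed under intersection, so they form a basis and not
  merely a subbasis.\<close>

lemma openin_generated:
  "openin (fs_top (generated_fspace X G)) V \<longleftrightarrow>
    (\<forall>x\<in>V. \<exists>U g. rational_expr X G U g \<and> x \<in> U \<and> U \<subseteq> V)"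
proof
  assume "openin (fs_top (generated_fspace X G)) V"
  then have "generate_topology_on {U. \<exists>g. rational_expr X G U g} V"
    by (simp add: generated_fspace_def openin_topology_generated_by_iff)
  then show "\<forall>x\<in>V. \<exists>U g. rational_expr X G U g \<and> x \<in> U \<and> U \<subseteq> V"
  proof (induction rule: generate_topology_on.induct)
    case Empty
    then show ?case by simp
  next
    case (Int a b)
    show ?case
    proof
      fix x assume "x \<in> a \<inter> b"
      with Int.IH obtain U g V h where "rational_expr X G U g" "x \<in> U" "U \<subseteq> a"
        "rational_expr X G V h" "x \<in> V" "V \<subseteq> b" by (meson IntD1 IntD2)
      then show "\<exists>U g. rational_expr X G U g \<and> x \<in> U \<and> U \<subseteq> a \<inter> b"
        using rational_expr_restrict[of X G U g V h] by blast
    qed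
  next
    case (UN K)
    then show ?case by (meson UnionE Union_upper order_trans)
  next
    case (Basis s)
    then show ?case by blast
  qed
next
  assume H: "\<forall>x\<in>V. \<exists>U g. rational_expr X G U g \<and> x \<in> U \<and> U \<subseteq> V"
  have "openin (fs_top (generated_fspace X G)) (\<Union>{U. U \<subseteq> V \<and> (\<exists>g. rational_expr X G U g)})"
  proof (rule openin_Union)
    fix S assume "S \<in> {U. U \<subseteq> V \<and> (\<exists>g. rational_expr X G U g)}"
    then show "openin (fs_top (generated_fspace X G)) S"
      by (auto simp: generated_fspace_def intro: topology_generated_by_Basis)
  qed
  moreover have "\<Union>{U. U \<subseteq> V \<and> (\<exists>g. rational_expr X G U g)} = V" using H by blast
  ultimately show "openin (fs_top (generated_fspace X G)) V" by simp
qed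

text \<open>Openness as a statement about regular functions: continuity of a morphism thereby
  becomes a special case of pulling back regular functions.\<close>

lemma openin_iff_regular_zero:
  "openin (fs_top (generated_fspace X G)) V \<longleftrightarrow> fs_regular (generated_fspace X G) V (\<lambda>_. 0)"
proof
  assume "openin (fs_top (generated_fspace X G)) V"
  then show "fs_regular (generated_fspace X G) V (\<lambda>_. 0)"
    unfolding openin_generated fs_regular_generated using rational_expr_const by metis
next
  assume "fs_regular (generated_fspace X G) V (\<lambda>_. 0)"
  then show "openin (fs_top (generated_fspace X G)) V"
    unfolding openin_generated fs_regular_generated by metis
qed

lemma fs_regular_cong:
  assumes "\<And>x. x \<in> V \<Longrightarrow> f x = g x"
  shows "fs_regular (generated_fspace X G) V f \<longleftrightarrow> fs_regular (generated_fspace X G) V g"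
proof -
  have "(U \<subseteq> V \<and> (\<forall>y\<in>U. f y = h y)) \<longleftrightarrow> (U \<subseteq> V \<and> (\<forall>y\<in>U. g y = h y))" for U h
    using assms by (metis subsetD)
  then show ?thesis unfolding fs_regular_generated by metis
qed

lemma rational_expr_regular:
  "rational_expr X G U f \<Longrightarrow> fs_regular (generated_fspace X G) U f"
  unfolding fs_regular_generated by blast

lemma fs_regular_combine:
  assumes f: "fs_regular (generated_fspace X G) V f" and g: "fs_regular (generated_fspace X G) W g"
    and op: "\<And>U a b. rational_expr X G U a \<Longrightarrow> rational_expr X G U b \<Longrightarrow> rational_expr X G U (\<lambda>x. F (a x) (b x))"
  shows "fs_regular (generated_fspace X G) (V \<inter> W) (\<lambda>x. F (f x) (g x))"
  unfolding fs_regular_generated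
proof
  fix x assume "x \<in> V \<inter> W"
  with f g obtain U a U' b where a: "rational_expr X G U a" "x \<in> U" "U \<subseteq> V" "\<forall>y\<in>U. f y = a y"
    and b: "rational_expr X G U' b" "x \<in> U'" "U' \<subseteq> W" "\<forall>y\<in>U'. g y = b y"
    unfolding fs_regular_generated by blast
  have "rational_expr X G (U \<inter> U') a" "rational_expr X G (U \<inter> U') b"
    using rational_expr_restrict[OF a(1) b(1)] rational_expr_restrict[OF b(1) a(1)]
    by (simp_all add: Int_commute)
  from op[OF this] show "\<exists>U g'. rational_expr X G U g' \<and> x \<in> U \<and> U \<subseteq> V \<inter> W \<and> (\<forall>y\<in>U. F (f y) (g y) = g' y)"
    using a b by (intro exI[of _ "U \<inter> U'"] exI[of _ "\<lambda>x. F (a x) (b x)"]) auto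
qed

lemma fs_regular_inverse:
  assumes f: "fs_regular (generated_fspace X G) V f"
  shows "fs_regular (generated_fspace X G) {x \<in> V. f x \<noteq> 0} (\<lambda>x. inverse (f x))"
  unfolding fs_regular_generated
proof
  fix x assume x: "x \<in> {x \<in> V. f x \<noteq> 0}"
  with f obtain U a where a: "rational_expr X G U a" "x \<in> U" "U \<subseteq> V" "\<forall>y\<in>U. f y = a y"
    unfolding fs_regular_generated by blast
  show "\<exists>U g. rational_expr X G U g \<and> x \<in> U \<and> U \<subseteq> {x \<in> V. f x \<noteq> 0} \<and> (\<forall>y\<in>U. inverse (f y) = g y)"
    using rational_expr.inverse[OF a(1)] a x
    by (intro exI[of _ "{y \<in> U. a y \<noteq> 0}"] exI[of _ "\<lambda>x. inverse (a x)"]) auto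
qed

text \<open>Only coordinates are tested; rational expressions, regular functions and open sets
  follow by induction over expressions.\<close>

definition fs_morphism ::
  "'a set \<Rightarrow> ('a set \<times> ('a \<Rightarrow> complex)) set \<Rightarrow> 'b set \<Rightarrow> ('b set \<times> ('b \<Rightarrow> complex)) set \<Rightarrow> ('a \<Rightarrow> 'b) \<Rightarrow> bool"
  where "fs_morphism X G Y H f \<longleftrightarrow> f ` X \<subseteq> Y \<and>
    (\<forall>U h. (U, h) \<in> H \<longrightarrow> fs_regular (generated_fspace X G) {x \<in> X. f x \<in> U} (h \<circ> f))"

lemma fs_morphism_rational:
  assumes f: "fs_morphism X G Y H f" and "rational_expr Y H U h"
  shows "fs_regular (generated_fspace X G) {x \<in> X. f x \<in> U} (h \<circ> f)"
  using assms(2)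
proof (induction rule: rational_expr.induct)
  case (coord U g)
  have "{x \<in> X. f x \<in> U \<inter> Y} = {x \<in> X. f x \<in> U}" using f by (auto simp: fs_morphism_def)
  moreover have "fs_regular (generated_fspace X G) {x \<in> X. f x \<in> U} (g \<circ> f)"
    using f coord unfolding fs_morphism_def by blast
  ultimately show ?case by (simp only:)
next
  case (const c)
  have "{x \<in> X. f x \<in> Y} = X" using f by (auto simp: fs_morphism_def)
  then show ?case using rational_expr_regular[OF rational_expr.const[of X G c]] by (simp add: comp_def)
next
  case (add U g V h)
  have "{x \<in> X. f x \<in> U \<inter> V} = {x \<in> X. f x \<in> U} \<inter> {x \<in> X. f x \<in> V}" by auto
  moreover have "fs_regular (generated_fspace X G) ({x \<in> X. f x \<in> U} \<inter> {x \<in> X. f x \<in> V})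
      (\<lambda>x. (g \<circ> f) x + (h \<circ> f) x)"
    by (rule fs_regular_combine[OF add.IH rational_expr_add])
  ultimately show ?case by (simp add: comp_def)
next
  case (mult U g V h)
  have "{x \<in> X. f x \<in> U \<inter> V} = {x \<in> X. f x \<in> U} \<inter> {x \<in> X. f x \<in> V}" by auto
  moreover have "fs_regular (generated_fspace X G) ({x \<in> X. f x \<in> U} \<inter> {x \<in> X. f x \<in> V})
      (\<lambda>x. (g \<circ> f) x * (h \<circ> f) x)"
    by (rule fs_regular_combine[OF mult.IH rational_expr_mult])
  ultimately show ?case by (simp add: comp_def)
next
  case (inverse U g)
  have "{x \<in> X. f x \<in> {y \<in> U. g y \<noteq> 0}} = {x \<in> {x \<in> X. f x \<in> U}. (g \<circ> f) x \<noteq> 0}" by auto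
  then show ?case using fs_regular_inverse[OF inverse.IH] by (simp add: comp_def)
qed

lemma fs_morphism_regular:
  assumes f: "fs_morphism X G Y H f" and h: "fs_regular (generated_fspace Y H) V h"
  shows "fs_regular (generated_fspace X G) {x \<in> X. f x \<in> V} (h \<circ> f)"
  unfolding fs_regular_generated
proof
  fix x assume x: "x \<in> {x \<in> X. f x \<in> V}"
  with h obtain U g where g: "rational_expr Y H U g" "f x \<in> U" "U \<subseteq> V" "\<forall>y\<in>U. h y = g y"
    unfolding fs_regular_generated by blast
  from fs_morphism_rational[OF f g(1)] x g(2)
  obtain U' g' where "rational_expr X G U' g'" "x \<in> U'" "U' \<subseteq> {x \<in> X. f x \<in> U}" "\<forall>y\<in>U'. (g \<circ> f) y = g' y"
    unfolding fs_regular_generated by blast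
  then show "\<exists>U g. rational_expr X G U g \<and> x \<in> U \<and> U \<subseteq> {x \<in> X. f x \<in> V} \<and> (\<forall>y\<in>U. (h \<circ> f) y = g y)"
    using g by (intro exI[of _ U'] exI[of _ g']) auto
qed

lemma fs_morphism_open:
  assumes f: "fs_morphism X G Y H f" and "openin (fs_top (generated_fspace Y H)) V"
  shows "openin (fs_top (generated_fspace X G)) {x \<in> X. f x \<in> V}"
  using fs_morphism_regular[OF f, of V "\<lambda>_. 0"] assms(2)
  by (simp add: openin_iff_regular_zero comp_def)

lemma fs_morphism_comp:
  assumes f: "fs_morphism X G Y H f" and g: "fs_morphism Y H Z K g"
  shows "fs_morphism X G Z K (g \<circ> f)"
  unfolding fs_morphism_def
proof (intro conjI allI impI)
  show "(g \<circ> f) ` X \<subseteq> Z" using f g unfolding fs_morphism_def image_comp[symmetric] by blast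
  fix U h assume "(U, h) \<in> K"
  then have "fs_regular (generated_fspace Y H) {y \<in> Y. g y \<in> U} (h \<circ> g)"
    using g by (simp add: fs_morphism_def)
  from fs_morphism_regular[OF f this]
  have "fs_regular (generated_fspace X G) {x \<in> X. f x \<in> {y \<in> Y. g y \<in> U}} (h \<circ> g \<circ> f)" .
  moreover have "{x \<in> X. f x \<in> {y \<in> Y. g y \<in> U}} = {x \<in> X. (g \<circ> f) x \<in> U}"
    using f by (auto simp: fs_morphism_def)
  ultimately show "fs_regular (generated_fspace X G) {x \<in> X. (g \<circ> f) x \<in> U} (h \<circ> (g \<circ> f))"
    by (simp add: comp_assoc)
qed

definition fs_equiv ::
  "'a set \<Rightarrow> ('a set \<times> ('a \<Rightarrow> complex)) set \<Rightarrow> 'b set \<Rightarrow> ('b set \<times> ('b \<Rightarrow> complex)) set \<Rightarrow> bool"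
  where "fs_equiv X G Y H \<longleftrightarrow> (\<exists>f g. fs_morphism X G Y H f \<and> fs_morphism Y H X G g \<and>
    (\<forall>x\<in>X. g (f x) = x) \<and> (\<forall>y\<in>Y. f (g y) = y))"

lemma fs_equiv_sym: "fs_equiv X G Y H \<Longrightarrow> fs_equiv Y H X G"
  unfolding fs_equiv_def by blast

lemma fs_equiv_trans:
  assumes "fs_equiv X G Y H" "fs_equiv Y H Z K"
  shows "fs_equiv X G Z K"
proof -
  obtain f g where f: "fs_morphism X G Y H f" "fs_morphism Y H X G g"
    "\<forall>x\<in>X. g (f x) = x" "\<forall>y\<in>Y. f (g y) = y" using assms(1) unfolding fs_equiv_def by blast
  obtain f' g' where f': "fs_morphism Y H Z K f'" "fs_morphism Z K Y H g'"
    "\<forall>y\<in>Y. g' (f' y) = y" "\<forall>z\<in>Z. f' (g' z) = z" using assms(2) unfolding fs_equiv_def by blast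
  have "f x \<in> Y" if "x \<in> X" for x using that f(1) by (auto simp: fs_morphism_def)
  moreover have "g' z \<in> Y" if "z \<in> Z" for z using that f'(2) by (auto simp: fs_morphism_def)
  ultimately show ?thesis unfolding fs_equiv_def
    using fs_morphism_comp[OF f(1) f'(1)] fs_morphism_comp[OF f'(2) f(2)] f(3,4) f'(3,4)
    by (intro exI[of _ "f' \<circ> f"] exI[of _ "g \<circ> g'"]) simp
qed

lemma fs_equiv_isomorphic:
  assumes "fs_equiv X G Y H"
  shows "generated_fspace X G \<cong>\<^sub>f\<^sub>s generated_fspace Y H"
proof -
  obtain f g where f: "fs_morphism X G Y H f" and g: "fs_morphism Y H X G g"
    and gf: "\<And>x. x \<in> X \<Longrightarrow> g (f x) = x" and fg: "\<And>y. y \<in> Y \<Longrightarrow> f (g y) = y"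
    using assms unfolding fs_equiv_def by blast
  have fX: "f x \<in> Y" if "x \<in> X" for x using that f by (auto simp: fs_morphism_def)
  have gY: "g y \<in> X" if "y \<in> Y" for y using that g by (auto simp: fs_morphism_def)
  have "homeomorphic_maps (fs_top (generated_fspace X G)) (fs_top (generated_fspace Y H)) f g"
    unfolding homeomorphic_maps_def continuous_map_def topspace_generated
    using fs_morphism_open[OF f] fs_morphism_open[OF g] fX gY gf fg by auto
  then have "homeomorphic_map (fs_top (generated_fspace X G)) (fs_top (generated_fspace Y H)) f"
    using homeomorphic_map_maps by blast
  moreover have "fs_regular (generated_fspace Y H) V h \<longleftrightarrow>
      fs_regular (generated_fspace X G) {x \<in> X. f x \<in> V} (h \<circ> f)"
    if V: "openin (fs_top (generated_fspace Y H)) V" for V h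
  proof
    assume "fs_regular (generated_fspace Y H) V h"
    then show "fs_regular (generated_fspace X G) {x \<in> X. f x \<in> V} (h \<circ> f)"
      by (rule fs_morphism_regular[OF f])
  next
    assume "fs_regular (generated_fspace X G) {x \<in> X. f x \<in> V} (h \<circ> f)"
    from fs_morphism_regular[OF g this]
    have r: "fs_regular (generated_fspace Y H) {y \<in> Y. g y \<in> {x \<in> X. f x \<in> V}} (h \<circ> f \<circ> g)" .
    have VY: "V \<subseteq> Y" using openin_subset[OF V] by simp
    then have "{y \<in> Y. g y \<in> {x \<in> X. f x \<in> V}} = V" using gY fg by auto
    with r have "fs_regular (generated_fspace Y H) V (h \<circ> f \<circ> g)" by simp
    moreover have "(h \<circ> f \<circ> g) y = h y" if "y \<in> V" for y using that VY fg by auto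
    ultimately show "fs_regular (generated_fspace Y H) V h"
      using fs_regular_cong[of V "h \<circ> f \<circ> g" h] by blast
  qed
  ultimately show ?thesis
    unfolding fs_isomorphic_def fs_isomorphism_def topspace_generated by blast
qed

subsection \<open>Linear isomorphisms of projective spaces\<close>

text \<open>The composition of a functional with \<open>T\<close> is a functional, so coordinates
  pull back to coordinates; injectivity on \<open>V\<close> ensures that lines go to lines.\<close>

lemma proj_linear_morphism:
  fixes sc :: "complex \<Rightarrow> 'v::ab_group_add \<Rightarrow> 'v" and sc' :: "complex \<Rightarrow> 'w::ab_group_add \<Rightarrow> 'w"
  assumes T: "Vector_Spaces.linear sc sc' T" and V: "T ` V \<subseteq> V'"
    and inj: "\<And>v. v \<in> V \<Longrightarrow> T v = 0 \<Longrightarrow> v = 0"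
  shows "fs_morphism (proj_points sc V) (proj_coords sc) (proj_points sc' V') (proj_coords sc') ((`) T)"
proof -
  interpret T: Vector_Spaces.linear sc sc' T by (rule T)
  have sp: "T ` module.span sc {v} = module.span sc' {T v}" for v
    using T.span_image[of "{v}"] by simp
  show ?thesis unfolding fs_morphism_def
  proof (intro conjI allI impI)
    show "(`) T ` proj_points sc V \<subseteq> proj_points sc' V'"
      using V inj sp by (fastforce simp: proj_points_def)
    fix U h assume "(U, h) \<in> proj_coords sc'"
    then obtain l l' where U: "U = {L. \<exists>v\<in>L. l v \<noteq> 0}" and h: "h = (\<lambda>L. THE z. \<forall>v\<in>L. l' v = z * l v)"
      and l: "Vector_Spaces.linear sc' (*) l" "Vector_Spaces.linear sc' (*) l'"
      by (auto simp: proj_coords_def)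
    have "({L. \<exists>v\<in>L. (l \<circ> T) v \<noteq> 0}, \<lambda>L. THE z. \<forall>v\<in>L. (l' \<circ> T) v = z * (l \<circ> T) v) \<in> proj_coords sc"
      unfolding proj_coords_def using Vector_Spaces.linear_compose[OF T] l by blast
    from rational_expr_regular[OF rational_expr.coord[OF this, of "proj_points sc V"]]
    show "fs_regular (generated_fspace (proj_points sc V) (proj_coords sc))
        {L \<in> proj_points sc V. T ` L \<in> U} (h \<circ> (`) T)"
      by (simp add: U h comp_def Int_def conj_commute)
  qed
qed

subsection \<open>The family as a projective space\<close>

lemma mem_vec_span_singleton: "v \<in> vec.span {w} \<longleftrightarrow> (\<exists>c. v = c *s w)"
  by (auto simp: vec.span_singleton)

lemma proj_points_vec: "proj_points (*s) UNIV = {vec.span {w} | w :: complex ^ 'n::finite. w \<noteq> 0}"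
  by (auto simp: proj_points_def)

lemma functional_scale:
  "Vector_Spaces.linear (*s) (*) l \<Longrightarrow> l (c *s v) = c * (l (v :: complex ^ 'n::finite) :: complex)"
  unfolding Vector_Spaces.linear_iff by blast

lemma functional_expand:
  fixes l :: "complex ^ 'n::finite \<Rightarrow> complex"
  assumes l: "Vector_Spaces.linear (*s) (*) l"
  shows "l v = (\<Sum>i\<in>UNIV. l (axis i 1) * v $ i)"
proof -
  interpret l: Vector_Spaces.linear "(*s)" "(*)" l by (rule l)
  have "l v = l (\<Sum>i\<in>UNIV. v $ i *s axis i 1)" by (simp only: basis_expansion)
  also have "\<dots> = (\<Sum>i\<in>UNIV. l (v $ i *s axis i 1))" by (rule l.sum)
  finally show ?thesis by (simp only: functional_scale[OF l] mult.commute)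
qed

lemma linear_component: "Vector_Spaces.linear (*s) (*) (\<lambda>v :: complex ^ 'n::finite. v $ i)"
  unfolding Vector_Spaces.linear_iff
  by (simp add: vec.vector_space_axioms vector_space_over_itself.vector_space_axioms)

lemma proj_coord_span:
  fixes l l' :: "complex ^ 'n::finite \<Rightarrow> complex"
  assumes l: "Vector_Spaces.linear (*s) (*) l" "Vector_Spaces.linear (*s) (*) l'" and "l w \<noteq> 0"
  shows "(THE z. \<forall>v\<in>vec.span {w}. l' v = z * l v) = l' w / l w"
proof (rule the_equality)
  show "\<forall>v\<in>vec.span {w}. l' v = l' w / l w * l v"
    using assms by (auto simp: mem_vec_span_singleton functional_scale)
  fix z assume "\<forall>v\<in>vec.span {w}. l' v = z * l v"
  then have "l' w = z * l w" using vec.span_base[of w "{w}"] by blast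
  then show "z = l' w / l w" using assms(3) by simp
qed

lemma span_functional_nonzero:
  fixes l :: "complex ^ 'n::finite \<Rightarrow> complex"
  assumes "Vector_Spaces.linear (*s) (*) l"
  shows "(\<exists>v\<in>vec.span {w}. l v \<noteq> 0) \<longleftrightarrow> l w \<noteq> 0"
proof
  show "l w \<noteq> 0" if "\<exists>v\<in>vec.span {w}. l v \<noteq> 0"
    using that by (auto simp: mem_vec_span_singleton functional_scale[OF assms])
  show "\<exists>v\<in>vec.span {w}. l v \<noteq> 0" if "l w \<noteq> 0"
    using that vec.span_base[of w "{w}"] by blast
qed

definition proj_chart :: "'n::finite \<Rightarrow> (complex ^ 'n) set set"
  where "proj_chart p = {L. \<exists>v\<in>L. v $ p \<noteq> 0} \<inter> proj_points (*s) UNIV"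

definition proj_ratio :: "'n::finite \<Rightarrow> 'n \<Rightarrow> (complex ^ 'n) set \<Rightarrow> complex"
  where "proj_ratio p i L = (THE z. \<forall>v\<in>L. v $ i = z * v $ p)"

lemma rational_expr_ratio:
  "rational_expr (proj_points (*s) UNIV) (proj_coords (*s)) (proj_chart p) (proj_ratio p i)"
proof -
  have "({L. \<exists>v\<in>L. v $ p \<noteq> 0}, \<lambda>L. THE z. \<forall>v\<in>L. v $ i = z * v $ p) \<in> proj_coords (*s)"
    unfolding proj_coords_def mem_Collect_eq
    by (rule exI[of _ "\<lambda>v. v $ p"], rule exI[of _ "\<lambda>v. v $ i"]) (simp add: linear_component)
  from rational_expr.coord[OF this] show ?thesis
    by (simp only: proj_chart_def proj_ratio_def[abs_def])
qed

lemma proj_chart_span: "w \<noteq> 0 \<Longrightarrow> vec.span {w} \<in> proj_chart p \<longleftrightarrow> w $ p \<noteq> 0"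
  unfolding proj_chart_def using span_functional_nonzero[OF linear_component]
  by (auto simp: proj_points_vec)

lemma proj_ratio_span: "w $ p \<noteq> 0 \<Longrightarrow> proj_ratio p i (vec.span {w}) = w $ i / w $ p"
  unfolding proj_ratio_def by (rule proj_coord_span[OF linear_component linear_component])

section \<open>The parametrisation by lines and its inverse\<close>

context diagonal_family
begin

text \<open>All sets in the intersection coincide for a line, so no representative has to be
  chosen.\<close>

definition J_line :: "(complex ^ 'n) set \<Rightarrow> tpoly set"
  where "J_line L = (\<Inter>v\<in>L - {0}. J v)"

lemma J_line_span:
  assumes "w \<noteq> 0"
  shows "J_line (vec.span {w}) = J w"
proof -
  have "J v = J w" if "v \<in> vec.span {w} - {0}" for v
    using that J_scale by (auto simp: mem_vec_span_singleton)
  moreover have "w \<in> vec.span {w} - {0}" using assms vec.span_base[of w "{w}"] by simp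
  ultimately show ?thesis unfolding J_line_def by blast
qed

text \<open>The power of \<open>w $ p\<close> split off here depends only on the class and cancels
  in the ratios that occur as chart coordinates.\<close>

lemma lam_dehomogenize:
  assumes "w $ p \<noteq> 0" "ok m"
  shows "lam w m = (w $ p) ^ (\<Sum>i\<in>UNIV. ex m i) * (\<Prod>i\<in>UNIV. (w $ i / w $ p) ^ ex m i)"
proof -
  have "(\<Prod>i\<in>UNIV. (w $ i) ^ ex m i) = (\<Prod>i\<in>UNIV. (w $ p) ^ ex m i * (w $ i / w $ p) ^ ex m i)"
    using assms(1) by (intro prod.cong) (simp_all add: power_mult_distrib[symmetric])
  then show ?thesis using assms(2) by (simp add: lam_def prod.distrib power_sum)
qed

lemma J_line_morphism:
  "fs_morphism (proj_points (*s) UNIV) (proj_coords (*s)) (J ` {w. w \<noteq> 0}) (ideal_coords K) J_line"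
  unfolding fs_morphism_def
proof (intro conjI allI impI)
  let ?P = "proj_points (*s) UNIV :: (complex ^ 'n) set set"
  show "J_line ` ?P \<subseteq> J ` {w. w \<noteq> 0}"
    unfolding proj_points_vec by (auto simp: J_line_span)
  fix D h assume "(D, h) \<in> ideal_coords K"
  then obtain k B m b where D: "D = chart_domain k B" and h: "h = chart_coord B m b"
    and B: "B \<subseteq> {m. mdeg m = k}" and m: "mdeg m = k" and b: "b \<in> B"
    by (auto simp: ideal_coords_def)
  show "fs_regular (generated_fspace ?P (proj_coords (*s))) {L \<in> ?P. J_line L \<in> D} (h \<circ> J_line)"
    unfolding fs_regular_generated
  proof
    fix L assume L: "L \<in> {L \<in> ?P. J_line L \<in> D}"
    then obtain w0 where w0: "w0 \<noteq> 0" "L = vec.span {w0}" by (auto simp: proj_points_vec)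
    then have J0: "J w0 \<in> chart_domain k B" using L J_line_span D by simp
    note T = chart_domain_transversal[OF w0(1) B J0]
    obtain p where p: "w0 $ p \<noteq> 0" using w0(1) by (metis vec_eq_iff zero_index)
    let ?R = "rational_expr ?P (proj_coords (*s))"
    define \<mu> where "\<mu> m L = (\<Prod>i\<in>UNIV. proj_ratio p i L ^ ex m i)" for m and L :: "(complex ^ 'n) set"
    have R\<mu>: "?R (proj_chart p) (\<mu> m)" for m
      unfolding \<mu>_def by (intro rational_expr_prod[OF rational_expr_ratio] rational_expr_power rational_expr_ratio)
    \<comment> \<open>One inverse, that of the product over \<open>B\<close>, both restricts the
      domain to the lines with all \<open>lam w b\<close> nonzero and supplies the
      denominators.\<close>
    define U where "U = {L \<in> proj_chart p. (\<Prod>b\<in>B. \<mu> b L) \<noteq> 0}"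
    have RQ: "?R U (\<lambda>L. inverse (\<Prod>b\<in>B. \<mu> b L))"
      unfolding U_def by (intro rational_expr.inverse rational_expr_prod[OF rational_expr_ratio] R\<mu>)
    \<comment> \<open>On \<open>U\<close> this is the quotient of the values at \<open>m\<close> and
      \<open>b\<close>: the remaining factors of the product cancel.\<close>
    define g where "g L = (if cls m = cls b then \<mu> m L * ((\<Prod>b'\<in>B - {b}. \<mu> b' L) * inverse (\<Prod>b\<in>B. \<mu> b L)) else 0)" for L
    have RU: "?R U f" if "?R (proj_chart p) f" for f
      using rational_expr_restrict'[OF that RQ] by (auto simp: U_def)
    have "?R U (\<lambda>L. \<mu> m L * ((\<Prod>b'\<in>B - {b}. \<mu> b' L) * inverse (\<Prod>b\<in>B. \<mu> b L)))"
      by (intro rational_expr_mult RU R\<mu> RQ rational_expr_prod[OF rational_expr_ratio])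
    then have Rg: "?R U g"
      using rational_expr_const[OF RQ, of 0] unfolding g_def by (cases "cls m = cls b") simp_all
    have fB: "finite B" by (rule transversal_finite[OF T(1)])
    have \<mu>_span: "lam w m = (w $ p) ^ (\<Sum>i\<in>UNIV. ex m i) * \<mu> m (vec.span {w})"
      if "w $ p \<noteq> 0" "ok m" for w m
      using lam_dehomogenize[OF that] that(1) by (simp add: \<mu>_def proj_ratio_span)
    have okB: "ok b" if "b \<in> B" for b by (rule transversalD(1)[OF T(1) that])
    have inU: "vec.span {w} \<in> U \<longleftrightarrow> w $ p \<noteq> 0 \<and> (\<forall>b\<in>B. lam w b \<noteq> 0)" if "w \<noteq> 0" for w
      using proj_chart_span[OF that, of p] \<mu>_span[OF _ okB, of w] fB by (auto simp: U_def)
    have "L \<in> U" using inU[OF w0(1)] w0(2) p T(2) by simp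
    moreover have "U \<subseteq> {L \<in> ?P. J_line L \<in> D} \<and> (\<forall>y\<in>U. (h \<circ> J_line) y = g y)"
    proof (intro conjI subsetI ballI)
      fix y assume y: "y \<in> U"
      then have yP: "y \<in> ?P" by (simp add: U_def proj_chart_def)
      then obtain w where w: "w \<noteq> 0" "y = vec.span {w}" by (auto simp: proj_points_vec)
      have wp: "w $ p \<noteq> 0" and nz: "\<And>b. b \<in> B \<Longrightarrow> lam w b \<noteq> 0" using inU[OF w(1)] w(2) y by auto
      have Jy: "J_line y = J w" using J_line_span[OF w(1)] w(2) by simp
      show "y \<in> {L \<in> ?P. J_line L \<in> D}"
        using yP transversal_chart[OF T(1) nz] by (simp add: Jy D)
      show "(h \<circ> J_line) y = g y"
      proof (cases "cls m = cls b")
        case True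
        have okm: "ok m" using ok_cls[OF True] okB[OF b] by simp
        have nzb: "\<mu> b' y \<noteq> 0" if "b' \<in> B" for b' using nz[OF that] \<mu>_span[OF wp okB[OF that]] w(2) by auto
        have "(\<Prod>b\<in>B. \<mu> b y) = \<mu> b y * (\<Prod>b'\<in>B - {b}. \<mu> b' y)" by (rule prod.remove[OF fB b])
        moreover have "(\<Prod>b'\<in>B - {b}. \<mu> b' y) \<noteq> 0" using nzb fB by simp
        ultimately have "g y = \<mu> m y / \<mu> b y" using True by (simp add: g_def field_simps)
        also have "\<dots> = lam w m / lam w b"
          using \<mu>_span[OF wp okm] \<mu>_span[OF wp okB[OF b]] sum_ex_cls[OF True] w(2) wp by simp
        finally show ?thesis using True by (simp add: Jy h chart_coord_J[OF T(1) nz m b])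
      next
        case False
        then show ?thesis by (simp add: Jy h g_def chart_coord_J[OF T(1) nz m b])
      qed
    qed
    ultimately show "\<exists>U g. ?R U g \<and> L \<in> U \<and> U \<subseteq> {L \<in> ?P. J_line L \<in> D} \<and> (\<forall>y\<in>U. (h \<circ> J_line) y = g y)"
      using Rg by blast
  qed
qed

context
  fixes k0 :: nat
  assumes bd_pos: "\<And>j. j \<notin> range x \<Longrightarrow> 0 < bd j" and k0: "N \<le> k0"
begin

text \<open>The projective coordinates are recovered from a single degree: exchanging one N-th power
  in this monomial for that of \<open>y_(x i)\<close> gives \<open>shifted p i\<close>, and modulo
  \<open>J w\<close> the two differ by the factor \<open>w $ i / w $ p\<close>. Any degree
  \<open>k0 \<ge> N\<close> has room for this.\<close>

definition pivot :: "'n \<Rightarrow> expo"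
  where "pivot p = Poly_Mapping.single (x p) k0"

definition shifted :: "'n \<Rightarrow> 'n \<Rightarrow> expo"
  where "shifted p i = Poly_Mapping.single (x i) N + Poly_Mapping.single (x p) (k0 - N)"

definition basis :: "'n \<Rightarrow> expo set"
  where "basis p = NF p \<inter> {m. mdeg m = k0}"

lemma basis_transversal: "transversal k0 (basis p)"
  unfolding basis_def by (rule NF_transversal)

lemma ok_single: "ok (Poly_Mapping.single (x p) k)"
  using bd_pos by (auto simp: ok_def lookup_single when_def)

lemma pivot_basis: "pivot p \<in> basis p"
  using N_pos ok_single by (auto simp: pivot_def basis_def NF_def lookup_single when_def x_eq_iff)

lemma mdeg_shifted: "mdeg (shifted p i) = k0"
  using k0 by (simp add: shifted_def)

lemma cls_shifted: "cls (shifted p i) = cls (pivot p)"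
proof -
  have "pivot p = Poly_Mapping.single (x p) (k0 - N) + Poly_Mapping.single (x p) N"
    using k0 by (simp add: pivot_def single_add[symmetric])
  moreover have "shifted p i = Poly_Mapping.single (x p) (k0 - N) + Poly_Mapping.single (x i) N"
    by (simp add: shifted_def add.commute)
  ultimately show ?thesis using cls_add_cancel cls_N_power by metis
qed

lemma lam_single: "lam w (Poly_Mapping.single (x p) k) = w $ p ^ (k div N)"
proof -
  have "(\<Prod>i\<in>UNIV. w $ i ^ ex (Poly_Mapping.single (x p) k) i)
      = (\<Prod>i\<in>UNIV. if i = p then w $ i ^ (k div N) else 1)"
    by (intro prod.cong) (auto simp: ex_def lookup_single when_def x_eq_iff)
  then show ?thesis by (simp add: lam_def ok_single)
qed

lemma lam_pivot: "lam w (pivot p) = w $ p ^ (k0 div N)"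
  by (simp add: pivot_def lam_single)

lemma lam_shifted: "lam w (shifted p i) = w $ i * w $ p ^ ((k0 - N) div N)"
proof -
  let ?k = "Poly_Mapping.single (x p) (k0 - N)" and ?n = "Poly_Mapping.single (x i) N"
  have "coef ?n (x l) mod N = 0" for l by (simp add: lookup_single when_def)
  then have carry: "carry ?n ?k l = ex ?n l" for l
    using N_pos by (simp add: carry_def)
  have "ok (?n + ?k)"
    using bd_pos by (auto simp: ok_def lookup_add lookup_single when_def)
  then have "lam w (shifted p i) = (\<Prod>l\<in>UNIV. w $ l ^ ex ?n l) * lam w ?k"
    by (simp only: shifted_def lam_add carry if_True)
  also have "(\<Prod>l\<in>UNIV. w $ l ^ ex ?n l) = lam w ?n"
    by (simp add: lam_def ok_single)
  finally show ?thesis using N_pos by (simp add: lam_single)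
qed

lemma pivot_exponent: "k0 div N = Suc ((k0 - N) div N)"
  using k0 N_pos by (simp add: le_div_geq)

lemma basis_chart_iff:
  assumes "w \<noteq> 0"
  shows "J w \<in> chart_domain k0 (basis p) \<longleftrightarrow> w $ p \<noteq> 0"
proof
  assume c: "J w \<in> chart_domain k0 (basis p)"
  have "basis p \<subseteq> {m. mdeg m = k0}" by (auto simp: basis_def)
  from chart_domain_transversal(2)[OF assms this c pivot_basis] have "lam w (pivot p) \<noteq> 0" .
  then show "w $ p \<noteq> 0" by (auto simp: lam_pivot pivot_exponent)
qed (simp add: basis_def NF_chart)

lemma chart_coord_shifted:
  assumes "w $ p \<noteq> 0"
  shows "chart_coord (basis p) (shifted p i) (pivot p) (J w) = w $ i / w $ p"
proof -
  have nz: "\<And>b. b \<in> basis p \<Longrightarrow> lam w b \<noteq> 0" using lam_NF[OF assms] by (simp add: basis_def)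
  have "chart_coord (basis p) (shifted p i) (pivot p) (J w) = lam w (shifted p i) / lam w (pivot p)"
    using chart_coord_J[OF basis_transversal nz mdeg_shifted pivot_basis] cls_shifted by simp
  then show ?thesis using assms by (simp add: lam_shifted lam_pivot pivot_exponent)
qed

lemma J_line_inj: "inj_on J_line (proj_points (*s) UNIV)"
proof (rule inj_onI)
  fix L L' :: "(complex ^ 'n) set"
  assume "L \<in> proj_points (*s) UNIV" "L' \<in> proj_points (*s) UNIV" and eq: "J_line L = J_line L'"
  then obtain w w' where w: "w \<noteq> 0" "L = vec.span {w}" and w': "w' \<noteq> 0" "L' = vec.span {w'}"
    by (auto simp: proj_points_vec)
  have JJ: "J w = J w'" using eq w w' by (simp add: J_line_span)
  obtain p where p: "w $ p \<noteq> 0" using w(1) by (metis vec_eq_iff zero_index)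
  have p': "w' $ p \<noteq> 0" using basis_chart_iff[OF w(1), of p] basis_chart_iff[OF w'(1), of p] p JJ by simp
  have "w $ i / w $ p = w' $ i / w' $ p" for i
    using chart_coord_shifted[OF p, of i] chart_coord_shifted[OF p', of i] JJ by simp
  then have comp: "w $ i = w $ p / w' $ p * w' $ i" "w' $ i = w' $ p / w $ p * w $ i" for i
    using p p' by (simp_all add: field_simps)
  have 1: "w = (w $ p / w' $ p) *s w'" "w' = (w' $ p / w $ p) *s w"
    unfolding vec_eq_iff vector_smult_component using comp by blast+
  then have "w \<in> vec.span {w'}" "w' \<in> vec.span {w}" unfolding mem_vec_span_singleton by blast+
  then show "L = L'" using w(2) w'(2) by (simp add: vec.span_eq)
qed

definition point_of :: "tpoly set \<Rightarrow> (complex ^ 'n) set"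
  where "point_of = the_inv_into (proj_points (*s) UNIV) J_line"

lemma point_of_J:
  assumes "w \<noteq> 0"
  shows "point_of (J w) = vec.span {w}"
proof -
  have "vec.span {w} \<in> proj_points (*s) UNIV" using assms by (auto simp: proj_points_vec)
  from the_inv_into_f_f[OF J_line_inj this] show ?thesis
    by (simp add: point_of_def J_line_span[OF assms])
qed

lemma point_of_morphism:
  assumes "k0 \<in> K"
  shows "fs_morphism (J ` {w. w \<noteq> 0}) (ideal_coords K) (proj_points (*s) UNIV) (proj_coords (*s)) point_of"
  unfolding fs_morphism_def
proof (intro conjI allI impI)
  let ?X = "J ` {w. w \<noteq> 0}"
  show "point_of ` ?X \<subseteq> proj_points (*s) UNIV"
    by (auto simp: point_of_J proj_points_vec)
  fix D h assume "(D, h) \<in> proj_coords ((*s) :: complex \<Rightarrow> complex ^ 'n \<Rightarrow> complex ^ 'n)"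
  then obtain l l' where D: "D = {L. \<exists>v\<in>L. l v \<noteq> 0}" and h: "h = (\<lambda>L. THE z. \<forall>v\<in>L. l' v = z * l v)"
    and l: "Vector_Spaces.linear (*s) (*) l" "Vector_Spaces.linear (*s) (*) l'"
    by (auto simp: proj_coords_def)
  have inD: "point_of (J w) \<in> D \<longleftrightarrow> l w \<noteq> 0" if "w \<noteq> 0" for w
    using that span_functional_nonzero[OF l(1)] by (simp add: point_of_J D)
  show "fs_regular (generated_fspace ?X (ideal_coords K)) {I \<in> ?X. point_of I \<in> D} (h \<circ> point_of)"
    unfolding fs_regular_generated
  proof
    fix I assume I: "I \<in> {I \<in> ?X. point_of I \<in> D}"
    then obtain w0 where w0: "w0 \<noteq> 0" "I = J w0" by auto
    obtain p where p: "w0 $ p \<noteq> 0" using w0(1) by (metis vec_eq_iff zero_index)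
    let ?R = "rational_expr ?X (ideal_coords K)"
    define z where "z i = chart_coord (basis p) (shifted p i) (pivot p)" for i
    define W where "W = chart_domain k0 (basis p) \<inter> ?X"
    have "(chart_domain k0 (basis p), z i) \<in> ideal_coords K" for i
      unfolding ideal_coords_def z_def mem_Collect_eq
      by (rule exI[of _ k0], rule exI[of _ "basis p"], rule exI[of _ "shifted p i"], rule exI[of _ "pivot p"])
        (use assms pivot_basis[of p] mdeg_shifted[of p i] in \<open>auto simp: basis_def\<close>)
    then have Rz: "?R W (z i)" for i unfolding W_def by (rule rational_expr.coord)
    \<comment> \<open>The functional \<open>f\<close> divided by the coordinate at \<open>p\<close>,
      written in the affine coordinates \<open>z i\<close>; the target coordinate
      \<open>l'/l\<close> is a quotient of two of these.\<close>
    define g where "g f I = (\<Sum>i\<in>UNIV. f (axis i (1::complex)) * z i I)" for f :: "complex ^ 'n \<Rightarrow> complex" and I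
    have Rg: "?R W (g f)" for f
      unfolding g_def by (intro rational_expr_sum[OF Rz] rational_expr_mult Rz rational_expr_const[OF Rz])
    define U where "U = {I \<in> W. g l I \<noteq> 0}"
    have Rinv: "?R U (\<lambda>I. inverse (g l I))" unfolding U_def by (rule rational_expr.inverse[OF Rg])
    have "?R U (g l')" using rational_expr_restrict'[OF Rg Rinv] by (auto simp: U_def)
    then have R: "?R U (\<lambda>I. g l' I * inverse (g l I))" using Rinv by (rule rational_expr_mult)
    have gval: "g f (J w) = f w / w $ p" if "w $ p \<noteq> 0" "Vector_Spaces.linear (*s) (*) f" for f w
      using functional_expand[OF that(2), of w] chart_coord_shifted[OF that(1)]
      by (simp add: g_def z_def sum_divide_distrib)
    have inW: "J w \<in> W \<longleftrightarrow> w $ p \<noteq> 0" if "w \<noteq> 0" for w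
      using basis_chart_iff[OF that] that by (auto simp: W_def)
    have "I \<in> U" using w0 p inW[OF w0(1)] gval[OF p l(1)] I inD[OF w0(1)] by (simp add: U_def)
    moreover have "U \<subseteq> {I \<in> ?X. point_of I \<in> D} \<and> (\<forall>y\<in>U. (h \<circ> point_of) y = g l' y * inverse (g l y))"
    proof (intro conjI subsetI ballI)
      fix y assume y: "y \<in> U"
      then obtain w where w: "w \<noteq> 0" "y = J w" by (auto simp: U_def W_def)
      have wp: "w $ p \<noteq> 0" using y inW[OF w(1)] w(2) by (simp add: U_def)
      have lw: "l w \<noteq> 0" using y gval[OF wp l(1)] w(2) by (auto simp: U_def)
      show "y \<in> {I \<in> ?X. point_of I \<in> D}" using w lw inD[OF w(1)] by simp
      have "(h \<circ> point_of) y = l' w / l w"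
        using proj_coord_span[OF l lw] by (simp add: h w point_of_J)
      then show "(h \<circ> point_of) y = g l' y * inverse (g l y)"
        unfolding w(2) gval[OF wp l(1)] gval[OF wp l(2)] using wp lw by simp
    qed
    ultimately show "\<exists>U g. ?R U g \<and> I \<in> U \<and> U \<subseteq> {I \<in> ?X. point_of I \<in> D} \<and> (\<forall>y\<in>U. (h \<circ> point_of) y = g y)"
      using R by blast
  qed
qed

lemma family_equiv_proj_space:
  assumes "k0 \<in> K"
  shows "fs_equiv (J ` {w. w \<noteq> 0}) (ideal_coords K)
    (proj_points (*s) (UNIV :: (complex ^ 'n) set)) (proj_coords (*s))"
  unfolding fs_equiv_def
proof (rule exI[of _ point_of], rule exI[of _ J_line], intro conjI)
  show "\<forall>I\<in>J ` {w. w \<noteq> 0}. J_line (point_of I) = I" by (auto simp: point_of_J J_line_span)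
  show "\<forall>L\<in>proj_points (*s) UNIV. point_of (J_line L) = L"
    by (auto simp: proj_points_vec point_of_J J_line_span)
qed (rule point_of_morphism[OF assms] J_line_morphism)+

end

end

subsection \<open>Apolar ideals of finite colength\<close>

lemma hilbert_function_antimono:
  assumes I: "tideal.subspace I" and I': "tideal.subspace I'" and sub: "I \<subseteq> I'"
  shows "hilbert_function I' k \<le> hilbert_function I k"
proof -
  have "tpoly.dim (I \<inter> graded_piece k) + card ({} :: nat set) \<le> tpoly.dim (I' \<inter> graded_piece k)"
  proof (rule tpoly.dim_add_card_le[where T = "monomial_poly ` {m. mdeg m = k}"])
    show "I' \<inter> graded_piece k \<subseteq> tpoly.span (monomial_poly ` {m. mdeg m = k})"
      using graded_piece_finitely_spanned by blast
  qed (use sub I I' in \<open>auto simp: subspace_ideal_graded\<close>)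
  then show ?thesis unfolding hilbert_function_def by simp
qed

lemma ideal_eq_if_hilbert_function_eq:
  assumes I: "homogeneous_ideal I" and I': "homogeneous_ideal I'" and sub: "I \<subseteq> I'"
    and hf: "\<And>k. hilbert_function I k = hilbert_function I' k"
  shows "I = I'"
proof
  have Is: "tideal.subspace I" "tideal.subspace I'" using I I' by (auto simp: homogeneous_ideal_def)
  have eq: "I \<inter> graded_piece k = I' \<inter> graded_piece k" for k
  proof (rule tpoly.subspace_eq_if_dim_le[where T = "monomial_poly ` {m. mdeg m = k}"])
    show "I' \<inter> graded_piece k \<subseteq> tpoly.span (monomial_poly ` {m. mdeg m = k})"
      using graded_piece_finitely_spanned by blast
    show "tpoly.dim (I' \<inter> graded_piece k) \<le> tpoly.dim (I \<inter> graded_piece k)"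
      using hf[of k] hilbert_function_add_dim[OF Is(1), of k] hilbert_function_add_dim[OF Is(2), of k]
      by linarith
  qed (use sub Is in \<open>auto simp: subspace_ideal_graded\<close>)
  show "I' \<subseteq> I"
  proof
    fix f assume f: "f \<in> I'"
    have "hom_component k f \<in> I" for k
    proof -
      have "hom_component k f \<in> I' \<inter> graded_piece k"
        using f I' by (auto simp: homogeneous_ideal_def)
      then show ?thesis using eq[of k] by blast
    qed
    then show "f \<in> I" by (subst sum_hom_component) (rule tideal.subspace_sum[OF Is(1)])
  qed
qed (rule sub)

text \<open>Already the monomials with the first two exponents in a box are numerous enough; so the
  generic Hilbert function has the value r from degree a + b on.\<close>

lemma card_mdeg_ge:
  assumes "a + b \<le> k"
  shows "(a + 1) * (b + 1) \<le> card {m. mdeg m = k}"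
proof -
  define B :: "3 \<Rightarrow> nat" where "B j = (if j = 0 then a + 1 else b + 1)" for j
  have C: "- {2} = {0, 1 :: 3}" using three_cases by auto
  have "card {m. mdeg m = k \<and> (\<forall>j. j \<noteq> 2 \<longrightarrow> coef m j < B j)} = (\<Prod>j\<in>- {2}. B j)"
    by (rule card_box) (use assms in \<open>simp add: C B_def\<close>)
  also have "\<dots> = (a + 1) * (b + 1)" by (simp add: C B_def)
  finally have "(a + 1) * (b + 1) = card {m. mdeg m = k \<and> (\<forall>j. j \<noteq> 2 \<longrightarrow> coef m j < B j)}" by simp
  also have "\<dots> \<le> card {m. mdeg m = k}" by (rule card_mono) auto
  finally show ?thesis .
qed

text \<open>
  The assumptions on \<open>bd\<close> and \<open>N\<close> make the generators of all members apolar to the monomial; the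
  last one makes the members define schemes of length \<open>r\<close>. For a one-element index type the
  binomial generators vanish, whatever \<open>N\<close> is.
\<close>

locale apolar_family = diagonal_family x N bd
  for x :: "'n::finite \<Rightarrow> 3" and N :: nat and bd :: "3 \<Rightarrow> nat" +
  fixes a b c r :: nat
  assumes a_pos: "0 < a" and b_pos: "0 < b" and c_def: "c = a + b - 1" and r_def: "r = (a + 1) * (b + 1)"
    and bd_apolar: "\<And>j. j \<notin> range x \<Longrightarrow>
      0 < bd j \<and> bd j \<le> c \<and> \<not> below a b c (Poly_Mapping.single j (bd j))"
    and N_apolar: "(\<forall>i j :: 'n. i = j) \<or>
      N = Suc c \<and> (\<forall>i. \<not> below a b c (Poly_Mapping.single (x i) N))"
    and length_eq: "\<And>p. (\<Prod>j\<in>- {x p}. if j \<in> range x then N else bd j) = r"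
begin

lemma hilbert_function_J_large:
  assumes "w \<noteq> 0"
  shows "\<exists>k0. \<forall>k\<ge>k0. hilbert_function (J w) k = r"
proof -
  obtain p where p: "w $ p \<noteq> 0" using assms by (metis vec_eq_iff zero_index)
  then show ?thesis
    using hilbert_function_J[OF p] card_NF[of p] length_eq[of p]
    by (intro exI[of _ "\<Sum>j\<in>- {x p}. (if j \<in> range x then N else bd j) - 1"]) simp
qed

lemma J_apolar:
  assumes "w \<noteq> 0"
  shows "J w \<subseteq> monomial_ann a b c"
proof -
  obtain p where p: "w $ p \<noteq> 0" using assms by (metis vec_eq_iff zero_index)
  have "gens p w \<subseteq> monomial_ann a b c"
  proof -
    have "Var j ^ bd j \<in> monomial_ann a b c" if "j \<notin> range x" for j
      unfolding Var_power using bd_apolar[OF that] by (intro monomial_in_ann) simp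
    moreover have "Var (x i) ^ N - pscale (w $ i / w $ p) (Var (x p) ^ N) \<in> monomial_ann a b c" for i
    proof (cases "\<forall>i j :: 'n. i = j")
      case True
      then have "i = p" by blast
      then show ?thesis using p tideal.subspace_0[OF ideal_monomial_ann] by simp
    next
      case False
      then have "Var (x i) ^ N \<in> monomial_ann a b c" for i
        unfolding Var_power using N_apolar by (intro monomial_in_ann) blast
      then show ?thesis
        using tideal.subspace_diff[OF ideal_monomial_ann] ideal_pscale[OF ideal_monomial_ann] by blast
    qed
    ultimately show ?thesis by (auto simp: gens_def)
  qed
  then show ?thesis
    unfolding J_eq_span[OF p] by (rule ideal_span_subset[OF ideal_monomial_ann])
qed

text \<open>The vector \<open>w\<close> is read off in degree c + 1, where codimension one makes the
  N-th powers of the variables proportional modulo \<open>I\<close>; the powers of degree at most c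
  come from \<open>var_power_in_saturation\<close>.\<close>

lemma saturation_in_family:
  assumes I: "homogeneous_ideal I" and sub: "I \<subseteq> monomial_ann a b c"
    and hf: "hilbert_function I (Suc c) \<le> r" "r \<le> hilbert_function I (Suc (Suc c)) + 1"
    and large: "\<And>k. k1 \<le> k \<Longrightarrow> hilbert_function I k = r"
  shows "\<exists>w. w \<noteq> 0 \<and> saturation I = J w"
proof -
  have Is: "tideal.subspace I" using I by (simp add: homogeneous_ideal_def)
  note ctx = a_pos b_pos c_def r_def
  have "\<exists>w p. w $ p \<noteq> 0 \<and> (\<forall>i. Var (x i) ^ N - pscale (w $ i / w $ p) (Var (x p) ^ N) \<in> I)"
  proof (cases "\<forall>i j :: 'n. i = j")
    case True
    have "Var (x i) ^ N - pscale (((\<chi> i. 1) :: complex ^ 'n) $ i / ((\<chi> i. 1) :: complex ^ 'n) $ p) (Var (x p) ^ N) \<in> I"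
      for i p
    proof -
      have "i = p" using True by blast
      then show ?thesis using tideal.subspace_0[OF Is] by simp
    qed
    then show ?thesis by (intro exI[of _ "\<chi> i. 1"]) simp
  next
    case False
    then have N: "N = Suc c" "\<And>i. \<not> below a b c (Poly_Mapping.single (x i) N)" using N_apolar by blast+
    have pw: "Var (x i) ^ N \<in> monomial_ann a b c" "Var (x i) ^ N \<in> graded_piece (Suc c)" for i
      unfolding Var_power using monomial_in_ann[OF N(2)] monomial_poly_graded[of "Poly_Mapping.single (x i) N"] N(1)
      by auto
    show ?thesis
    proof (cases "\<exists>p. Var (x p) ^ N \<notin> I")
      case True
      then obtain p where p: "Var (x p) ^ N \<notin> I" by blast
      have "\<exists>k. Var (x i) ^ N - pscale k (Var (x p) ^ N) \<in> I" for i
        by (rule ann_codim_one[OF ctx Is sub hf(1) pw p pw])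
      then obtain k where k: "\<And>i. Var (x i) ^ N - pscale (k i) (Var (x p) ^ N) \<in> I" by metis
      \<comment> \<open>Setting the entry at \<open>p\<close> to 1 makes the binomial with
        \<open>i = p\<close> zero without determining \<open>k p\<close>.\<close>
      define w :: "complex ^ 'n" where "w = (\<chi> i. if i = p then 1 else k i)"
      have "Var (x i) ^ N - pscale (w $ i / w $ p) (Var (x p) ^ N) \<in> I" for i
        using k[of i] tideal.subspace_0[OF Is] by (cases "i = p") (simp_all add: w_def)
      moreover have "w $ p \<noteq> 0" by (simp add: w_def)
      ultimately show ?thesis by blast
    next
      case False
      \<comment> \<open>When all powers lie in \<open>I\<close>, the binomials of the all-ones
        vector do.\<close>
      then have "Var (x i) ^ N - Var (x p) ^ N \<in> I" for i p
        using tideal.subspace_diff[OF Is] by blast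
      then show ?thesis by (intro exI[of _ "\<chi> i. 1"]) simp
    qed
  qed
  then obtain w p where p: "w $ p \<noteq> 0"
    and w: "\<And>i. Var (x i) ^ N - pscale (w $ i / w $ p) (Var (x p) ^ N) \<in> I" by blast
  have "Var j ^ bd j \<in> saturation I" if "j \<notin> range x" for j
    using var_power_in_saturation[OF ctx Is sub hf] bd_apolar[OF that] by blast
  then have g: "gens p w \<subseteq> saturation I"
    using w subset_saturation[OF Is] by (auto simp: gens_def)
  have w0: "w \<noteq> 0" using p by auto
  obtain k0 where k0: "\<And>k. k0 \<le> k \<Longrightarrow> hilbert_function (J w) k = r"
    using hilbert_function_J_large[OF w0] by blast
  have "saturation I = J w"
    by (rule saturation_eq_J[OF p I g, of "k0 + k1"]) (simp add: k0 large)
  then show ?thesis using w0 by blast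
qed

lemma VPS_eq_family:
  assumes F: "Ann F = monomial_ann a b c"
  shows "VPS F r = J ` {w. w \<noteq> 0}"
proof
  show "J ` {w. w \<noteq> 0} \<subseteq> VPS F r"
  proof (rule image_subsetI)
    fix w :: "complex ^ 'n" assume "w \<in> {w. w \<noteq> 0}"
    then have w: "w \<noteq> 0" by simp
    then show "J w \<in> VPS F r"
      unfolding VPS_def Hilb_def F
      using homogeneous_J saturation_J[OF w] hilbert_function_J_large[OF w] J_apolar[OF w] by simp
  qed
  show "VPS F r \<subseteq> J ` {w. w \<noteq> 0}"
  proof
    fix I assume "I \<in> VPS F r"
    then obtain k1 where I: "homogeneous_ideal I" "saturation I = I" and sub: "I \<subseteq> monomial_ann a b c"
      and large: "\<And>k. k1 \<le> k \<Longrightarrow> hilbert_function I k = r"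
      by (auto simp: VPS_def Hilb_def F)
    have Is: "tideal.subspace I" using I by (simp add: homogeneous_ideal_def)
    have "hilbert_function I k \<le> r" if "k1 \<le> k" for k using large[OF that] by simp
    note mono = hilbert_function_saturated_mono[OF I this]
    have "hilbert_function I (Suc c) \<le> hilbert_function I (Suc c + k1)" by (rule mono) simp_all
    then have 1: "hilbert_function I (Suc c) \<le> r" using large[of "Suc c + k1"] by simp
    \<comment> \<open>A smaller ideal has larger Hilbert function; the value in degree c is carried
      to degree c + 2 by monotonicity, which costs the slack of one.\<close>
    have "r - 1 \<le> hilbert_function I c"
      using hilbert_function_antimono[OF Is ideal_monomial_ann sub, of c]
        hf_ann_c[OF a_pos b_pos c_def r_def] by simp
    also have "\<dots> \<le> hilbert_function I (Suc (Suc c))" by (rule mono) simp_all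
    finally have "r \<le> hilbert_function I (Suc (Suc c)) + 1" by simp
    from saturation_in_family[OF I(1) sub 1 this large] I(2) show "I \<in> J ` {w. w \<noteq> 0}" by auto
  qed
qed

lemma generic_hf_large: "Suc c \<le> k \<Longrightarrow> generic_hf r k = r"
  using card_mdeg_ge[of a b k] a_pos c_def r_def by (simp add: generic_hf_def dim_graded_piece)

lemma Slip_hilb: "I \<in> Slip r \<Longrightarrow> I \<in> multigraded_hilb (generic_hf r)"
  unfolding Slip_def using closure_of_subset_topspace[of "fs_top (multigraded_hilb_space (generic_hf r))"]
  by (auto simp: multigraded_hilb_space_def)

lemma apolar_hilb_saturation:
  assumes I: "I \<in> multigraded_hilb (generic_hf r)" and sub: "I \<subseteq> monomial_ann a b c"
  shows "\<exists>w. w \<noteq> 0 \<and> saturation I = J w"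
proof (rule saturation_in_family[OF _ sub])
  have hf: "hilbert_function I k = generic_hf r k" for k using I by (simp add: multigraded_hilb_def)
  show "homogeneous_ideal I" using I by (simp add: multigraded_hilb_def)
  show "hilbert_function I (Suc c) \<le> r" "r \<le> hilbert_function I (Suc (Suc c)) + 1"
    "\<And>k. Suc c \<le> k \<Longrightarrow> hilbert_function I k = r"
    by (simp_all add: hf generic_hf_large)
qed

text \<open>An ideal lies in its saturation, which settles one inclusion; for the other, the
  saturation of an apolar ideal in \<open>Slip\<close> belongs to the family and is therefore itself
  apolar.\<close>

lemma fiber_type:
  assumes F: "Ann F = monomial_ann a b c"
  shows "VSP_of_fiber_type F r"
  unfolding VSP_of_fiber_type_def
proof (intro equalityI subsetI)
  fix I assume "I \<in> VSP F r"
  then have I: "I \<in> Slip r" "I \<subseteq> monomial_ann a b c" by (auto simp: VSP_def F)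
  obtain w where "w \<noteq> 0" "saturation I = J w"
    using apolar_hilb_saturation[OF Slip_hilb[OF I(1)] I(2)] by blast
  then have "phi r I \<in> VPS F r"
    using I(1) VPS_eq_family[OF F] by (auto simp: phi_def Proj_quot_def)
  then show "I \<in> {I \<in> Slip r. phi r I \<in> VPS F r}" using I(1) by simp
next
  fix I assume "I \<in> {I \<in> Slip r. phi r I \<in> VPS F r}"
  then have I: "I \<in> Slip r" and "saturation I \<in> VPS F r" by (auto simp: phi_def Proj_quot_def)
  then have "saturation I \<subseteq> Ann F" by (simp add: VPS_def)
  moreover have "I \<subseteq> saturation I"
    using Slip_hilb[OF I] by (intro subset_saturation) (simp add: multigraded_hilb_def homogeneous_ideal_def)
  ultimately show "I \<in> VSP F r" using I by (auto simp: VSP_def)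
qed

lemma Proj_quot_span:
  assumes w: "w $ p \<noteq> 0" and G: "G \<subseteq> J w" and g: "gens p w \<subseteq> tideal.span G"
  shows "Proj_quot (tideal.span G) = J w"
proof -
  have "tideal.span G = J w"
  proof
    show "tideal.span G \<subseteq> J w" by (rule ideal_span_subset[OF ideal_J G])
    show "J w \<subseteq> tideal.span G"
      unfolding J_eq_span[OF w] by (rule ideal_span_subset[OF tideal.subspace_span g])
  qed
  moreover have "w \<noteq> 0" using w by auto
  ultimately show ?thesis by (simp add: Proj_quot_def saturation_J)
qed

end

subsection \<open>Pencils of diagonal conics as limits of quadruples of points\<close>

lemma eventually_nonzero:
  fixes f :: "'a::t2_space \<Rightarrow> 'b::t1_space"
  assumes "isCont f x" "f x \<noteq> c"
  shows "eventually (\<lambda>y. f y \<noteq> c) (nhds x)"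
  using tendsto_imp_eventually_ne[of f "f x" "nhds x" c] assms
  by (simp add: isCont_def tendsto_at_iff_tendsto_nhds)

context diagonal_family
begin

lemma isCont_lam: "isCont (\<lambda>w. lam w m) w"
  unfolding lam_def by (cases "ok m") (auto intro!: continuous_intros)

text \<open>
  Thus a Zariski closure of members of the family contains their limits with respect to the
  Euclidean topology on the parameters.
\<close>

lemma rational_expr_continuous:
  assumes "rational_expr X (ideal_coords K) U g" and X: "J ` {w. w \<noteq> 0} \<subseteq> X"
    and "w \<noteq> 0" and "J w \<in> U"
  shows "eventually (\<lambda>v. J v \<in> U) (nhds w) \<and> isCont (\<lambda>v. g (J v)) w"
  using assms(1,4)
proof (induction rule: rational_expr.induct)
  case (coord D h)
  then obtain k B m b where D: "D = chart_domain k B" and h: "h = chart_coord B m b"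
    and B: "B \<subseteq> {m. mdeg m = k}" and m: "mdeg m = k" and b: "b \<in> B"
    by (auto simp: ideal_coords_def)
  have Jw: "J w \<in> chart_domain k B" using coord.prems D by simp
  note T = chart_domain_transversal[OF \<open>w \<noteq> 0\<close> B Jw]
  \<comment> \<open>Nonvanishing of finitely many \<open>lam v b\<close> is an open condition, so
    near \<open>w\<close> the same set \<open>B\<close> is a chart and the coordinate is given by
    one continuous formula.\<close>
  have "eventually (\<lambda>v. v \<noteq> 0 \<and> (\<forall>b\<in>B. lam v b \<noteq> 0)) (nhds w)"
    using eventually_nonzero[OF continuous_ident \<open>w \<noteq> 0\<close>] eventually_nonzero[OF isCont_lam T(2)]
    by (auto simp: eventually_conj_iff eventually_ball_finite_distrib transversal_finite[OF T(1)])
  then have ev: "eventually (\<lambda>v. J v \<in> D \<inter> X \<and>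
      h (J v) = (if cls m = cls b then lam v m / lam v b else 0)) (nhds w)"
  proof eventually_elim
    case (elim v)
    then have nz: "\<And>b. b \<in> B \<Longrightarrow> lam v b \<noteq> 0" by blast
    show ?case
      using transversal_chart[OF T(1) nz] chart_coord_J[OF T(1) nz m b] X elim by (auto simp: D h)
  qed
  have "isCont (\<lambda>v. if cls m = cls b then lam v m / lam v b else 0) w"
    using T(2)[OF b] by (cases "cls m = cls b") (auto intro!: continuous_intros isCont_lam)
  moreover have "isCont (\<lambda>v. h (J v)) w \<longleftrightarrow> isCont (\<lambda>v. if cls m = cls b then lam v m / lam v b else 0) w"
    by (rule isCont_cong) (use ev in eventually_elim, simp)
  ultimately show ?case using ev by (auto elim: eventually_mono)
next
  case (const c)
  have "eventually (\<lambda>v. v \<noteq> 0) (nhds w)" using eventually_nonzero[OF continuous_ident \<open>w \<noteq> 0\<close>] .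
  then have "eventually (\<lambda>v. J v \<in> X) (nhds w)" by eventually_elim (use X in auto)
  then show ?case by simp
next
  case (add U f V g)
  then show ?case by (auto simp: eventually_conj_iff intro: continuous_intros)
next
  case (mult U f V g)
  then show ?case by (auto simp: eventually_conj_iff intro: continuous_intros)
next
  case (inverse U f)
  then have IH: "eventually (\<lambda>v. J v \<in> U) (nhds w)" "isCont (\<lambda>v. f (J v)) w" and nz: "f (J w) \<noteq> 0" by auto
  show ?case
    using IH(1) eventually_nonzero[OF IH(2) nz] continuous_at_within_inverse[OF IH(2) nz]
    by (auto simp: eventually_conj_iff)
qed

end

text \<open>A polynomial in \<open>t\<close> vanishing identically has zero coefficients; the sum on
  the left of the conclusion is the coefficient of \<open>t ^ k\<close>.\<close>

lemma separate_powers: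
  fixes Y :: "'a \<Rightarrow> complex"
  assumes "finite A" "\<And>t. (\<Sum>C\<in>A. t ^ d C * Y C) = 0"
  shows "(\<Sum>C\<in>{C \<in> A. d C = k}. Y C) = 0"
proof (cases "k \<in> d ` A")
  case True
  define n where "n = Max (d ` A)"
  have n: "d ` A \<subseteq> {..n}" using assms(1) by (auto simp: n_def)
  have "(\<Sum>i\<le>n. (\<Sum>C\<in>{C \<in> A. d C = i}. Y C) * t ^ i) = 0" for t
  proof -
    have "(\<Sum>i\<le>n. (\<Sum>C\<in>{C \<in> A. d C = i}. Y C) * t ^ i) = (\<Sum>i\<le>n. \<Sum>C\<in>{C \<in> A. d C = i}. t ^ d C * Y C)"
      unfolding sum_distrib_right by (intro sum.cong) auto
    also have "\<dots> = (\<Sum>C\<in>A. t ^ d C * Y C)" by (rule sum.group[OF assms(1) _ n]) simp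
    finally show ?thesis using assms(2) by simp
  qed
  then have "\<forall>i\<le>n. (\<Sum>C\<in>{C \<in> A. d C = i}. Y C) = 0"
    using polyfun_eq_0[of "\<lambda>i. \<Sum>C\<in>{C \<in> A. d C = i}. Y C" n] by blast
  then show ?thesis using True n by auto
next
  case False
  then have "{C \<in> A. d C = k} = {}" by auto
  then show ?thesis by (simp only: sum.empty)
qed

text \<open>Averaging over the two characters of a group of order two extracts one parity.\<close>

lemma separate_signs:
  fixes Y :: "'a \<Rightarrow> complex" and n :: "'a \<Rightarrow> nat"
  assumes fin: "finite A" and n: "\<And>C. C \<in> A \<Longrightarrow> n C < 2"
    and 1: "(\<Sum>C\<in>A. 1 ^ n C * Y C) = 0" and 2: "(\<Sum>C\<in>A. (- 1) ^ n C * Y C) = 0"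
  shows "(\<Sum>C\<in>{C \<in> A. n C = \<nu>}. Y C) = 0"
proof (cases "\<nu> < 2")
  case True
  have "(\<Sum>C\<in>{C \<in> A. n C = \<nu>}. 2 * Y C) = (\<Sum>C\<in>A. if n C = \<nu> then 2 * Y C else 0)"
    using fin by (rule sum.inter_filter)
  also have "\<dots> = (\<Sum>C\<in>A. 1 ^ n C * Y C + (- 1) ^ \<nu> * ((- 1) ^ n C * Y C))"
  proof (rule sum.cong[OF refl])
    fix C assume "C \<in> A"
    then have "n C = 0 \<or> n C = 1" "\<nu> = 0 \<or> \<nu> = 1" using n[of C] True by auto
    then show "(if n C = \<nu> then 2 * Y C else 0) = 1 ^ n C * Y C + (- 1) ^ \<nu> * ((- 1) ^ n C * Y C)"
      by auto
  qed
  also have "\<dots> = 0" by (simp only: sum.distrib sum_distrib_left[symmetric] 1 2) simp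
  finally show ?thesis by (simp add: sum_distrib_left[symmetric])
next
  case False
  then have "{C \<in> A. n C = \<nu>} = {}" using n by force
  then show ?thesis by (simp only: sum.empty)
qed

text \<open>For F = x0 x1 x2 all three variables have exponent c, and \<open>J w\<close> is
  generated by the pencil of diagonal conics whose coefficient vectors annihilate
  \<open>w\<close>.\<close>

interpretation quadrics: apolar_family "\<lambda>i :: 3. i" 2 "\<lambda>_. 2" 1 1 1 4
proof
  show "(\<forall>i j :: 3. i = j) \<or> (2 :: nat) = Suc 1 \<and> (\<forall>i. \<not> below 1 1 1 (Poly_Mapping.single i 2))"
  proof -
    have "\<not> below 1 1 1 (Poly_Mapping.single i 2)" for i
      using three_cases[of i] by (auto simp: below_def lookup_single when_def)
    then show ?thesis by simp
  qed
  show "(\<Prod>j\<in>- {p}. if j \<in> range (\<lambda>i. i) then 2 else 2) = (4 :: nat)" for p :: 3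
    by (simp add: Compl_eq_Diff_UNIV card_Diff_subset)
qed auto

lemma quadrics_ok [simp]: "quadrics.ok m"
  by (simp add: quadrics.ok_def)

lemma quadrics_card_NF:
  assumes "2 \<le> k"
  shows "card (quadrics.NF p \<inter> {m. mdeg m = k}) = 4"
proof -
  have "(\<Sum>j\<in>- {p}. (if j \<in> range (\<lambda>i. i) then 2 else 2) - 1) = (2 :: nat)"
    by (simp add: Compl_eq_Diff_UNIV card_Diff_subset)
  then show ?thesis
    using quadrics.card_NF[of p k] quadrics.length_eq[of p] assms by simp
qed

text \<open>The Hilbert function is 1, 3, 4, 4, ...: below degree 2 all monomials are standard, and
  from there on there are four.\<close>

lemma quadrics_hilb:
  assumes "w \<noteq> 0"
  shows "quadrics.J w \<in> multigraded_hilb (generic_hf 4)"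
proof -
  obtain p where p: "w $ p \<noteq> 0" using assms by (metis vec_eq_iff zero_index)
  have "hilbert_function (quadrics.J w) k = generic_hf 4 k" for k
  proof (cases "2 \<le> k")
    case True
    then have "hilbert_function (quadrics.J w) k = 4"
      using quadrics.hilbert_function_J[OF p] quadrics_card_NF by simp
    then show ?thesis by (simp add: generic_hf_def hilbert_function_def)
  next
    case False
    have small: "coef m j < 2" if "mdeg m = k" for m j
    proof -
      have "coef m j \<le> mdeg m" unfolding mdeg_def by (rule member_le_sum) auto
      then show ?thesis using that False by simp
    qed
    then have NF: "quadrics.NF p \<inter> {m. mdeg m = k} = {m. mdeg m = k}"
      by (auto simp: quadrics.NF_def)
    have "card {m. mdeg m = k} \<le> 4"
    proof -
      have "{m. mdeg m = k} \<subseteq> insert 0 (range (\<lambda>i. Poly_Mapping.single i 1))"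
      proof
        fix m assume "m \<in> {m. mdeg m = k}"
        then have m: "coef m 0 + coef m 1 + coef m 2 < 2" using False by (simp add: mdeg_expand)
        show "m \<in> insert 0 (range (\<lambda>i. Poly_Mapping.single i 1))"
        proof (cases "m = 0")
          case False
          then obtain i where "coef m i \<noteq> 0" by (metis poly_mapping_eqI lookup_zero)
          then have "m = Poly_Mapping.single i 1"
            using m three_cases[of i] by (intro expo_eqI) (auto simp: lookup_single when_def)
          then show ?thesis by blast
        qed simp
      qed
      then have "card {m. mdeg m = k} \<le> card (insert 0 (range (\<lambda>i :: 3. Poly_Mapping.single i (1 :: nat))))"
        by (intro card_mono) auto
      also have "\<dots> \<le> Suc (card (range (\<lambda>i :: 3. Poly_Mapping.single i (1 :: nat))))" by (rule card_insert_le_m1) auto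
      also have "card (range (\<lambda>i :: 3. Poly_Mapping.single i (1 :: nat))) \<le> CARD(3)" by (rule card_image_le) simp
      finally show ?thesis by simp
    qed
    then show ?thesis
      using quadrics.hilbert_function_J[OF p, of k] NF by (simp add: generic_hf_def dim_graded_piece)
  qed
  then show ?thesis by (simp add: multigraded_hilb_def quadrics.homogeneous_J)
qed

lemma power_split_parity: "(z :: complex) ^ n = z ^ (n mod 2) * (z\<^sup>2) ^ (n div 2)"
  by (metis mod_mult_div_eq power_add power_mult)

text \<open>At a point whose squared coordinates are \<open>w\<close>, all monomials of a class
  share the degree and the parities of the exponents, and the rest is \<open>lam w\<close>.
  Evaluation is thus a combination of the class functionals.\<close>

lemma poly_eval_classes:
  assumes v: "\<And>i. (v $ i)\<^sup>2 = w $ i"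
  shows "poly_eval p (t *s v)
    = (\<Sum>C\<in>quadrics.cls ` supp p. t ^ fst C * ((\<Prod>i\<in>UNIV. (v $ i) ^ snd C i) * quadrics.csum w C p))"
proof -
  have summand: "(\<Prod>i\<in>UNIV. ((t *s v) $ i) ^ coef m i)
      = t ^ fst (quadrics.cls m) * (\<Prod>i\<in>UNIV. (v $ i) ^ snd (quadrics.cls m) i) * quadrics.lam w m" for m
  proof -
    have "(\<Prod>i\<in>UNIV. ((t *s v) $ i) ^ coef m i)
       = (\<Prod>i\<in>UNIV. t ^ coef m i * ((v $ i) ^ (coef m i mod 2) * (w $ i) ^ (coef m i div 2)))"
      using power_split_parity[of "v $ i" "coef m i" for i]
      by (intro prod.cong) (simp_all add: power_mult_distrib v)
    then show ?thesis
      by (simp add: prod.distrib quadrics.cls_def quadrics.lam_def quadrics.ex_def mdeg_def power_sum)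
  qed
  have "poly_eval p (t *s v) = (\<Sum>m\<in>supp p. coef p m * (t ^ fst (quadrics.cls m) *
      (\<Prod>i\<in>UNIV. (v $ i) ^ snd (quadrics.cls m) i) * quadrics.lam w m))"
    unfolding poly_eval_def summand ..
  also have "\<dots> = (\<Sum>C\<in>quadrics.cls ` supp p. \<Sum>m\<in>{m \<in> supp p. quadrics.cls m = C}.
      coef p m * (t ^ fst (quadrics.cls m) * (\<Prod>i\<in>UNIV. (v $ i) ^ snd (quadrics.cls m) i) * quadrics.lam w m))"
    by (rule sum.image_gen) simp
  also have "\<dots> = (\<Sum>C\<in>quadrics.cls ` supp p. t ^ fst C * ((\<Prod>i\<in>UNIV. (v $ i) ^ snd C i) * quadrics.csum w C p))"
  proof (rule sum.cong[OF refl])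
    fix C
    have "quadrics.csum w C p = (\<Sum>m\<in>{m \<in> supp p. quadrics.cls m = C}. coef p m * quadrics.lam w m)"
      unfolding quadrics.csum_def by (rule sum.inter_filter[symmetric]) simp
    then show "(\<Sum>m\<in>{m \<in> supp p. quadrics.cls m = C}.
      coef p m * (t ^ fst (quadrics.cls m) * (\<Prod>i\<in>UNIV. (v $ i) ^ snd (quadrics.cls m) i) * quadrics.lam w m))
      = t ^ fst C * ((\<Prod>i\<in>UNIV. (v $ i) ^ snd C i) * quadrics.csum w C p)"
      by (simp add: sum_distrib_left mult_ac)
  qed
  finally show ?thesis .
qed

text \<open>The points with the same squared coordinates as \<open>s\<close>; in the projective
  plane only relative signs count, so the sign of coordinate 0 is fixed.\<close>

definition signed :: "complex ^ 3 \<Rightarrow> complex \<times> complex \<Rightarrow> complex ^ 3"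
  where "signed s e = (\<chi> i. (if i = 1 then fst e else if i = 2 then snd e else 1) * s $ i)"

lemma prod_UNIV_three: "(\<Prod>i\<in>(UNIV :: 3 set). f i) = f 0 * f 1 * (f 2 :: complex)"
proof -
  have "(\<Prod>i\<in>(UNIV :: 3 set). f i) = (\<Prod>i\<in>{0, 1, 2 :: 3}. f i)" by (simp only: UNIV_three)
  also have "\<dots> = f 0 * f 1 * f 2" by (simp add: mult.assoc)
  finally show ?thesis .
qed

text \<open>Scaling by all \<open>t\<close> separates degrees, and the four sign choices separate
  the parities of exponents 1 and 2. The parity of exponent 0 is then forced by the degree, so a
  single class remains.\<close>

lemma csum_zero_of_vanishing:
  assumes s: "\<And>i. (s $ i)\<^sup>2 = w $ i" and nz: "\<And>i. w $ i \<noteq> 0"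
    and van: "\<And>t e. e \<in> {1, -1} \<times> {1, -1} \<Longrightarrow> poly_eval p (t *s signed s e) = 0"
  shows "quadrics.csum w C0 p = 0"
proof (cases "C0 \<in> quadrics.cls ` supp p")
  case C0: True
  let ?A = "quadrics.cls ` supp p"
  define Y where "Y C = (\<Prod>i\<in>UNIV. (s $ i) ^ snd C i) * quadrics.csum w C p" for C
  have par: "snd C i < 2" if "C \<in> ?A" for C i using that by (auto simp: quadrics.cls_def)
  have signed_prod: "(\<Prod>i\<in>UNIV. (signed s e $ i) ^ snd C i)
      = fst e ^ snd C 1 * snd e ^ snd C 2 * (\<Prod>i\<in>UNIV. (s $ i) ^ snd C i)" for e and C :: "nat \<times> (3 \<Rightarrow> nat)"
    unfolding prod_UNIV_three by (simp add: signed_def power_mult_distrib mult_ac)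
  have deg: "(\<Sum>C\<in>{C \<in> ?A. fst C = fst C0}. fst e ^ snd C 1 * (snd e ^ snd C 2 * Y C)) = 0"
    if e: "e \<in> {1, -1} \<times> {1, -1}" for e
  proof (rule separate_powers)
    fix t
    have "(signed s e $ i)\<^sup>2 = w $ i" for i
      using e s by (auto simp: signed_def power_mult_distrib)
    from poly_eval_classes[OF this, of p t] van[OF e, of t]
    show "(\<Sum>C\<in>?A. t ^ fst C * (fst e ^ snd C 1 * (snd e ^ snd C 2 * Y C))) = 0"
      unfolding signed_prod Y_def by (simp add: mult.assoc)
  qed simp
  let ?B = "{C \<in> ?A. fst C = fst C0}" 
  let ?B1 = "{C \<in> ?B. snd C 1 = snd C0 1}"
  have s1: "(\<Sum>C\<in>?B1. e2 ^ snd C 2 * Y C) = 0" if e2: "e2 \<in> {1, -1}" for e2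
  proof (rule separate_signs)
    show "(\<Sum>C\<in>?B. 1 ^ snd C 1 * (e2 ^ snd C 2 * Y C)) = 0" using deg[of "(1, e2)"] e2 by simp
    show "(\<Sum>C\<in>?B. (- 1) ^ snd C 1 * (e2 ^ snd C 2 * Y C)) = 0" using deg[of "(-1, e2)"] e2 by simp
  qed (use par in auto)
  have "(\<Sum>C\<in>{C \<in> ?B1. snd C 2 = snd C0 2}. Y C) = 0"
    by (rule separate_signs) (use par s1[of 1] s1[of "- 1"] in auto)
  moreover have "{C \<in> ?B1. snd C 2 = snd C0 2} = {C0}"
  proof (intro equalityI subsetI)
    fix C assume C: "C \<in> {C \<in> ?B1. snd C 2 = snd C0 2}"
    then obtain m where m: "C = quadrics.cls m" by auto
    obtain m0 where m0: "C0 = quadrics.cls m0" using C0 by auto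
    have e: "coef m 0 + coef m 1 + coef m 2 = coef m0 0 + coef m0 1 + coef m0 2"
      "coef m 1 mod 2 = coef m0 1 mod 2" "coef m 2 mod 2 = coef m0 2 mod 2"
      using C by (auto simp: m m0 quadrics.cls_def mdeg_expand)
    have "i mod 2 = i' mod 2" if "i + j + l = i' + j' + l'" "j mod 2 = j' mod 2" "l mod 2 = l' mod 2"
      for i j l i' j' l' :: nat
    proof -
      have "even (i + j + l) = even (i' + j' + l')" using that(1) by simp
      moreover have "even j = even j'" "even l = even l'"
        using that(2,3) by (simp_all only: even_iff_mod_2_eq_zero)
      ultimately have "even i = even i'" by (simp only: even_add) blast
      then show ?thesis
        unfolding even_iff_mod_2_eq_zero using mod_less_divisor[of 2 i] mod_less_divisor[of 2 i'] by linarith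
    qed
    from this[OF e] have "coef m 0 mod 2 = coef m0 0 mod 2" .
    then have "coef m i mod 2 = coef m0 i mod 2" for i using e(2,3) three_cases[of i] by auto
    then show "C \<in> {C0}" using e(1) by (simp add: m m0 quadrics.cls_def mdeg_expand)
  qed (use C0 in auto)
  ultimately have "Y C0 = 0" by simp
  moreover have "s $ i \<noteq> 0" for i using s[of i] nz[of i] by auto
  ultimately show ?thesis by (simp add: Y_def)
next
  case False
  then show ?thesis unfolding quadrics.csum_def by (intro sum.neutral) auto
qed

text \<open>If no entry of \<open>w\<close> vanishes, the base locus of the pencil consists of four
  distinct points, with coordinates the square roots of the entries up to sign.\<close>

lemma quadrics_points_locus:
  assumes nz: "\<And>i. w $ i \<noteq> 0"
  shows "quadrics.J w \<in> points_locus 4"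
proof -
  define s :: "complex ^ 3" where "s = (\<chi> i. csqrt (w $ i))"
  have s: "(s $ i)\<^sup>2 = w $ i" for i by (simp add: s_def)
  have s0: "s $ i \<noteq> 0" for i using s[of i] nz[of i] by auto
  let ?E = "{1, -1} \<times> {1, -1} :: (complex \<times> complex) set"
  let ?\<Gamma> = "(\<lambda>e. vec.span {signed s e}) ` ?E"
  have comp: "signed s e $ 0 = s $ 0" "signed s e $ 1 = fst e * s $ 1" "signed s e $ 2 = snd e * s $ 2" for e
    by (simp_all add: signed_def)
  have ne: "signed s e \<noteq> 0" for e using comp(1)[of e] s0[of 0] by (metis zero_index)
  have inj: "inj_on (\<lambda>e. vec.span {signed s e}) ?E"
  proof (rule inj_onI)
    fix e e' assume "vec.span {signed s e} = vec.span {signed s e'}"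
    then have "signed s e \<in> vec.span {signed s e'}"
      using vec.span_base[of "signed s e" "{signed s e}"] by simp
    then obtain c where c: "signed s e = c *s signed s e'"
      unfolding mem_vec_span_singleton by blast
    have "s $ 0 = c * s $ 0" using arg_cong[OF c, of "\<lambda>v. v $ 0"] by (simp add: comp)
    then have "c = 1" using s0[of 0] by simp
    then have eq: "signed s e = signed s e'" using c by simp
    have "fst e * s $ 1 = fst e' * s $ 1" "snd e * s $ 2 = snd e' * s $ 2"
      using arg_cong[OF eq, of "\<lambda>v. v $ 1"] arg_cong[OF eq, of "\<lambda>v. v $ 2"] by (simp_all only: comp)
    then show "e = e'" using s0 by (simp add: prod_eq_iff)
  qed
  have "card ?\<Gamma> = 4" unfolding card_image[OF inj] by (simp add: card_cartesian_product)
  moreover have "finite ?\<Gamma>" by simp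
  moreover have "?\<Gamma> \<subseteq> proj_points (*s) UNIV" using ne by (auto simp: proj_points_vec)
  moreover have "vanishing_ideal ?\<Gamma> = quadrics.J w"
  proof (intro equalityI subsetI)
    fix p assume p: "p \<in> vanishing_ideal ?\<Gamma>"
    have "quadrics.csum w C p = 0" for C
    proof (rule csum_zero_of_vanishing[OF s nz])
      fix t e assume "e \<in> ?E"
      moreover have "t *s signed s e \<in> vec.span {signed s e}" using mem_vec_span_singleton by blast
      ultimately show "poly_eval p (t *s signed s e) = 0" using p unfolding vanishing_ideal_def by blast
    qed
    then show "p \<in> quadrics.J w" by (simp add: quadrics.J_def)
  next
    fix p assume p: "p \<in> quadrics.J w"
    have "poly_eval p (t *s signed s e) = 0" if e: "e \<in> ?E" for t e
    proof -
      have "(signed s e $ i)\<^sup>2 = w $ i" for i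
        using e s by (auto simp: signed_def power_mult_distrib)
      from poly_eval_classes[OF this, of p t] show ?thesis
        by (simp only: quadrics.J_D[OF p] mult_zero_right sum.neutral_const)
    qed
    then have "poly_eval p v = 0" if "e \<in> ?E" "v \<in> vec.span {signed s e}" for e v
      using that unfolding mem_vec_span_singleton by blast
    then show "p \<in> vanishing_ideal ?\<Gamma>" unfolding vanishing_ideal_def by blast
  qed
  moreover have "w \<noteq> 0" using nz[of 0] by auto
  then have "quadrics.J w \<in> multigraded_hilb (generic_hf 4)" by (rule quadrics_hilb)
  ultimately show ?thesis unfolding points_locus_def by blast
qed

text \<open>Parameters without zero entries are dense, and Euclidean limits of parameters stay in
  the Zariski closure.\<close>

lemma quadrics_Slip:
  assumes w: "w \<noteq> 0"
  shows "quadrics.J w \<in> Slip 4"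
proof -
  let ?X = "multigraded_hilb (generic_hf 4)"
  have X: "quadrics.J ` {w. w \<noteq> 0} \<subseteq> ?X" using quadrics_hilb by auto
  have "\<exists>I. I \<in> points_locus 4 \<and> I \<in> T"
    if T: "quadrics.J w \<in> T" "openin (fs_top (generated_fspace ?X (ideal_coords UNIV))) T" for T
  proof -
    obtain U g where U: "rational_expr ?X (ideal_coords UNIV) U g" "quadrics.J w \<in> U" "U \<subseteq> T"
      using T unfolding openin_generated by blast
    have ev: "eventually (\<lambda>v. quadrics.J v \<in> U) (nhds w)"
      using quadrics.rational_expr_continuous[OF U(1) X w U(2)] by blast
    \<comment> \<open>A zero entry becomes 1/(n + 1), and a nonzero one stays nonzero for large
      n.\<close>
    define v where "v n = (\<chi> i. w $ i + of_real (inverse (real (Suc n))))" for n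
    have comp: "(\<lambda>n. v n $ i) \<longlonglongrightarrow> w $ i" for i
    proof -
      have "(\<lambda>n. w $ i + of_real (inverse (real (Suc n)))) \<longlonglongrightarrow> w $ i + of_real 0"
        by (intro tendsto_intros LIMSEQ_inverse_real_of_nat)
      then show ?thesis by (simp add: v_def)
    qed
    then have lim: "v \<longlonglongrightarrow> w" by (rule vec_tendstoI)
    have "eventually (\<lambda>n. v n $ i \<noteq> 0) sequentially" for i
    proof (cases "w $ i = 0")
      case True
      have "v n $ i \<noteq> 0" for n
        using of_real_eq_0_iff[of "inverse (real (Suc n))", where 'a=complex] by (simp add: v_def True del: of_nat_Suc)
      then show ?thesis by simp
    next
      case False
      then show ?thesis using tendsto_imp_eventually_ne[OF comp] by blast
    qed
    then have "eventually (\<lambda>n. \<forall>i. v n $ i \<noteq> 0) sequentially" by (simp add: eventually_all_finite)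
    moreover have "eventually (\<lambda>n. quadrics.J (v n) \<in> U) sequentially"
      using ev lim by (rule eventually_compose_filterlim)
    ultimately have "eventually (\<lambda>n. (\<forall>i. v n $ i \<noteq> 0) \<and> quadrics.J (v n) \<in> U) sequentially"
      by (rule eventually_conj)
    then obtain n where "\<forall>i. v n $ i \<noteq> 0" "quadrics.J (v n) \<in> U"
      using eventually_happens'[OF sequentially_bot] by blast
    then show ?thesis using quadrics_points_locus U(3) by blast
  qed
  moreover have "quadrics.J w \<in> ?X" by (rule quadrics_hilb[OF w])
  ultimately show ?thesis
    unfolding Slip_def multigraded_hilb_space_def in_closure_of topspace_generated by blast
qed

text \<open>Every member of the family already has the generic Hilbert function, so an ideal in VSP
  equals its saturation.\<close>

lemma quadrics_VSP:
  assumes F: "Ann F = monomial_ann 1 1 1"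
  shows "VSP F 4 = quadrics.J ` {w. w \<noteq> 0}"
proof (intro equalityI subsetI)
  fix I assume "I \<in> VSP F 4"
  then have I: "I \<in> multigraded_hilb (generic_hf 4)" "I \<subseteq> monomial_ann 1 1 1"
    using quadrics.Slip_hilb by (auto simp: VSP_def F)
  obtain w where w: "w \<noteq> 0" "saturation I = quadrics.J w"
    using quadrics.apolar_hilb_saturation[OF I] by blast
  have hom: "homogeneous_ideal I" using I(1) by (simp add: multigraded_hilb_def)
  then have "I \<subseteq> quadrics.J w"
    using subset_saturation w(2) by (auto simp: homogeneous_ideal_def)
  moreover have "hilbert_function I k = hilbert_function (quadrics.J w) k" for k
    using I(1) quadrics_hilb[OF w(1)] by (simp add: multigraded_hilb_def)
  ultimately have "I = quadrics.J w"
    using ideal_eq_if_hilbert_function_eq[OF hom quadrics.homogeneous_J] by blast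
  then show "I \<in> quadrics.J ` {w. w \<noteq> 0}" using w(1) by simp
next
  fix I assume "I \<in> quadrics.J ` {w. w \<noteq> 0}"
  then show "I \<in> VSP F 4" using quadrics_Slip quadrics.J_apolar by (auto simp: VSP_def F)
qed

subsection \<open>The three cases\<close>

text \<open>The quadrics apolar to x0 x1 x2 are the diagonal ones; \<open>diag\<close> and
  \<open>diag_coefs\<close> are mutually inverse linear maps between them and coefficient
  vectors.\<close>

definition diag :: "complex ^ 3 \<Rightarrow> tpoly"
  where "diag w = (\<Sum>i\<in>UNIV. pscale (w $ i) (Var i ^ 2))"

definition diag_coefs :: "tpoly \<Rightarrow> complex ^ 3"
  where "diag_coefs p = (\<chi> i. coef p (Poly_Mapping.single i 2))"

lemma coef_Var_square: "coef (Var i ^ 2) m = (if m = Poly_Mapping.single i 2 then 1 else 0)"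
  by (simp only: Var_power coef_monomial_poly)

lemma single_two_eq_iff: "(Poly_Mapping.single i 2 :: expo) = Poly_Mapping.single j 2 \<longleftrightarrow> i = j"
  by (metis lookup_single_eq lookup_single_not_eq zero_neq_numeral)

lemma coef_diag: "coef (diag w) m = (\<Sum>i\<in>UNIV. if m = Poly_Mapping.single i 2 then w $ i else 0)"
  unfolding diag_def lookup_sum coef_pscale coef_Var_square by (intro sum.cong) auto

lemma coef_diag_single: "coef (diag w) (Poly_Mapping.single j 2) = w $ j"
  unfolding coef_diag single_two_eq_iff by simp

lemma diag_coefs_diag: "diag_coefs (diag w) = w"
  by (simp add: diag_coefs_def coef_diag_single vec_eq_iff)

lemma linear_diag: "Vector_Spaces.linear (*s) pscale diag"
  unfolding Vector_Spaces.linear_iff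
  by (simp add: vec.vector_space_axioms tpoly.vector_space_axioms diag_def
      tpoly.scale_left_distrib sum.distrib tpoly.scale_sum_right)

lemma linear_diag_coefs: "Vector_Spaces.linear pscale (*s) diag_coefs"
  unfolding Vector_Spaces.linear_iff
  by (simp add: vec.vector_space_axioms tpoly.vector_space_axioms diag_coefs_def vec_eq_iff lookup_add)

lemma diag_in_ann: "diag w \<in> monomial_ann 1 1 1 \<inter> graded_piece 2"
proof -
  have "\<not> below 1 1 1 m \<and> mdeg m = 2" if "coef (diag w) m \<noteq> 0" for m
  proof -
    have "\<exists>i. m = Poly_Mapping.single i 2"
    proof (rule ccontr)
      assume "\<not> ?thesis"
      then show False using that unfolding coef_diag by simp
    qed
    then obtain i where m: "m = Poly_Mapping.single i 2" ..
    have "\<not> below 1 1 1 m"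
      using three_cases[of i] unfolding m by (auto simp: below_def lookup_single when_def)
    then show ?thesis by (simp add: m)
  qed
  then show ?thesis unfolding monomial_ann_def graded_piece_eq by blast
qed

lemma diag_diag_coefs:
  assumes "p \<in> monomial_ann 1 1 1 \<inter> graded_piece 2"
  shows "diag (diag_coefs p) = p"
proof (rule poly_mapping_eqI)
  fix m
  show "coef (diag (diag_coefs p)) m = coef p m"
  proof (cases "\<exists>j. m = Poly_Mapping.single j 2")
    case True
    then show ?thesis by (auto simp: coef_diag_single diag_coefs_def)
  next
    case False
    have "coef p m = 0"
    proof (rule ccontr)
      assume "coef p m \<noteq> 0"
      then have m: "coef m 0 + coef m 1 + coef m 2 = 2" "\<not> (coef m 0 \<le> 1 \<and> coef m 1 \<le> 1 \<and> coef m 2 \<le> 1)"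
        using assms by (auto simp: monomial_ann_def graded_piece_eq below_def mdeg_expand)
      have "m = Poly_Mapping.single i 2" if "2 \<le> coef m i" for i
        using three_cases[of i] m(1) that by (intro expo_eqI) (auto simp: lookup_single when_def)
      moreover have "2 \<le> coef m 0 \<or> 2 \<le> coef m 1 \<or> 2 \<le> coef m 2" using m(2) by linarith
      ultimately have "\<exists>i. m = Poly_Mapping.single i 2" by blast
      then show False using False by blast
    qed
    then show ?thesis using False unfolding coef_diag by simp
  qed
qed

lemma proj_ann_equiv:
  "fs_equiv (proj_points pscale (monomial_ann 1 1 1 \<inter> graded_piece 2)) (proj_coords pscale)
    (proj_points (*s) (UNIV :: (complex ^ 3) set)) (proj_coords (*s))"
proof -
  let ?V = "monomial_ann 1 1 1 \<inter> graded_piece 2"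
  have sub: "tpoly.subspace ?V" by (rule subspace_ideal_graded[OF ideal_monomial_ann])
  have f: "fs_morphism (proj_points pscale ?V) (proj_coords pscale)
      (proj_points (*s) UNIV) (proj_coords (*s)) ((`) diag_coefs)"
  proof (rule proj_linear_morphism[OF linear_diag_coefs])
    fix v assume v: "v \<in> ?V" "diag_coefs v = 0"
    have "diag 0 = 0" by (simp add: diag_def)
    then show "v = 0" using diag_diag_coefs[OF v(1)] v(2) by simp
  qed simp
  have g: "fs_morphism (proj_points (*s) UNIV) (proj_coords (*s))
      (proj_points pscale ?V) (proj_coords pscale) ((`) diag)"
  proof (rule proj_linear_morphism[OF linear_diag])
    show "diag ` UNIV \<subseteq> ?V" using diag_in_ann by blast
    fix w assume "diag w = 0"
    then have "diag_coefs 0 = w" using diag_coefs_diag[of w] by simp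
    then show "w = 0" by (simp add: diag_coefs_def vec_eq_iff)
  qed
  have gf: "diag ` (diag_coefs ` L) = L" if "L \<in> proj_points pscale ?V" for L
  proof -
    from that obtain v where v: "v \<in> ?V" "L = tpoly.span {v}" unfolding proj_points_def by blast
    have "L \<subseteq> ?V" unfolding v(2) by (rule tpoly.span_minimal[OF _ sub]) (use v(1) in simp)
    then have "diag (diag_coefs p) = p" if "p \<in> L" for p using diag_diag_coefs that by blast
    then show ?thesis by (force simp: image_image)
  qed
  have fg: "diag_coefs ` (diag ` L) = L" for L by (simp add: image_image diag_coefs_diag)
  show ?thesis unfolding fs_equiv_def
    by (rule exI[of _ "(`) diag_coefs"], rule exI[of _ "(`) diag"]) (intro conjI ballI f g gf fg)
qed

text \<open>VSP and VPS are the same set of ideals here but carry coordinates from different sets of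
  degrees. Either set contains degree 4, so each space is compared with the plane.\<close>

lemma case_one_one:
  assumes F: "Ann F = monomial_ann 1 1 1"
  shows "VSP_space F 4 \<cong>\<^sub>f\<^sub>s VPS_space F 4"
    and "VPS_space F 4 \<cong>\<^sub>f\<^sub>s proj_space pscale (Ann F \<inter> graded_piece 2)"
    and "proj_space pscale (Ann F \<inter> graded_piece 2) \<cong>\<^sub>f\<^sub>s P2"
proof -
  have eq: "fs_equiv (quadrics.J ` {w. w \<noteq> 0}) (ideal_coords K)
      (proj_points (*s) (UNIV :: (complex ^ 3) set)) (proj_coords (*s))" if "4 \<in> K" for K
    using quadrics.family_equiv_proj_space[OF _ _ that] by simp
  have VSP: "VSP F 4 = quadrics.J ` {w. w \<noteq> 0}" by (rule quadrics_VSP[OF F])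
  have VPS: "VPS F 4 = quadrics.J ` {w. w \<noteq> 0}" by (rule quadrics.VPS_eq_family[OF F])
  have 1: "fs_equiv (quadrics.J ` {w. w \<noteq> 0}) (ideal_coords UNIV)
      (proj_points (*s) (UNIV :: (complex ^ 3) set)) (proj_coords (*s))" by (rule eq) simp
  have 2: "fs_equiv (quadrics.J ` {w. w \<noteq> 0}) (ideal_coords {4..})
      (proj_points (*s) (UNIV :: (complex ^ 3) set)) (proj_coords (*s))" by (rule eq) simp
  show "VSP_space F 4 \<cong>\<^sub>f\<^sub>s VPS_space F 4"
    unfolding VSP_space_def VPS_space_def VSP VPS
    by (rule fs_equiv_isomorphic[OF fs_equiv_trans[OF 1 fs_equiv_sym[OF 2]]])
  show "VPS_space F 4 \<cong>\<^sub>f\<^sub>s proj_space pscale (Ann F \<inter> graded_piece 2)"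
    unfolding VPS_space_def VPS F proj_space_def
    by (rule fs_equiv_isomorphic[OF fs_equiv_trans[OF 2 fs_equiv_sym[OF proj_ann_equiv]]])
  show "proj_space pscale (Ann F \<inter> graded_piece 2) \<cong>\<^sub>f\<^sub>s P2"
    unfolding F proj_space_def by (rule fs_equiv_isomorphic[OF proj_ann_equiv])
qed

lemma below_single:
  "below a b c (Poly_Mapping.single j n) \<longleftrightarrow> n \<le> (if j = 0 then a else if j = 1 then b else c)"
proof -
  have "below a b c (Poly_Mapping.single j n) \<longleftrightarrow>
      (j = 0 \<longrightarrow> n \<le> a) \<and> (j = 1 \<longrightarrow> n \<le> b) \<and> (j = 2 \<longrightarrow> n \<le> c)"
    by (auto simp: below_def lookup_single when_def)
  then show ?thesis using three_cases[of j] by auto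
qed

text \<open>For a = 1 the variables 1 and 2 have exponent b = c and enter through their powers of
  degree c + 1; the remaining generator is the square of variable 0, of degree 2 \<le> c because b >
  1.\<close>

lemma pencil_family:
  assumes "1 < b"
  shows "apolar_family (\<lambda>i :: 2. if i = 1 then 1 else 2) (b + 1) (\<lambda>_. 2) 1 b b (2 * (b + 1))"
proof
  let ?x = "\<lambda>i :: 2. if i = 1 then 1 else 2 :: 3"
  have r: "range ?x = {1, 2}" by (auto simp: UNIV_2)
  have out: "j = 0" if "j \<notin> range ?x" for j using that three_cases[of j] unfolding r by auto
  show "inj ?x" using exhaust_2 by (auto simp: inj_on_def split: if_splits)
  show "0 < (2 :: nat) \<and> 2 \<le> b \<and> \<not> below 1 b b (Poly_Mapping.single j 2)" if "j \<notin> range ?x" for j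
    unfolding below_single using out[OF that] assms by simp
  show "(\<forall>i j :: 2. i = j) \<or> b + 1 = Suc b \<and> (\<forall>i. \<not> below 1 b b (Poly_Mapping.single (?x i) (b + 1)))"
    unfolding below_single by simp
  have C: "- {1} = {0, 2 :: 3}" "- {2} = {0, 1 :: 3}" using three_cases by auto
  show "(\<Prod>j\<in>- {?x p}. if j \<in> range ?x then b + 1 else 2) = 2 * (b + 1)" for p
    unfolding r by (simp add: C)
qed (use assms in auto)

lemma case_one:
  assumes b: "1 < b" and F: "Ann F = monomial_ann 1 b b"
  shows "VSP_of_fiber_type F (2 * (b + 1))"
    and "VPS F (2 * (b + 1)) = {Proj_quot (tideal.span {Var 0 ^ 2,
      pscale s (Var 1 ^ (b + 1)) + pscale t (Var 2 ^ (b + 1))}) | s t. (s, t) \<noteq> (0, 0)}"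
    and "VPS_space F (2 * (b + 1)) \<cong>\<^sub>f\<^sub>s P1"
proof -
  let ?x = "\<lambda>i :: 2. if i = 1 then 1 else 2 :: 3"
  interpret A: apolar_family ?x "b + 1" "\<lambda>_. 2" 1 b b "2 * (b + 1)" by (rule pencil_family[OF b])
  have x: "?x 1 = 1" "?x 2 = 2" by simp_all
  have r: "range ?x = {1, 2}" by (auto simp: UNIV_2)
  show "VSP_of_fiber_type F (2 * (b + 1))" by (rule A.fiber_type[OF F])
  have VPS: "VPS F (2 * (b + 1)) = A.J ` {w. w \<noteq> 0}" by (rule A.VPS_eq_family[OF F])
  have "fs_equiv (A.J ` {w. w \<noteq> 0}) (ideal_coords {2 * (b + 1)..})
      (proj_points (*s) (UNIV :: (complex ^ 2) set)) (proj_coords (*s))"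
    by (rule A.family_equiv_proj_space[of "2 * (b + 1)"]) simp_all
  then show "VPS_space F (2 * (b + 1)) \<cong>\<^sub>f\<^sub>s P1"
    unfolding VPS_space_def VPS proj_space_def by (rule fs_equiv_isomorphic)
  let ?G = "\<lambda>s t. {Var 0 ^ 2, pscale s (Var 1 ^ (b + 1)) + pscale t (Var 2 ^ (b + 1))}"
  have gens: "A.gens p w = {Var 0 ^ 2} \<union>
      {Var (?x i) ^ (b + 1) - pscale (w $ i / w $ p) (Var (?x p) ^ (b + 1)) | i. True}" for p w
  proof -
    have "j \<notin> range ?x \<longleftrightarrow> j = 0" for j using three_cases[of j] unfolding r by auto
    then show ?thesis by (simp only: A.gens_def) auto
  qed
  \<comment> \<open>The coefficient vector (s, t) annihilates (t, -s), which is unique up to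
    scalars.\<close>
  have main: "Proj_quot (tideal.span (?G s t)) = A.J w"
    if w: "w $ 1 = t" "w $ 2 = - s" "w $ p \<noteq> 0" for s t p w
  proof (rule A.Proj_quot_span[OF w(3)])
    let ?g = "pscale s (Var 1 ^ (b + 1)) + pscale t (Var 2 ^ (b + 1))"
    let ?h = "\<lambda>i. Var (?x i) ^ (b + 1) - pscale (w $ i / w $ p) (Var (?x p) ^ (b + 1))"
    have hp: "?h p = 0" using w(3) by simp
    \<comment> \<open>\<open>q\<close> is the index other than \<open>p\<close>; its binomial is the
      given form up to the scalar \<open>d\<close>, while the binomial of \<open>p\<close> is
      zero.\<close>
    obtain q d where q: "\<And>i. i = p \<or> i = q" and d: "d \<noteq> 0" "?g = pscale d (?h q)"
    proof (cases "p = 1")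
      case True
      then have "t \<noteq> 0" using w by simp
      moreover have "pscale s A + pscale t B = pscale t (B - pscale (- s / t) A)" for A B
        using \<open>t \<noteq> 0\<close> by (intro poly_mapping_eqI) (simp add: lookup_add lookup_minus field_simps)
      then have "?g = pscale t (?h 2)" unfolding True w(1,2) x .
      ultimately show ?thesis using that[of 2 t] True exhaust_2 by blast
    next
      case False
      then have p: "p = 2" using exhaust_2 by blast
      then have "s \<noteq> 0" using w by simp
      moreover have "pscale s A + pscale t B = pscale s (A - pscale (t / - s) B)" for A B
        using \<open>s \<noteq> 0\<close> by (intro poly_mapping_eqI) (simp add: lookup_add lookup_minus field_simps)
      then have "?g = pscale s (?h 1)" unfolding p w(1,2) x .
      ultimately show ?thesis using that[of 1 s] p exhaust_2 by blast
    qed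
    have gJ: "A.gens p w \<subseteq> A.J w" by (rule A.gens_subset_J[OF w(3)])
    have "?h q \<in> A.J w" using gJ unfolding gens by blast
    then have "?g \<in> A.J w" unfolding d(2) by (rule ideal_pscale[OF A.ideal_J])
    then show "?G s t \<subseteq> A.J w" using gJ unfolding gens by blast
    have "?g \<in> tideal.span (?G s t)" by (rule tideal.span_base) simp
    then have "pscale (inverse d) (pscale d (?h q)) \<in> tideal.span (?G s t)"
      unfolding d(2) by (rule ideal_pscale[OF tideal.subspace_span])
    then have "?h q \<in> tideal.span (?G s t)"
      unfolding tpoly.scale_scale left_inverse[OF d(1)] tpoly.scale_one .
    then have "?h i \<in> tideal.span (?G s t)" for i
      using q[of i] hp tideal.span_zero by metis
    moreover have "Var 0 ^ 2 \<in> tideal.span (?G s t)" by (rule tideal.span_base) simp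
    ultimately show "A.gens p w \<subseteq> tideal.span (?G s t)" unfolding gens by blast
  qed
  show "VPS F (2 * (b + 1)) = {Proj_quot (tideal.span (?G s t)) | s t. (s, t) \<noteq> (0, 0)}"
    unfolding VPS
  proof (intro equalityI subsetI)
    fix I assume "I \<in> A.J ` {w. w \<noteq> 0}"
    then obtain w where w: "w \<noteq> 0" "I = A.J w" by auto
    obtain p where p: "w $ p \<noteq> 0" using w(1) by (metis vec_eq_iff zero_index)
    have "I = Proj_quot (tideal.span (?G (- (w $ 2)) (w $ 1)))"
      using main[of w "w $ 1" "- (w $ 2)" p] p w(2) by simp
    moreover have "(- (w $ 2), w $ 1) \<noteq> (0, 0)" using p exhaust_2[of p] by auto
    ultimately show "I \<in> {Proj_quot (tideal.span (?G s t)) | s t. (s, t) \<noteq> (0, 0)}" by blast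
  next
    fix I assume "I \<in> {Proj_quot (tideal.span (?G s t)) | s t. (s, t) \<noteq> (0, 0)}"
    then obtain s t where st: "I = Proj_quot (tideal.span (?G s t))" "(s, t) \<noteq> (0, 0)" by blast
    define w :: "complex ^ 2" where "w = (\<chi> i. if i = 1 then t else - s)"
    have w: "w $ 1 = t" "w $ 2 = - s" by (simp_all add: w_def)
    then obtain p where p: "w $ p \<noteq> 0" using st(2) by (metis neg_equal_0_iff_equal)
    have "w \<noteq> 0" using p by auto
    then show "I \<in> A.J ` {w. w \<noteq> 0}" using main[OF w p] st(1) by blast
  qed
qed

text \<open>From a \<ge> 2 follows b + 1 \<le> c, so the pure powers of variables 0 and 1 both have
  degree at most c and no parameter is left.\<close>

lemma rigid_family:
  assumes "2 \<le> a" "a \<le> b" "c = a + b - 1" "r = (a + 1) * (b + 1)"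
  shows "apolar_family (\<lambda>_ :: 1. 2) 1 (\<lambda>j. if j = 0 then a + 1 else b + 1) a b c r"
proof
  let ?x = "\<lambda>_ :: 1. 2 :: 3"
  have r: "range ?x = {2}" by auto
  have out: "j = 0 \<or> j = 1" if "j \<notin> range ?x" for j using that three_cases[of j] unfolding r by auto
  show "inj ?x" by (auto simp: inj_on_def)
  show "0 < (if j = 0 then a + 1 else b + 1) \<and> (if j = 0 then a + 1 else b + 1) \<le> c \<and>
      \<not> below a b c (Poly_Mapping.single j (if j = 0 then a + 1 else b + 1))" if "j \<notin> range ?x" for j
    unfolding below_single using out[OF that] assms by auto
  show "(\<forall>i j :: 1. i = j) \<or> 1 = Suc c \<and> (\<forall>i. \<not> below a b c (Poly_Mapping.single (?x i) 1))" by simp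
  have C: "- {2} = {0, 1 :: 3}" using three_cases by auto
  show "(\<Prod>j\<in>- {?x p}. if j \<in> range ?x then 1 else if j = 0 then a + 1 else b + 1) = r" for p
    unfolding r assms by (simp add: C)
qed (use assms in auto)

lemma case_ge_two:
  assumes abcr: "2 \<le> a" "a \<le> b" "c = a + b - 1" "r = (a + 1) * (b + 1)"
    and F: "Ann F = monomial_ann a b c"
  shows "VSP_of_fiber_type F r"
    and "VPS F r = {Proj_quot (tideal.span {Var 0 ^ (a + 1), Var 1 ^ (b + 1)})}"
proof -
  let ?x = "\<lambda>_ :: 1. 2 :: 3" and ?bd = "\<lambda>j :: 3. if j = 0 then a + 1 else b + 1"
  interpret A: apolar_family ?x 1 ?bd a b c r by (rule rigid_family[OF abcr])
  show "VSP_of_fiber_type F r" by (rule A.fiber_type[OF F])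
  let ?G = "{Var 0 ^ (a + 1), Var 1 ^ (b + 1)}"
  have main: "Proj_quot (tideal.span ?G) = A.J w" if "w \<noteq> 0" for w
  proof -
    from that obtain p where p: "w $ p \<noteq> 0" by (metis vec_eq_iff zero_index)
    have gens: "A.gens p w = ?G \<union> {0}"
    proof -
      have "{Var j ^ ?bd j | j. j \<notin> range ?x} = ?G"
      proof -
        have out: "j \<notin> range ?x \<longleftrightarrow> j = 0 \<or> j = 1" for j using three_cases[of j] by auto
        have "{f j | j. j \<notin> range ?x} = {f 0, f 1}" for f :: "3 \<Rightarrow> tpoly"
          unfolding out by blast
        from this[of "\<lambda>j. Var j ^ ?bd j"] show ?thesis by simp
      qed
      moreover have "{Var (?x i) ^ 1 - pscale (w $ i / w $ p) (Var (?x p) ^ 1) | i. True} = {0}"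
      proof -
        have "\<forall>i j :: 1. i = j" by simp
        then have ip: "i = p" for i by blast
        have one: "w $ i / w $ p = 1" for i unfolding ip[of i] using p by simp
        show ?thesis unfolding one by simp
      qed
      ultimately show ?thesis by (simp only: A.gens_def)
    qed
    show ?thesis
    proof (rule A.Proj_quot_span[OF p])
      show "?G \<subseteq> A.J w" using A.gens_subset_J[OF p] unfolding gens by blast
      show "A.gens p w \<subseteq> tideal.span ?G"
        unfolding gens using tideal.span_superset[of ?G] tideal.span_zero[of ?G] by blast
    qed
  qed
  have "(\<chi> i. 1) \<noteq> (0 :: complex ^ 1)" by (simp add: vec_eq_iff)
  then have "A.J ` {w. w \<noteq> 0} = {Proj_quot (tideal.span ?G)}" using main by blast
  then show "VPS F r = {Proj_quot (tideal.span ?G)}" using A.VPS_eq_family[OF F] by simp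
qed

theorem theorem8p12:
  fixes a b c r :: nat and F :: tpoly
  assumes "F = Var 0 ^ a * Var 1 ^ b * Var 2 ^ c"
    and "0 < a" and "a \<le> b" and "b \<le> c"
    and "r = (a + 1) * (b + 1)"
    and "c = a + b - 1"
  shows "VSP_of_fiber_type F r \<and>
    (a = 1 \<and> b = 1 \<longrightarrow>
      VSP_space F 4 \<cong>\<^sub>f\<^sub>s VPS_space F 4 \<and>
      VPS_space F 4 \<cong>\<^sub>f\<^sub>s proj_space pscale (Ann F \<inter> graded_piece 2) \<and>
      proj_space pscale (Ann F \<inter> graded_piece 2) \<cong>\<^sub>f\<^sub>s P2) \<and>
    (a = 1 \<and> 1 < b \<longrightarrow>
      VPS F (2 * (b + 1)) =
        {Proj_quot (tideal.span {Var 0 ^ 2,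
            pscale s (Var 1 ^ (b + 1)) + pscale t (Var 2 ^ (b + 1))}) | s t. (s, t) \<noteq> (0, 0)} \<and>
      VPS_space F (2 * (b + 1)) \<cong>\<^sub>f\<^sub>s P1) \<and>
    (2 \<le> a \<longrightarrow>
      VPS F r = {Proj_quot (tideal.span {Var 0 ^ (a + 1), Var 1 ^ (b + 1)})})"
proof -
  have F: "Ann F = monomial_ann a b c" unfolding assms(1) by (rule Ann_power_product)
  consider (1) "a = 1" "b = 1" | (2) "a = 1" "1 < b" | (3) "2 \<le> a" using assms(2,3) by linarith
  then show ?thesis
  proof cases
    case 1
    then have c: "c = 1" "r = 4" using assms by simp_all
    have F1: "Ann F = monomial_ann 1 1 1" using F by (simp only: 1 c)
    show ?thesis
      unfolding c(2) using quadrics.fiber_type[OF F1] case_one_one[OF F1] 1 by simp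
  next
    case 2
    then have c: "c = b" "r = 2 * (b + 1)" using assms by simp_all
    have F1: "Ann F = monomial_ann 1 b b" using F by (simp only: 2 c)
    show ?thesis unfolding c(2) using case_one[OF 2(2) F1] 2 by linarith
  next
    case 3
    show ?thesis using case_ge_two[OF 3 assms(3,6,5) F] 3 by linarith
  qed
qed

end
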